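(* The almost minimal varieties in the lattice of subvarieties of $K(\mathsf{WA})$ are exactly $K(\mathsf{BA})$, the varieties $\mathbb V(\mathbf K_{0,p})$ for $p$ prime, and $\mathbb V(K_0(\mathbf{Ł}_1^\omega))$.
   Context: $\mathsf{BCRL}$ is the variety of bounded commutative residuated lattices $(A,\vee,\wedge,\cdot,\to,0,1)$ (lattice, commutative monoid $(A,\cdot,1)$, $ab\le c$ iff $a\le b\to c$, $1$ greatest, $0$ least). For $\mathbf A\in\mathsf{BCRL}$, $K(\mathbf A)$ is the algebra on $A\times A$ with $(a,b)\vee(c,d)=(a\vee c,b\wedge d)$, $(a,b)\wedge(c,d)=(a\wedge c,b\vee d)$, $(a,b)(c,d)=(ac,(a\to d)\wedge(c\to b))$, $(a,b)\to(c,d)=((a\to c)\wedge(d\to b),ad)$, unit $(1,1)$, constant $0$ as $(0,1)$. With $\sim x:=x\to1$, a bounded K-lattice is a commutative residuated lattice with extra constant $0\le x$ satisfying $\sim\sim x=x$, the lattice distributive laws whenever one of the three elements is $1$, and $xy\wedge 1=(x\wedge1)(y\wedge1)$, $((x\wedge1)\to y)\wedge((\sim y\wedge 1)\to\sim x)=x\to y$. For such $\mathbf A$, $\mathbf A^-$ is the algebra on $\{a\le 1\}$ with the same $\vee,\wedge,\cdot,0,1$ and $a\to^-b=(a\to b)\wedge1$. A subalgebra $\mathbf B$ of a bounded K-lattice $\mathbf A$ is admissible if $B^-=A^-$; $K_0(\mathbf A)$ denotes the smallest admissible subalgebra of $K(\mathbf A)$. A Wajsberg algebra is a member of $\mathsf{BCRL}$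 satisfying $x(x\to y)=y(y\to x)$ and $(x\to y)\to y=(y\to x)\to x$ (i.e. an MV-algebra); $\mathsf{WA}$ is their variety, $\mathsf{BA}$ the variety of Boolean algebras, and for a subvariety $\mathcal V\subseteq\mathsf{BCRL}$, $K(\mathcal V)$ is the class of bounded K-lattices $\mathbf A$ with $\mathbf A^-\in\mathcal V$. $\mathbf{Ł}_n$ is the chain $\{0,1/n,\dots,1\}$ with $xy=\max(0,x+y-1)$, $x\to y=\min(1,1-x+y)$; set $u\oplus v=\min(1,u+v)$. $\mathbf K_{0,p}$ is the subalgebra of $K(\mathbf{Ł}_p)$ with universe $\{(u,v): u\oplus v=1\}$. The Chang algebra $\mathbf{Ł}_1^\omega$ has universe $\{p\in\mathbb Z\times\mathbb Z:(0,0)\le p\le(1,0)\}$ in the lexicographic order, with $p\cdot q=\max((0,0),p+q-(1,0))$, $p\to q=\min((1,0),(1,0)-p+q)$, $0=(0,0)$, $1=(1,0)$. A variety is almost minimal if it covers an atom of the lattice of subvarieties. *)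

theory Defs
  imports
    Complex_Main
    "HOL-Algebra.Group"
    "HOL-Library.Product_Lexorder"
    "HOL-Library.Product_Plus"
    "HOL-Computational_Algebra.Primes"
begin

section \<open>Algebras in the signature of bounded residuated lattices\<close>

record 'a rl = "'a monoid" +
  join :: "'a \<Rightarrow> 'a \<Rightarrow> 'a"  (infixl \<open>\<curlyvee>\<index>\<close> 65)
  meet :: "'a \<Rightarrow> 'a \<Rightarrow> 'a"  (infixl \<open>\<curlywedge>\<index>\<close> 68)
  imp  :: "'a \<Rightarrow> 'a \<Rightarrow> 'a"  (infixr \<open>\<leadsto>\<index>\<close> 60)
  zero :: 'a  (\<open>\<zero>\<index>\<close>)

definition below :: "'a rl \<Rightarrow> 'a \<Rightarrow> 'a \<Rightarrow> bool"  (infix \<open>\<preceq>\<index>\<close> 50)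
  where "x \<preceq>\<^bsub>A\<^esub> y \<longleftrightarrow> x \<curlywedge>\<^bsub>A\<^esub> y = x"

locale rl_algebra =
  fixes A :: "'a rl" (structure)
  assumes mult_in: "x \<in> carrier A \<Longrightarrow> y \<in> carrier A \<Longrightarrow> x \<otimes> y \<in> carrier A"
    and join_in: "x \<in> carrier A \<Longrightarrow> y \<in> carrier A \<Longrightarrow> x \<curlyvee> y \<in> carrier A"
    and meet_in: "x \<in> carrier A \<Longrightarrow> y \<in> carrier A \<Longrightarrow> x \<curlywedge> y \<in> carrier A"
    and imp_in: "x \<in> carrier A \<Longrightarrow> y \<in> carrier A \<Longrightarrow> (x \<leadsto> y) \<in> carrier A"
    and one_in: "\<one> \<in> carrier A"
    and zero_in: "\<zero> \<in> carrier A"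

locale comm_residuated_lattice = rl_algebra A + comm_monoid A
  for A :: "'a rl" (structure) +
  assumes join_commute: "\<lbrakk>x \<in> carrier A; y \<in> carrier A\<rbrakk> \<Longrightarrow> x \<curlyvee> y = y \<curlyvee> x"
    and meet_commute: "\<lbrakk>x \<in> carrier A; y \<in> carrier A\<rbrakk> \<Longrightarrow> x \<curlywedge> y = y \<curlywedge> x"
    and join_assoc: "\<lbrakk>x \<in> carrier A; y \<in> carrier A; z \<in> carrier A\<rbrakk>
      \<Longrightarrow> (x \<curlyvee> y) \<curlyvee> z = x \<curlyvee> (y \<curlyvee> z)"
    and meet_assoc: "\<lbrakk>x \<in> carrier A; y \<in> carrier A; z \<in> carrier A\<rbrakk>
      \<Longrightarrow> (x \<curlywedge> y) \<curlywedge> z = x \<curlywedge> (y \<curlywedge> z)"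
    and join_absorb: "\<lbrakk>x \<in> carrier A; y \<in> carrier A\<rbrakk> \<Longrightarrow> x \<curlyvee> (x \<curlywedge> y) = x"
    and meet_absorb: "\<lbrakk>x \<in> carrier A; y \<in> carrier A\<rbrakk> \<Longrightarrow> x \<curlywedge> (x \<curlyvee> y) = x"
    and residuation: "\<lbrakk>x \<in> carrier A; y \<in> carrier A; z \<in> carrier A\<rbrakk>
      \<Longrightarrow> x \<otimes> y \<preceq> z \<longleftrightarrow> x \<preceq> (y \<leadsto> z)"

locale bounded_comm_residuated_lattice = comm_residuated_lattice +
  assumes zero_least: "x \<in> carrier A \<Longrightarrow> \<zero> \<preceq> x"
    and one_greatest: "x \<in> carrier A \<Longrightarrow> x \<preceq> \<one>"

locale wajsberg_algebra = bounded_comm_residuated_lattice +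
  assumes divisible: "\<lbrakk>x \<in> carrier A; y \<in> carrier A\<rbrakk>
      \<Longrightarrow> x \<otimes> (x \<leadsto> y) = y \<otimes> (y \<leadsto> x)"
    and wajsberg: "\<lbrakk>x \<in> carrier A; y \<in> carrier A\<rbrakk>
      \<Longrightarrow> ((x \<leadsto> y) \<leadsto> y) = ((y \<leadsto> x) \<leadsto> x)"

text \<open>A Boolean algebra, in this signature: a complemented distributive lattice whose monoid
  operation is the meet; the residuum is then the Boolean implication and
  \<open>x \<leadsto> \<zero>\<close> the complement of \<open>x\<close>.\<close>

locale boolean_rl = bounded_comm_residuated_lattice +
  assumes mult_eq_meet: "\<lbrakk>x \<in> carrier A; y \<in> carrier A\<rbrakk> \<Longrightarrow> x \<otimes> y = x \<curlywedge> y"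
    and distrib: "\<lbrakk>x \<in> carrier A; y \<in> carrier A; z \<in> carrier A\<rbrakk>
      \<Longrightarrow> x \<curlywedge> (y \<curlyvee> z) = (x \<curlywedge> y) \<curlyvee> (x \<curlywedge> z)"
    and meet_compl: "x \<in> carrier A \<Longrightarrow> x \<curlywedge> (x \<leadsto> \<zero>) = \<zero>"
    and join_compl: "x \<in> carrier A \<Longrightarrow> x \<curlyvee> (x \<leadsto> \<zero>) = \<one>"

definition tilde :: "'a rl \<Rightarrow> 'a \<Rightarrow> 'a"  (\<open>\<sim>\<index> _\<close> [81] 80)
  where "\<sim>\<^bsub>A\<^esub> x = (x \<leadsto>\<^bsub>A\<^esub> \<one>\<^bsub>A\<^esub>)"

locale bounded_K_lattice = comm_residuated_lattice +
  assumes zero_least: "x \<in> carrier A \<Longrightarrow> \<zero> \<preceq> x"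
    and tilde_tilde: "x \<in> carrier A \<Longrightarrow> \<sim> (\<sim> x) = x"
    and meet_distrib: "\<lbrakk>x \<in> carrier A; y \<in> carrier A; z \<in> carrier A; \<one> \<in> {x, y, z}\<rbrakk>
      \<Longrightarrow> x \<curlywedge> (y \<curlyvee> z) = (x \<curlywedge> y) \<curlyvee> (x \<curlywedge> z)"
    and join_distrib: "\<lbrakk>x \<in> carrier A; y \<in> carrier A; z \<in> carrier A; \<one> \<in> {x, y, z}\<rbrakk>
      \<Longrightarrow> x \<curlyvee> (y \<curlywedge> z) = (x \<curlyvee> y) \<curlywedge> (x \<curlyvee> z)"
    and mult_meet_one: "\<lbrakk>x \<in> carrier A; y \<in> carrier A\<rbrakk>
      \<Longrightarrow> (x \<otimes> y) \<curlywedge> \<one> = (x \<curlywedge> \<one>) \<otimes> (y \<curlywedge> \<one>)"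
    and imp_decomp: "\<lbrakk>x \<in> carrier A; y \<in> carrier A\<rbrakk>
      \<Longrightarrow> ((x \<curlywedge> \<one>) \<leadsto> y) \<curlywedge> ((\<sim> y \<curlywedge> \<one>) \<leadsto> \<sim> x) = (x \<leadsto> y)"

section \<open>The K-construction and negative cones\<close>

definition K_alg :: "'a rl \<Rightarrow> ('a \<times> 'a) rl" where
  "K_alg A = \<lparr>
     carrier = carrier A \<times> carrier A,
     monoid.mult = (\<lambda>(a, b) (c, d). (a \<otimes>\<^bsub>A\<^esub> c, (a \<leadsto>\<^bsub>A\<^esub> d) \<curlywedge>\<^bsub>A\<^esub> (c \<leadsto>\<^bsub>A\<^esub> b))),
     one = (\<one>\<^bsub>A\<^esub>, \<one>\<^bsub>A\<^esub>),
     join = (\<lambda>(a, b) (c, d). (a \<curlyvee>\<^bsub>A\<^esub> c, b \<curlywedge>\<^bsub>A\<^esub> d)),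
     meet = (\<lambda>(a, b) (c, d). (a \<curlywedge>\<^bsub>A\<^esub> c, b \<curlyvee>\<^bsub>A\<^esub> d)),
     imp = (\<lambda>(a, b) (c, d). ((a \<leadsto>\<^bsub>A\<^esub> c) \<curlywedge>\<^bsub>A\<^esub> (d \<leadsto>\<^bsub>A\<^esub> b), a \<otimes>\<^bsub>A\<^esub> d)),
     zero = (\<zero>\<^bsub>A\<^esub>, \<one>\<^bsub>A\<^esub>)\<rparr>"

definition neg_cone :: "'a rl \<Rightarrow> 'a rl" where
  "neg_cone A = A\<lparr>
     carrier := {a \<in> carrier A. a \<preceq>\<^bsub>A\<^esub> \<one>\<^bsub>A\<^esub>},
     imp := (\<lambda>a b. (a \<leadsto>\<^bsub>A\<^esub> b) \<curlywedge>\<^bsub>A\<^esub> \<one>\<^bsub>A\<^esub>)\<rparr>"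

definition subuniverse :: "'a set \<Rightarrow> 'a rl \<Rightarrow> bool" where
  "subuniverse B A \<longleftrightarrow> B \<subseteq> carrier A \<and> rl_algebra (A\<lparr>carrier := B\<rparr>)"

definition admissible :: "'a set \<Rightarrow> 'a rl \<Rightarrow> bool" where
  "admissible B A \<longleftrightarrow> subuniverse B A \<and> neg_cone (A\<lparr>carrier := B\<rparr>) = neg_cone A"

definition K0_alg :: "'a rl \<Rightarrow> ('a \<times> 'a) rl" where
  "K0_alg A = (K_alg A)\<lparr>carrier := \<Inter>{B. admissible B (K_alg A)}\<rparr>"

section \<open>Lukasiewicz chains and the Chang algebra\<close>

definition luk :: "nat \<Rightarrow> real rl" where
  "luk n = \<lparr>
     carrier = {real k / real n |k. k \<le> n},
     monoid.mult = (\<lambda>x y. max 0 (x + y - 1)),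
     one = 1,
     join = max,
     meet = min,
     imp = (\<lambda>x y. min 1 (1 - x + y)),
     zero = 0\<rparr>"

definition oplus :: "real \<Rightarrow> real \<Rightarrow> real" where
  "oplus u v = min 1 (u + v)"

definition K0p :: "nat \<Rightarrow> (real \<times> real) rl" where
  "K0p p = (K_alg (luk p))
     \<lparr>carrier := {(u, v). u \<in> carrier (luk p) \<and> v \<in> carrier (luk p) \<and> oplus u v = 1}\<rparr>"

text \<open>Here \<open>\<le>\<close>, \<open>max\<close> and \<open>min\<close> refer to the lexicographic order of
  \<^theory>\<open>HOL-Library.Product_Lexorder\<close>, and addition and subtraction are componentwise.\<close>

definition chang :: "(int \<times> int) rl" where
  "chang = \<lparr>
     carrier = {p. (0, 0) \<le> p \<and> p \<le> (1, 0)},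
     monoid.mult = (\<lambda>p q. max (0, 0) (p + q - (1, 0))),
     one = (1, 0),
     join = max,
     meet = min,
     imp = (\<lambda>p q. min (1, 0) ((1, 0) - p + q)),
     zero = (0, 0)\<rparr>"

section \<open>Equations and varieties\<close>

datatype rl_term =
    Var nat
  | Join rl_term rl_term
  | Meet rl_term rl_term
  | Mult rl_term rl_term
  | Imp rl_term rl_term
  | Zero
  | One

primrec eval :: "'a rl \<Rightarrow> (nat \<Rightarrow> 'a) \<Rightarrow> rl_term \<Rightarrow> 'a" where
  "eval A e (Var n) = e n"
| "eval A e (Join s t) = eval A e s \<curlyvee>\<^bsub>A\<^esub> eval A e t"
| "eval A e (Meet s t) = eval A e s \<curlywedge>\<^bsub>A\<^esub> eval A e t"
| "eval A e (Mult s t) = eval A e s \<otimes>\<^bsub>A\<^esub> eval A e t"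
| "eval A e (Imp s t) = (eval A e s \<leadsto>\<^bsub>A\<^esub> eval A e t)"
| "eval A e Zero = \<zero>\<^bsub>A\<^esub>"
| "eval A e One = \<one>\<^bsub>A\<^esub>"

definition satisfies :: "'a rl \<Rightarrow> (rl_term \<times> rl_term) set \<Rightarrow> bool" where
  "satisfies A E \<longleftrightarrow>
     (\<forall>(s, t) \<in> E. \<forall>e. range e \<subseteq> carrier A \<longrightarrow> eval A e s = eval A e t)"

text \<open>HOL has no proper classes, so a class of algebras is a set of algebras whose carriers are
  subsets of one type \<open>'u\<close>. As the signature is countable, an equational class is determined by its
  countable members; hence, for every infinite \<open>'u\<close>, the sets \<open>models E\<close> ordered by inclusion form
  the same lattice as the equational classes of all algebras. Operations are unconstrained outside
  the carrier; none of the classes below depends on their values there.\<close>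

definition models :: "(rl_term \<times> rl_term) set \<Rightarrow> 'u rl set" where
  "models E = {A. rl_algebra A \<and> satisfies A E}"

definition variety :: "'u rl set \<Rightarrow> bool" where
  "variety V \<longleftrightarrow> (\<exists>E. V = models E)"

text \<open>The smallest variety containing \<open>A\<close>. The carrier type of \<open>A\<close> may differ from \<open>'u\<close>, so that
  \<open>A\<close> belongs to a variety is expressed by \<open>A\<close> satisfying its defining equations.\<close>

definition variety_of :: "'a rl \<Rightarrow> 'u rl set" where
  "variety_of A = \<Inter>{models E |E. satisfies A E}"

definition WA :: "'u rl set" where
  "WA = {A. wajsberg_algebra A}"

definition BA :: "'u rl set" where
  "BA = {A. boolean_rl A}"

definition K_class :: "'u rl set \<Rightarrow> 'u rl set" where
  "K_class V = {A. bounded_K_lattice A \<and> neg_cone A \<in> V}"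

section \<open>Almost minimal varieties\<close>

definition subvarieties :: "'u rl set \<Rightarrow> 'u rl set set" where
  "subvarieties C = {V. variety V \<and> V \<subseteq> C}"

definition covered_in :: "'b set set \<Rightarrow> 'b set \<Rightarrow> 'b set \<Rightarrow> bool" where
  "covered_in L U V \<longleftrightarrow> U \<in> L \<and> V \<in> L \<and> U \<subset> V \<and> \<not> (\<exists>W \<in> L. U \<subset> W \<and> W \<subset> V)"

definition atom_in :: "'b set set \<Rightarrow> 'b set \<Rightarrow> bool" where
  "atom_in L U \<longleftrightarrow> (\<exists>b \<in> L. (\<forall>W \<in> L. b \<subseteq> W) \<and> covered_in L b U)"

definition almost_minimal :: "'b set set \<Rightarrow> 'b set \<Rightarrow> bool" where
  "almost_minimal L V \<longleftrightarrow> (\<exists>U. atom_in L U \<and> covered_in L U V)"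

end

theory Submission
  imports Defs "HOL-Library.Countable_Set"
begin

text \<open>A member \<open>A\<close> of \<open>K(WA)\<close> embeds into \<open>K(A\<^sup>-)\<close> by \<open>x \<mapsto> (x \<and> 1, \<sim>x \<and> 1)\<close>. An equation failing in \<open>A\<close>
  still fails after passing to the quotient of \<open>A\<^sup>-\<close> by a suitable prime filter, so it fails in a
  subalgebra \<open>B\<close> of some \<open>K(D)\<close> with \<open>D\<close> a Wajsberg chain and \<open>D \<times> {1} \<subseteq> B\<close>; such a \<open>B\<close> contains every
  \<open>(u, v)\<close> with \<open>u \<oplus> v = 1\<close>. If \<open>D\<close> is the two-element chain, \<open>B\<close> is \<open>K(2)\<close> or the three-element
  algebra \<open>K\<^sub>0(2)\<close>, which generates the only atom. Otherwise either \<open>D\<close> has arbitrarily small nonzero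
  elements \<open>a\<close>, in the sense that \<open>na \<le> \<not>a\<close> with \<open>n\<close> arbitrarily large, and then every finite part
  of \<open>K\<^sub>0\<close> of the Chang algebra embeds into \<open>B\<close>; or a nonzero \<open>a\<close> with \<open>na \<le> \<not>a\<close> and \<open>n\<close> maximal
  satisfies \<open>na = \<not>a\<close>, and then \<open>K\<^sub>0\<close> of the \<open>(n+1)\<close>-chain and of its \<open>p\<close>-subchains for primes
  \<open>p\<close> dividing \<open>n + 1\<close> embed into \<open>B\<close>. So every variety properly above the atom contains one of the listed
  ones, and explicit equations show that these are pairwise incomparable. The class \<open>K(BA)\<close> is the
  variety generated by \<open>K(2)\<close>.\<close>

section \<open>Residuated lattices and Wajsberg algebras\<close>

text \<open>A class of algebras lives on one fixed type, while the generators live on other types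
  and an ultraproduct would leave every given one. The argument therefore runs on equations: a
  generator is placed below a variety by transporting to it all equations of some B, and an
  embedding into an ultraproduct is replaced by a sequence of maps each finite part of which is
  eventually correct. Two computations carry the case analysis. The pair (u, v) with u \<oplus> v =
  1 is the product (u, 1)(1, uv). And na = \<not>a for maximal n because a nonzero remainder
  \<not>((n+1)a) would be smaller than a and would yield a nonzero element fitting twice into a, for
  which n + 1 works. Pairs with second component 1 form a copy of D, and the term translation
  \<open>cone\<close> evaluates in that copy. Hence the subalgebras B of K(D) are separated by
  equations of the chains D themselves; only K(2) needs an equation that looks at both
  components.\<close>

context comm_residuated_lattice
begin

lemmas closed [simp] = mult_in join_in meet_in imp_in one_in zero_in

declare m_closed [rule del]

lemma meet_idem [simp]: "x \<in> carrier A \<Longrightarrow> x \<curlywedge> x = x"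
  by (metis join_absorb meet_absorb meet_in)

lemma le_refl [simp]: "x \<in> carrier A \<Longrightarrow> x \<preceq> x"
  by (simp add: below_def)

lemma le_antisym: "\<lbrakk>x \<preceq> y; y \<preceq> x; x \<in> carrier A; y \<in> carrier A\<rbrakk> \<Longrightarrow> x = y"
  by (metis below_def meet_commute)

lemma le_trans: "\<lbrakk>x \<preceq> y; y \<preceq> z; x \<in> carrier A; y \<in> carrier A; z \<in> carrier A\<rbrakk> \<Longrightarrow> x \<preceq> z"
  by (metis below_def meet_assoc)

lemma le_join_iff: "\<lbrakk>x \<in> carrier A; y \<in> carrier A\<rbrakk> \<Longrightarrow> x \<preceq> y \<longleftrightarrow> x \<curlyvee> y = y"
  by (metis below_def join_absorb join_commute meet_absorb meet_commute)

lemma meet_le1 [simp]: "\<lbrakk>x \<in> carrier A; y \<in> carrier A\<rbrakk> \<Longrightarrow> x \<curlywedge> y \<preceq> x"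
  by (metis le_join_iff join_absorb join_commute meet_in)

lemma meet_le2 [simp]: "\<lbrakk>x \<in> carrier A; y \<in> carrier A\<rbrakk> \<Longrightarrow> x \<curlywedge> y \<preceq> y"
  by (metis meet_commute meet_le1)

lemma meet_greatest: "\<lbrakk>z \<preceq> x; z \<preceq> y; x \<in> carrier A; y \<in> carrier A; z \<in> carrier A\<rbrakk> \<Longrightarrow> z \<preceq> x \<curlywedge> y"
  by (metis below_def meet_assoc)

lemma le_meet_iff: "\<lbrakk>x \<in> carrier A; y \<in> carrier A; z \<in> carrier A\<rbrakk> \<Longrightarrow> z \<preceq> x \<curlywedge> y \<longleftrightarrow> z \<preceq> x \<and> z \<preceq> y"
  by (meson le_trans meet_greatest meet_in meet_le1 meet_le2)

lemma join_ge1 [simp]: "\<lbrakk>x \<in> carrier A; y \<in> carrier A\<rbrakk> \<Longrightarrow> x \<preceq> x \<curlyvee> y"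
  by (simp add: below_def meet_absorb)

lemma join_ge2 [simp]: "\<lbrakk>x \<in> carrier A; y \<in> carrier A\<rbrakk> \<Longrightarrow> y \<preceq> x \<curlyvee> y"
  by (metis join_commute join_ge1)

lemma join_least: "\<lbrakk>x \<preceq> z; y \<preceq> z; x \<in> carrier A; y \<in> carrier A; z \<in> carrier A\<rbrakk> \<Longrightarrow> x \<curlyvee> y \<preceq> z"
  by (metis join_assoc join_in le_join_iff)

lemma join_le_iff: "\<lbrakk>x \<in> carrier A; y \<in> carrier A; z \<in> carrier A\<rbrakk> \<Longrightarrow> x \<curlyvee> y \<preceq> z \<longleftrightarrow> x \<preceq> z \<and> y \<preceq> z"
  by (meson join_ge1 join_ge2 join_in join_least le_trans)

text \<open>Residuation describes a residual through its lower bounds, so identities about residuals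
  are proved by comparing lower bounds.\<close>

lemma eqI_below:
  assumes "x \<in> carrier A" "y \<in> carrier A" "\<And>z. z \<in> carrier A \<Longrightarrow> z \<preceq> x \<longleftrightarrow> z \<preceq> y"
  shows "x = y"
  using assms le_antisym le_refl by blast

lemma mult_mono1: "\<lbrakk>x \<preceq> y; x \<in> carrier A; y \<in> carrier A; z \<in> carrier A\<rbrakk> \<Longrightarrow> x \<otimes> z \<preceq> y \<otimes> z"
  by (meson imp_in le_refl le_trans mult_in residuation)

lemma mult_mono2: "\<lbrakk>x \<preceq> y; x \<in> carrier A; y \<in> carrier A; z \<in> carrier A\<rbrakk> \<Longrightarrow> z \<otimes> x \<preceq> z \<otimes> y"
  by (metis m_comm mult_mono1)

lemma mult_mono: "\<lbrakk>x \<preceq> y; u \<preceq> v; x \<in> carrier A; y \<in> carrier A; u \<in> carrier A; v \<in> carrier A\<rbrakk>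
    \<Longrightarrow> x \<otimes> u \<preceq> y \<otimes> v"
  by (meson le_trans mult_in mult_mono1 mult_mono2)

lemma imp_mp: "\<lbrakk>x \<in> carrier A; y \<in> carrier A\<rbrakk> \<Longrightarrow> x \<otimes> (x \<leadsto> y) \<preceq> y"
  by (metis imp_in le_refl m_comm residuation)

lemma imp_curry: "\<lbrakk>x \<in> carrier A; y \<in> carrier A; z \<in> carrier A\<rbrakk> \<Longrightarrow> x \<otimes> y \<leadsto> z = x \<leadsto> (y \<leadsto> z)"
  by (rule eqI_below) (auto simp flip: residuation simp: m_assoc)

lemma one_imp [simp]: "x \<in> carrier A \<Longrightarrow> \<one> \<leadsto> x = x"
  by (rule eqI_below) (auto simp flip: residuation)

lemma imp_meet: "\<lbrakk>x \<in> carrier A; y \<in> carrier A; z \<in> carrier A\<rbrakk>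
    \<Longrightarrow> x \<leadsto> (y \<curlywedge> z) = (x \<leadsto> y) \<curlywedge> (x \<leadsto> z)"
  by (rule eqI_below) (auto simp flip: residuation simp: le_meet_iff)

lemma join_imp:
  assumes "x \<in> carrier A" "y \<in> carrier A" "z \<in> carrier A"
  shows "(x \<curlyvee> y) \<leadsto> z = (x \<leadsto> z) \<curlywedge> (y \<leadsto> z)"
proof (rule eqI_below)
  fix w assume w: "w \<in> carrier A"
  have "w \<preceq> (x \<curlyvee> y) \<leadsto> z \<longleftrightarrow> x \<curlyvee> y \<preceq> w \<leadsto> z"
    using w assms by (metis join_in m_comm residuation)
  also have "\<dots> \<longleftrightarrow> w \<preceq> x \<leadsto> z \<and> w \<preceq> y \<leadsto> z"
    using w assms by (metis imp_in join_le_iff m_comm residuation)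
  also have "\<dots> \<longleftrightarrow> w \<preceq> (x \<leadsto> z) \<curlywedge> (y \<leadsto> z)"
    using w assms by (simp add: le_meet_iff)
  finally show "w \<preceq> (x \<curlyvee> y) \<leadsto> z \<longleftrightarrow> w \<preceq> (x \<leadsto> z) \<curlywedge> (y \<leadsto> z)" .
qed (use assms in auto)

lemma one_le_imp: "\<lbrakk>x \<in> carrier A; y \<in> carrier A\<rbrakk> \<Longrightarrow> \<one> \<preceq> x \<leadsto> y \<longleftrightarrow> x \<preceq> y"
  by (metis l_one one_in residuation)

lemma imp_mono: "\<lbrakk>y \<preceq> z; x \<in> carrier A; y \<in> carrier A; z \<in> carrier A\<rbrakk> \<Longrightarrow> x \<leadsto> y \<preceq> x \<leadsto> z"
  by (metis below_def imp_meet)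

lemma imp_antimono: "\<lbrakk>x \<preceq> y; x \<in> carrier A; y \<in> carrier A; z \<in> carrier A\<rbrakk> \<Longrightarrow> y \<leadsto> z \<preceq> x \<leadsto> z"
  by (metis below_def join_imp le_join_iff meet_commute imp_in)

lemma mult_join:
  assumes "x \<in> carrier A" "y \<in> carrier A" "z \<in> carrier A"
  shows "(x \<curlyvee> y) \<otimes> z = (x \<otimes> z) \<curlyvee> (y \<otimes> z)"
proof (rule le_antisym)
  show "(x \<curlyvee> y) \<otimes> z \<preceq> (x \<otimes> z) \<curlyvee> (y \<otimes> z)"
    using assms by (simp add: residuation join_le_iff) (simp flip: residuation)
qed (use assms in \<open>auto simp: join_le_iff mult_mono1\<close>)

end

section \<open>Residuated lattices with the unit on top\<close>

context bounded_comm_residuated_lattice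
begin

lemma imp_eq_one: "\<lbrakk>x \<in> carrier A; y \<in> carrier A\<rbrakk> \<Longrightarrow> x \<leadsto> y = \<one> \<longleftrightarrow> x \<preceq> y"
  by (metis imp_in le_antisym le_refl one_greatest one_in one_le_imp)

lemma imp_one [simp]: "x \<in> carrier A \<Longrightarrow> x \<leadsto> \<one> = \<one>"
  by (simp add: imp_eq_one one_greatest)

lemma zero_imp [simp]: "x \<in> carrier A \<Longrightarrow> \<zero> \<leadsto> x = \<one>"
  by (simp add: imp_eq_one zero_least)

lemma imp_refl [simp]: "x \<in> carrier A \<Longrightarrow> x \<leadsto> x = \<one>"
  by (simp add: imp_eq_one)

lemma meet_one [simp]: "x \<in> carrier A \<Longrightarrow> x \<curlywedge> \<one> = x" "x \<in> carrier A \<Longrightarrow> \<one> \<curlywedge> x = x"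
  by (simp_all add: meet_commute[of \<one>] one_greatest flip: below_def)

lemma join_one [simp]: "x \<in> carrier A \<Longrightarrow> x \<curlyvee> \<one> = \<one>" "x \<in> carrier A \<Longrightarrow> \<one> \<curlyvee> x = \<one>"
  by (simp_all add: join_commute[of \<one>] one_greatest flip: le_join_iff)

lemma le_zero: "\<lbrakk>x \<preceq> \<zero>; x \<in> carrier A\<rbrakk> \<Longrightarrow> x = \<zero>"
  by (simp add: le_antisym zero_least)

lemma mult_le1: "\<lbrakk>x \<in> carrier A; y \<in> carrier A\<rbrakk> \<Longrightarrow> x \<otimes> y \<preceq> x"
  by (metis m_comm l_one mult_mono1 one_greatest one_in)

lemma mult_le2: "\<lbrakk>x \<in> carrier A; y \<in> carrier A\<rbrakk> \<Longrightarrow> x \<otimes> y \<preceq> y"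
  by (metis m_comm mult_le1)

lemma le_imp: "\<lbrakk>x \<in> carrier A; y \<in> carrier A\<rbrakk> \<Longrightarrow> y \<preceq> x \<leadsto> y"
  by (simp add: mult_le1 flip: residuation)

lemma zero_mult [simp]: "x \<in> carrier A \<Longrightarrow> \<zero> \<otimes> x = \<zero>" "x \<in> carrier A \<Longrightarrow> x \<otimes> \<zero> = \<zero>"
  by (simp_all add: le_zero mult_le1 mult_le2)

end

section \<open>Wajsberg algebras as MV-algebras\<close>

context wajsberg_algebra
begin

text \<open>MV negation and truncated sum; multiplication is the De Morgan dual of
  \<open>plus\<close>.\<close>

definition neg :: "'a \<Rightarrow> 'a" where "neg x = x \<leadsto> \<zero>"
definition plus :: "'a \<Rightarrow> 'a \<Rightarrow> 'a" where "plus x y = neg x \<leadsto> y"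

lemma neg_in [simp]: "x \<in> carrier A \<Longrightarrow> neg x \<in> carrier A"
  by (simp add: neg_def)

lemma plus_in [simp]: "x \<in> carrier A \<Longrightarrow> y \<in> carrier A \<Longrightarrow> plus x y \<in> carrier A"
  by (simp add: plus_def)

text \<open>If y \<preceq> z, the Wajsberg axiom becomes (z \<leadsto> y) \<leadsto> y = z. At z = x
  \<curlyvee> y this bounds (x \<leadsto> y) \<leadsto> y from above, by monotonicity.\<close>

lemma join_eq:
  assumes "x \<in> carrier A" "y \<in> carrier A"
  shows "x \<curlyvee> y = (x \<leadsto> y) \<leadsto> y"
proof (rule le_antisym)
  show "x \<curlyvee> y \<preceq> (x \<leadsto> y) \<leadsto> y"
    using assms by (simp add: join_le_iff le_imp) (simp add: imp_mp flip: residuation)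
  let ?z = "x \<curlyvee> y"
  have "(?z \<leadsto> y) \<leadsto> y = ?z"
    using assms wajsberg[of ?z y] imp_eq_one[of y ?z] by simp
  moreover have "(x \<leadsto> y) \<leadsto> y \<preceq> (?z \<leadsto> y) \<leadsto> y"
    using assms by (intro imp_antimono) auto
  ultimately show "(x \<leadsto> y) \<leadsto> y \<preceq> ?z" by simp
qed (use assms in auto)

text \<open>If z \<preceq> x, divisibility becomes z = x \<otimes> (x \<leadsto> z); this is applied
  at z = x \<curlywedge> y.\<close>

lemma meet_eq:
  assumes "x \<in> carrier A" "y \<in> carrier A"
  shows "x \<curlywedge> y = x \<otimes> (x \<leadsto> y)"
proof (rule le_antisym)
  let ?z = "x \<curlywedge> y"
  have "?z = x \<otimes> (x \<leadsto> ?z)"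
    using assms divisible[of x ?z] imp_eq_one[of ?z x] by simp
  moreover have "x \<otimes> (x \<leadsto> ?z) \<preceq> x \<otimes> (x \<leadsto> y)"
    using assms by (intro mult_mono2 imp_mono) auto
  ultimately show "?z \<preceq> x \<otimes> (x \<leadsto> y)" by simp
qed (use assms in \<open>auto simp: le_meet_iff mult_le1 imp_mp\<close>)

lemma neg_neg [simp]: "x \<in> carrier A \<Longrightarrow> neg (neg x) = x"
  using join_eq[of x \<zero>] le_join_iff[of \<zero> x] join_commute[of x \<zero>] zero_least
  by (simp add: neg_def)

lemma neg_zero [simp]: "neg \<zero> = \<one>" and neg_one [simp]: "neg \<one> = \<zero>"
  by (simp_all add: neg_def)

lemma neg_inject: "x \<in> carrier A \<Longrightarrow> y \<in> carrier A \<Longrightarrow> neg x = neg y \<longleftrightarrow> x = y"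
  by (metis neg_neg)

lemma neg_mult: "x \<in> carrier A \<Longrightarrow> y \<in> carrier A \<Longrightarrow> neg (x \<otimes> y) = x \<leadsto> neg y"
  by (simp add: neg_def imp_curry)

lemma mult_neg_imp: "x \<in> carrier A \<Longrightarrow> y \<in> carrier A \<Longrightarrow> x \<otimes> y = neg (x \<leadsto> neg y)"
  by (metis mult_in neg_mult neg_neg)

lemma neg_imp: "x \<in> carrier A \<Longrightarrow> y \<in> carrier A \<Longrightarrow> neg (x \<leadsto> y) = x \<otimes> neg y"
  by (simp add: mult_neg_imp)

lemma contrapos: "x \<in> carrier A \<Longrightarrow> y \<in> carrier A \<Longrightarrow> neg x \<leadsto> neg y = y \<leadsto> x"
  by (metis m_comm neg_imp neg_inject neg_in neg_neg imp_in)

lemma neg_le: "\<lbrakk>x \<in> carrier A; y \<in> carrier A\<rbrakk> \<Longrightarrow> neg x \<preceq> neg y \<longleftrightarrow> y \<preceq> x"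
  by (simp add: contrapos flip: imp_eq_one)

lemma imp_eq_plus: "x \<in> carrier A \<Longrightarrow> x \<leadsto> y = plus (neg x) y"
  by (simp add: plus_def)

lemma plus_comm: "x \<in> carrier A \<Longrightarrow> y \<in> carrier A \<Longrightarrow> plus x y = plus y x"
  by (metis contrapos neg_in neg_neg plus_def)

lemma neg_plus: "x \<in> carrier A \<Longrightarrow> y \<in> carrier A \<Longrightarrow> neg (plus x y) = neg x \<otimes> neg y"
  by (simp add: neg_imp plus_def)

lemma plus_assoc: "\<lbrakk>x \<in> carrier A; y \<in> carrier A; z \<in> carrier A\<rbrakk> \<Longrightarrow> plus (plus x y) z = plus x (plus y z)"
  by (simp add: plus_def neg_imp imp_curry)

lemma plus_zero [simp]: "x \<in> carrier A \<Longrightarrow> plus x \<zero> = x" "x \<in> carrier A \<Longrightarrow> plus \<zero> x = x"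
  by (metis neg_def neg_neg plus_def, simp add: plus_def)

lemma plus_one [simp]: "x \<in> carrier A \<Longrightarrow> plus x \<one> = \<one>" "x \<in> carrier A \<Longrightarrow> plus \<one> x = \<one>"
  by (simp_all add: plus_def)

lemma plus_neg [simp]: "x \<in> carrier A \<Longrightarrow> plus x (neg x) = \<one>" "x \<in> carrier A \<Longrightarrow> plus (neg x) x = \<one>"
  by (simp_all add: plus_def)

lemma plus_eq_one: "x \<in> carrier A \<Longrightarrow> y \<in> carrier A \<Longrightarrow> plus x y = \<one> \<longleftrightarrow> neg x \<preceq> y"
  by (simp add: plus_def imp_eq_one)

lemma plus_mono2: "\<lbrakk>x \<preceq> y; x \<in> carrier A; y \<in> carrier A; z \<in> carrier A\<rbrakk> \<Longrightarrow> plus z x \<preceq> plus z y"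
  by (simp add: plus_def imp_mono)

lemma plus_mono: "\<lbrakk>x \<preceq> y; u \<preceq> v; x \<in> carrier A; y \<in> carrier A; u \<in> carrier A; v \<in> carrier A\<rbrakk>
    \<Longrightarrow> plus x u \<preceq> plus y v"
  using plus_mono2[of u v x] plus_mono2[of x y v] le_trans[of "plus x u" "plus x v" "plus y v"]
  by (simp add: plus_comm[of _ v])

lemma le_plus2: "x \<in> carrier A \<Longrightarrow> y \<in> carrier A \<Longrightarrow> y \<preceq> plus x y"
  by (simp add: le_imp plus_def)

lemma le_plus1: "x \<in> carrier A \<Longrightarrow> y \<in> carrier A \<Longrightarrow> x \<preceq> plus x y"
  by (subst plus_comm) (simp_all add: le_plus2)

lemma le_neg_swap: "x \<in> carrier A \<Longrightarrow> y \<in> carrier A \<Longrightarrow> x \<preceq> neg y \<longleftrightarrow> y \<preceq> neg x"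
  by (metis neg_in neg_le neg_neg)

text \<open>\<not>x \<otimes> y is the difference y - x cut off at 0, and adding x back gives the
  join. This identity does the work of subtraction in the computations with multiples below.\<close>

lemma join_plus:
  assumes "x \<in> carrier A" "y \<in> carrier A"
  shows "plus x (neg x \<otimes> y) = x \<curlyvee> y"
proof -
  have "neg x \<otimes> y = neg (y \<leadsto> x)"
    using assms by (simp add: neg_imp m_comm)
  then have "plus x (neg x \<otimes> y) = plus (neg (y \<leadsto> x)) x"
    using assms by (simp add: plus_comm)
  also have "\<dots> = y \<curlyvee> x"
    using assms by (simp add: plus_def join_eq)
  finally show ?thesis
    using assms by (simp add: join_commute)
qed

text \<open>Let w = y \<otimes> \<not>x, so that \<not>w = y \<leadsto> x. The point is w = (x
  \<leadsto> y) \<otimes> w: it makes (x \<leadsto> y) \<leadsto> \<not>w equal to \<not>w, and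
  \<open>join_eq\<close> turns the join into \<not>w \<leadsto> \<not>w = 1.\<close>

lemma prelinear:
  assumes "x \<in> carrier A" "y \<in> carrier A"
  shows "(x \<leadsto> y) \<curlyvee> (y \<leadsto> x) = \<one>"
proof -
  let ?w = "y \<otimes> neg x"
  \<comment> \<open>\<not>x lies below x \<leadsto> y, so divisibility factors it through x
    \<leadsto> y. The other factor is \<not>x \<curlyvee> \<not>y, and multiplying by y kills its
    second half.\<close>
  have "neg x = neg x \<curlywedge> (x \<leadsto> y)"
    by (metis assms below_def contrapos le_imp neg_in)
  also have "\<dots> = (x \<leadsto> y) \<otimes> ((x \<leadsto> y) \<leadsto> neg x)"
    using assms meet_commute meet_eq by simp
  also have "(x \<leadsto> y) \<leadsto> neg x = (neg y \<leadsto> neg x) \<leadsto> neg x"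
    using assms by (simp add: contrapos)
  also have "\<dots> = neg x \<curlyvee> neg y"
    using assms by (simp flip: join_eq add: join_commute)
  finally have "?w = (x \<leadsto> y) \<otimes> ((neg x \<curlyvee> neg y) \<otimes> y)"
    using assms by (metis imp_in join_in m_assoc m_comm neg_in)
  also have "(neg x \<curlyvee> neg y) \<otimes> y = neg x \<otimes> y"
  proof -
    have "neg y \<otimes> y = \<zero>"
      using assms by (simp add: mult_neg_imp)
    then show ?thesis
      using assms mult_join[of "neg x" "neg y" y] le_join_iff[of \<zero> "neg x \<otimes> y"]
      by (simp add: join_commute zero_least)
  qed
  finally have *: "?w = (x \<leadsto> y) \<otimes> ?w"
    using assms by (simp add: m_comm)
  have "(x \<leadsto> y) \<leadsto> (y \<leadsto> x) = (x \<leadsto> y) \<leadsto> neg ?w"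
    using assms by (simp add: neg_mult)
  also have "\<dots> = neg ((x \<leadsto> y) \<otimes> ?w)"
    using assms by (simp add: neg_mult)
  also have "\<dots> = y \<leadsto> x"
    using * assms by (simp add: neg_mult)
  finally show ?thesis
    using assms by (simp add: join_eq)
qed

text \<open>The left side is \<not>u \<curlyvee> v by \<open>join_plus\<close>. It will be the
  second component of the product (u, 1)(1, uv).\<close>

lemma imp_mult_right:
  assumes "u \<in> carrier A" "v \<in> carrier A" "neg u \<preceq> v"
  shows "u \<leadsto> u \<otimes> v = v"
proof -
  have "u \<leadsto> u \<otimes> v = neg u \<curlyvee> v"
    using assms join_plus[of "neg u" v] by (simp add: plus_def)
  then show ?thesis
    using assms le_join_iff by simp
qed

section \<open>Truncated multiples of an element\<close>

primrec nm :: "nat \<Rightarrow> 'a \<Rightarrow> 'a" where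
  "nm 0 a = \<zero>"
| "nm (Suc k) a = plus a (nm k a)"

lemma nm_in [simp]: "a \<in> carrier A \<Longrightarrow> nm k a \<in> carrier A"
  by (induction k) auto

lemma nm_add: "a \<in> carrier A \<Longrightarrow> nm (j + k) a = plus (nm j a) (nm k a)"
  by (induction j) (auto simp: plus_assoc)

lemma nm_one [simp]: "a \<in> carrier A \<Longrightarrow> nm 1 a = a"
  by simp

lemma nm_mono: "a \<in> carrier A \<Longrightarrow> j \<le> k \<Longrightarrow> nm j a \<preceq> nm k a"
  using nm_add[of a j "k - j"] by (simp add: le_plus1)

lemma nm_mono2: "a \<in> carrier A \<Longrightarrow> b \<in> carrier A \<Longrightarrow> a \<preceq> b \<Longrightarrow> nm k a \<preceq> nm k b"
  by (induction k) (auto intro: plus_mono)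

lemma nm_mult: "a \<in> carrier A \<Longrightarrow> nm (j * k) a = nm j (nm k a)"
  by (induction j) (auto simp: nm_add)

text \<open>The hypothesis na \<preceq> \<not>a says that a sum of n + 1 copies of a is not
  truncated, so multiples up to n + 1 add as in an ordered group. The induction moves one copy of a
  at a time from one multiple to the other, hence the arbitrary k.\<close>

lemma nm_le_neg:
  assumes "a \<in> carrier A" "nm n a \<preceq> neg a" "k + l \<le> Suc n"
  shows "nm k a \<preceq> neg (nm l a)"
  using assms(3)
proof (induction l arbitrary: k)
  case 0
  then show ?case using assms by (simp add: one_greatest)
next
  case (Suc l)
  have "nm k a \<preceq> neg a"
    using Suc.prems assms le_trans[OF nm_mono[of a k n]] by simp
  have "nm (Suc k) a \<preceq> neg (nm l a)"
    using Suc.IH[of "Suc k"] Suc.prems by (simp del: nm.simps)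
  then have "nm l a \<preceq> neg (plus a (nm k a))"
    using assms le_neg_swap by simp
  then have "nm l a \<preceq> neg a \<otimes> neg (nm k a)"
    using assms by (simp add: neg_plus)
  then have "plus a (nm l a) \<preceq> plus a (neg a \<otimes> neg (nm k a))"
    using assms by (simp add: plus_mono2)
  also have "plus a (neg a \<otimes> neg (nm k a)) = a \<curlyvee> neg (nm k a)"
    using assms by (simp add: join_plus)
  also have "\<dots> = neg (nm k a)"
    using assms \<open>nm k a \<preceq> neg a\<close> le_join_iff le_neg_swap by simp
  finally show ?case
    using assms le_neg_swap by simp
qed

text \<open>Cancellation: \<not>(la) is \<not>(ka) \<otimes> \<not>((l-k)a), so the sum is a join by
  \<open>join_plus\<close>, and \<open>nm_le_neg\<close> tells which of the two elements is the
  larger.\<close>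

lemma nm_plus_neg:
  assumes "a \<in> carrier A" "nm n a \<preceq> neg a" "k \<le> l" "l \<le> Suc n"
  shows "plus (nm k a) (neg (nm l a)) = neg (nm (l - k) a)"
proof -
  have "neg (nm l a) = neg (nm k a) \<otimes> neg (nm (l - k) a)"
    using assms nm_add[of a k "l - k"] neg_plus by simp
  then have "plus (nm k a) (neg (nm l a)) = nm k a \<curlyvee> neg (nm (l - k) a)"
    using assms by (simp add: join_plus)
  then show ?thesis
    using assms nm_le_neg[of a n k "l - k"] le_join_iff by simp
qed

lemma nm_eq_zero:
  assumes "a \<in> carrier A" "nm (Suc k) a = \<zero>" shows "a = \<zero>"
  using assms by (metis le_plus1 le_zero nm.simps(2) nm_in)

lemma nm_inj:
  assumes "a \<in> carrier A" "a \<noteq> \<zero>" "nm n a \<preceq> neg a" "k < l" "l \<le> Suc n"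
  shows "nm k a \<noteq> nm l a"
proof
  assume "nm k a = nm l a"
  then have "neg (nm (l - k) a) = \<one>"
    using assms nm_plus_neg[of a n k l] by simp
  then have "nm (l - k) a = \<zero>"
    using assms by (metis neg_neg neg_one nm_in)
  then show False
    using assms nm_eq_zero by (metis Suc_diff_Suc)
qed

text \<open>The bound is n and not n + 1: at k + l = n + 1 equality can occur, and na = \<not>a is
  exactly the cyclic case.\<close>

lemma nm_neq_neg:
  assumes "a \<in> carrier A" "a \<noteq> \<zero>" "nm n a \<preceq> neg a" "k + l \<le> n"
  shows "nm k a \<noteq> neg (nm l a)"
proof
  assume "nm k a = neg (nm l a)"
  then have "nm (k + l) a = \<one>"
    using assms by (simp add: nm_add)
  then have "\<one> \<preceq> neg a"
    using assms le_trans[OF nm_mono[of a "k + l" n] assms(3)] by simp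
  then have "a = \<zero>"
    by (metis assms(1) le_antisym neg_in neg_neg neg_one one_greatest one_in)
  then show False using assms by simp
qed

text \<open>Let N be the last number for which a nonzero a with Na \<preceq> \<not>a exists. The
  remainder r = \<not>((N+1)a) is smaller than a. If it were nonzero, the smaller b of r and a - r
  would satisfy 2b \<preceq> a, hence (N+1)b \<preceq> 2Nb \<preceq> Na \<preceq> \<not>a \<preceq>
  \<not>b, against the choice of N.\<close>

lemma archimedean_or_cyclic:
  assumes chain: "\<And>x y. x \<in> carrier A \<Longrightarrow> y \<in> carrier A \<Longrightarrow> x \<preceq> y \<or> y \<preceq> x"
    and c: "c \<in> carrier A" "c \<noteq> \<zero>" "c \<noteq> \<one>"
    and bdd: "\<not> (\<forall>n. \<exists>a \<in> carrier A. a \<noteq> \<zero> \<and> nm n a \<preceq> neg a)"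
  obtains a n where "a \<in> carrier A" "a \<noteq> \<zero>" "n \<ge> 1" "nm n a = neg a"
proof -
  let ?P = "\<lambda>n. \<exists>a \<in> carrier A. a \<noteq> \<zero> \<and> nm n a \<preceq> neg a"
  \<comment> \<open>One of c and \<not>c is below the other, and the smaller one is the
    witness.\<close>
  have "?P 1"
    by (metis c chain neg_in neg_neg neg_one neg_zero nm_one)
  obtain m where m: "\<not> ?P m" using bdd by blast
  have "?P 0"
    using c by (auto simp: zero_least)
  then obtain N where "\<forall>i\<le>N. ?P i" and N2: "\<not> ?P (Suc N)"
    using ex_least_nat_less[of "\<lambda>n. \<not> ?P n" m] m by blast
  moreover have "N \<ge> 1"
    using N2 \<open>?P 1\<close> by (cases N) auto
  ultimately have N: "?P N" "\<not> ?P (Suc N)" "N \<ge> 1"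
    by auto
  then obtain a where a: "a \<in> carrier A" "a \<noteq> \<zero>" "nm N a \<preceq> neg a" by blast
  define r where "r = neg (nm (Suc N) a)"
  have r [simp]: "r \<in> carrier A" using a by (simp add: r_def del: nm.simps)
  have "r = \<zero>"
  proof (rule ccontr)
    assume r0: "r \<noteq> \<zero>"
    have nar: "\<not> a \<preceq> r"
    proof
      assume "a \<preceq> r"
      then have "nm (Suc N) a \<preceq> neg a"
        using a le_neg_swap[of a "nm (Suc N) a"] by (simp add: r_def del: nm.simps)
      then show False using a N(2) by blast
    qed
    then have ra: "r \<preceq> a" using chain[OF r a(1)] by simp
    have s: "neg r \<otimes> a \<noteq> \<zero>"
    proof
      assume "neg r \<otimes> a = \<zero>"
      then have "r \<curlyvee> a = r" using join_plus[of r a] a by simp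
      then show False using nar a join_ge2[of r a] by simp
    qed
    \<comment> \<open>The smaller of r and a - r. These two add up to a.\<close>
    define b where "b = r \<curlywedge> (neg r \<otimes> a)"
    have b: "b \<in> carrier A" "b \<noteq> \<zero>"
      using chain[of r "neg r \<otimes> a"] r0 s a meet_commute[of r "neg r \<otimes> a"]
      unfolding b_def by (auto simp: below_def)
    have "plus b b \<preceq> plus r (neg r \<otimes> a)"
      using a b by (intro plus_mono) (auto simp: b_def)
    also have "\<dots> = a"
      using a ra by (simp add: join_plus flip: le_join_iff)
    finally have ba: "nm 2 b \<preceq> a"
      using b by (simp add: numeral_2_eq_2)
    \<comment> \<open>N + 1 \<le> 2N because N \<ge> 1.\<close>
    have "nm (Suc N) b \<preceq> nm (N * 2) b"
      using b N by (intro nm_mono) auto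
    also have "nm (N * 2) b = nm N (nm 2 b)"
      using b by (simp only: nm_mult)
    finally have "nm (Suc N) b \<preceq> nm N (nm 2 b)" .
    moreover have "nm N (nm 2 b) \<preceq> nm N a"
      using a b ba by (intro nm_mono2) auto
    moreover have "neg a \<preceq> neg b"
      using a b le_trans[OF nm_mono[of b 1 2] ba] by (simp add: neg_le)
    ultimately have "nm (Suc N) b \<preceq> neg b"
      using a b le_trans[of "nm (Suc N) b" "nm N a" "neg b"] le_trans[of "nm N a" "neg a" "neg b"]
        le_trans[of "nm (Suc N) b" "nm N (nm 2 b)" "nm N a"] by (simp del: nm.simps)
    then show False using N(2) b by blast
  qed
  then have "plus a (nm N a) = \<one>"
    using a neg_neg[of "plus a (nm N a)"] by (simp add: r_def)
  then have "nm N a = neg a"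
    using a by (simp add: plus_eq_one le_antisym)
  then show thesis using that a N by blast
qed

end

section \<open>Representation over Wajsberg chains\<close>

definition rl_hom :: "('a \<Rightarrow> 'b) \<Rightarrow> 'a rl \<Rightarrow> 'b rl \<Rightarrow> bool" where
  "rl_hom f A B \<longleftrightarrow>
     (\<forall>x \<in> carrier A. f x \<in> carrier B) \<and>
     (\<forall>x \<in> carrier A. \<forall>y \<in> carrier A.
        f (x \<otimes>\<^bsub>A\<^esub> y) = f x \<otimes>\<^bsub>B\<^esub> f y \<and> f (x \<curlyvee>\<^bsub>A\<^esub> y) = f x \<curlyvee>\<^bsub>B\<^esub> f y \<and>
        f (x \<curlywedge>\<^bsub>A\<^esub> y) = f x \<curlywedge>\<^bsub>B\<^esub> f y \<and> f (x \<leadsto>\<^bsub>A\<^esub> y) = (f x \<leadsto>\<^bsub>B\<^esub> f y)) \<and>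
     f \<one>\<^bsub>A\<^esub> = \<one>\<^bsub>B\<^esub> \<and> f \<zero>\<^bsub>A\<^esub> = \<zero>\<^bsub>B\<^esub>"

lemma eval_closed: "rl_algebra A \<Longrightarrow> range e \<subseteq> carrier A \<Longrightarrow> eval A e t \<in> carrier A"
  by (induction t) (auto intro: rl_algebra.mult_in rl_algebra.join_in rl_algebra.meet_in
      rl_algebra.imp_in rl_algebra.one_in rl_algebra.zero_in)

lemma eval_hom:
  assumes "rl_algebra A" "rl_hom f A B" "range e \<subseteq> carrier A"
  shows "eval B (\<lambda>n. f (e n)) t = f (eval A e t)"
  using assms eval_closed[OF assms(1,3)] by (induction t) (auto simp: rl_hom_def)

lemma satisfies_image:
  fixes A :: "'a rl" and B :: "'b rl"
  assumes "rl_algebra A" "rl_hom f A B" "carrier B \<subseteq> f ` carrier A" "satisfies A E"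
  shows "satisfies B E"
  unfolding satisfies_def
proof safe
  fix s t and e :: "nat \<Rightarrow> 'b" assume st: "(s, t) \<in> E" and e: "range e \<subseteq> carrier B"
  then have "\<forall>n. \<exists>x. x \<in> carrier A \<and> f x = e n"
    using assms(3) by (simp add: image_iff subset_iff) metis
  then obtain e' :: "nat \<Rightarrow> 'a" where e': "\<And>n. e' n \<in> carrier A" "\<And>n. f (e' n) = e n"
    by (auto dest!: choice)
  then have "eval A e' s = eval A e' t"
    using assms(4) st unfolding satisfies_def by blast
  then show "eval B e s = eval B e t"
    using eval_hom[OF assms(1,2), of e'] e' by (auto simp: image_subset_iff)
qed

lemma rl_hom_comp: "rl_hom f A B \<Longrightarrow> rl_hom g B C \<Longrightarrow> rl_hom (g \<circ> f) A C"
  by (auto simp: rl_hom_def)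

lemma rl_hom_K_alg:
  assumes "rl_algebra A" "rl_hom f A B"
  shows "rl_hom (map_prod f f) (K_alg A) (K_alg B)"
  using assms by (auto simp: rl_hom_def K_alg_def rl_algebra.imp_in)

lemma subuniverse_image:
  assumes "rl_algebra A" "rl_hom f A B"
  shows "subuniverse (f ` carrier A) B"
proof -
  have c: "f x \<otimes>\<^bsub>B\<^esub> f y \<in> f ` carrier A" "f x \<curlyvee>\<^bsub>B\<^esub> f y \<in> f ` carrier A"
      "f x \<curlywedge>\<^bsub>B\<^esub> f y \<in> f ` carrier A" "(f x \<leadsto>\<^bsub>B\<^esub> f y) \<in> f ` carrier A"
      "\<one>\<^bsub>B\<^esub> \<in> f ` carrier A" "\<zero>\<^bsub>B\<^esub> \<in> f ` carrier A"
    if "x \<in> carrier A" "y \<in> carrier A" for x y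
    using that imageI[OF rl_algebra.mult_in[OF assms(1) that], of f]
      imageI[OF rl_algebra.join_in[OF assms(1) that], of f]
      imageI[OF rl_algebra.meet_in[OF assms(1) that], of f]
      imageI[OF rl_algebra.imp_in[OF assms(1) that], of f]
      imageI[OF rl_algebra.one_in[OF assms(1)], of f] imageI[OF rl_algebra.zero_in[OF assms(1)], of f]
      assms(2)
    by (simp_all add: rl_hom_def)
  moreover have "f ` carrier A \<subseteq> carrier B" using assms by (auto simp: rl_hom_def)
  ultimately show ?thesis
    using rl_algebra.one_in[OF assms(1)] by (auto simp: subuniverse_def intro!: rl_algebra.intro)
qed

lemma rl_hom_range: "rl_hom f A B \<Longrightarrow> rl_hom f A (B\<lparr>carrier := f ` carrier A\<rparr>)"
  by (auto simp: rl_hom_def)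

section \<open>Linearly ordered quotients of Wajsberg algebras\<close>

context wajsberg_algebra
begin

lemma imp_trans:
  assumes "x \<in> carrier A" "y \<in> carrier A" "z \<in> carrier A"
  shows "x \<leadsto> y \<preceq> (y \<leadsto> z) \<leadsto> (x \<leadsto> z)"
proof -
  have "(x \<otimes> (x \<leadsto> y)) \<otimes> (y \<leadsto> z) \<preceq> y \<otimes> (y \<leadsto> z)"
    using assms by (intro mult_mono1 imp_mp) auto
  then have "(x \<otimes> (x \<leadsto> y)) \<otimes> (y \<leadsto> z) \<preceq> z"
    by (rule le_trans) (use assms imp_mp[of y z] in auto)
  then have "(x \<leadsto> y) \<otimes> (y \<leadsto> z) \<otimes> x \<preceq> z"
    using assms by (simp add: m_ac)
  then show ?thesis
    using assms by (simp add: residuation)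
qed

lemma imp_trans2:
  assumes "x \<in> carrier A" "y \<in> carrier A" "z \<in> carrier A"
  shows "y \<leadsto> z \<preceq> (x \<leadsto> y) \<leadsto> (x \<leadsto> z)"
proof -
  have "x \<leadsto> y \<preceq> (y \<leadsto> z) \<leadsto> (x \<leadsto> z)"
    by (rule imp_trans[OF assms])
  then have "(y \<leadsto> z) \<otimes> (x \<leadsto> y) \<preceq> x \<leadsto> z"
    using assms by (simp add: m_comm flip: residuation)
  then show ?thesis
    using assms by (simp add: residuation)
qed

text \<open>Nothing is assumed about the target B, so its order has to be read off from A. The link
  is x \<leadsto> y = x \<leadsto> (x \<curlywedge> y) in one direction and x \<curlywedge> y = x
  \<otimes> (x \<leadsto> y) in the other.\<close>

lemma hom_image_below:
  assumes "rl_hom f A B" "x \<in> carrier A" "y \<in> carrier A"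
  shows "f x \<preceq>\<^bsub>B\<^esub> f y \<longleftrightarrow> f (x \<leadsto> y) = \<one>\<^bsub>B\<^esub>"
proof
  assume "f x \<preceq>\<^bsub>B\<^esub> f y"
  then have "f x = f (x \<curlywedge> y)"
    using assms by (simp add: below_def rl_hom_def)
  moreover have "x \<leadsto> y = x \<leadsto> (x \<curlywedge> y)"
    using assms by (simp add: imp_meet)
  ultimately have "f (x \<leadsto> y) = f (x \<leadsto> x)"
    using assms unfolding rl_hom_def by (metis meet_in)
  then show "f (x \<leadsto> y) = \<one>\<^bsub>B\<^esub>"
    using assms by (simp add: rl_hom_def)
next
  assume *: "f (x \<leadsto> y) = \<one>\<^bsub>B\<^esub>"
  have "f x \<curlywedge>\<^bsub>B\<^esub> f y = f (x \<curlywedge> y)"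
    using assms by (simp add: rl_hom_def)
  also have "\<dots> = f x \<otimes>\<^bsub>B\<^esub> f (x \<leadsto> y)"
    using assms by (simp add: meet_eq) (simp add: rl_hom_def)
  also have "\<dots> = f (x \<otimes> \<one>)"
    using * assms unfolding rl_hom_def by (metis one_in)
  also have "\<dots> = f x"
    using assms by simp
  finally show "f x \<preceq>\<^bsub>B\<^esub> f y"
    by (simp add: below_def)
qed

text \<open>Most axioms are equations and pass to images at once. Residuation is not an equation; by
  \<open>hom_image_below\<close> both of its sides become statements about the same element of
  A.\<close>

lemma hom_image_wajsberg:
  assumes f: "rl_hom f A B" and surj: "carrier B = f ` carrier A"
  shows "wajsberg_algebra B"
proof -
  have in_B: "x \<in> carrier B \<Longrightarrow> \<exists>x' \<in> carrier A. x = f x'" for x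
    using surj by blast
  have h [simp]: "f x \<otimes>\<^bsub>B\<^esub> f y = f (x \<otimes> y)" "f x \<curlyvee>\<^bsub>B\<^esub> f y = f (x \<curlyvee> y)"
      "f x \<curlywedge>\<^bsub>B\<^esub> f y = f (x \<curlywedge> y)" "(f x \<leadsto>\<^bsub>B\<^esub> f y) = f (x \<leadsto> y)"
    if "x \<in> carrier A" "y \<in> carrier A" for x y
    using f that by (auto simp: rl_hom_def)
  have f_in [simp]: "x \<in> carrier A \<Longrightarrow> f x \<in> carrier B" for x
    using f by (simp add: rl_hom_def)
  have h1 [simp]: "\<one>\<^bsub>B\<^esub> = f \<one>" "\<zero>\<^bsub>B\<^esub> = f \<zero>"
    using f by (auto simp: rl_hom_def)
  note below = hom_image_below[OF f]
  interpret B: rl_algebra B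
    by unfold_locales (use h1 surj in \<open>auto dest!: in_B\<close>)
  interpret B: comm_monoid B
    by unfold_locales (auto dest!: in_B simp: m_ac)
  interpret B: comm_residuated_lattice B
    by unfold_locales (auto dest!: in_B simp: below join_assoc meet_assoc join_absorb meet_absorb
        imp_curry intro!: arg_cong[of _ _ f] intro: join_commute meet_commute)
  interpret B: bounded_comm_residuated_lattice B
    by unfold_locales (auto dest!: in_B simp: below h1)
  show ?thesis
    by unfold_locales (auto dest!: in_B intro!: arg_cong[of _ _ f] intro: divisible wajsberg)
qed

text \<open>The implicative filters: the sets of elements that a congruence identifies with
  1.\<close>

definition deductive :: "'a set \<Rightarrow> bool" where
  "deductive F \<longleftrightarrow> F \<subseteq> carrier A \<and> \<one> \<in> F \<and>
     (\<forall>x \<in> F. \<forall>y \<in> carrier A. (x \<leadsto> y) \<in> F \<longrightarrow> y \<in> F)"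

lemma deductive_in: "\<lbrakk>deductive F; x \<in> F\<rbrakk> \<Longrightarrow> x \<in> carrier A"
  unfolding deductive_def by blast

lemma deductive_one: "deductive F \<Longrightarrow> \<one> \<in> F"
  unfolding deductive_def by blast

lemma deductive_mp: "\<lbrakk>deductive F; x \<in> F; (x \<leadsto> y) \<in> F; y \<in> carrier A\<rbrakk> \<Longrightarrow> y \<in> F"
  unfolding deductive_def by blast

lemma deductive_up: "\<lbrakk>deductive F; x \<in> F; x \<preceq> y; y \<in> carrier A\<rbrakk> \<Longrightarrow> y \<in> F"
  using imp_eq_one[of x y] deductive_mp[of F x y] deductive_in[of F x] deductive_one[of F] by simp

lemma deductive_mult: "\<lbrakk>deductive F; x \<in> F; y \<in> F\<rbrakk> \<Longrightarrow> x \<otimes> y \<in> F"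
  using deductive_mp[of F y "x \<otimes> y"] deductive_up[of F x "y \<leadsto> x \<otimes> y"] deductive_in[of F]
  by (simp flip: residuation)

text \<open>Multiplying out (u \<curlyvee> x) \<otimes> (u \<curlyvee> (x \<leadsto> y)) gives only
  terms below u or below y. These sets are the competitors against which a maximal F is
  tested.\<close>

lemma deductive_join:
  assumes F: "deductive F" and u: "u \<in> carrier A"
  shows "deductive {z \<in> carrier A. u \<curlyvee> z \<in> F}"
  unfolding deductive_def
proof (safe)
  show "u \<curlyvee> \<one> \<in> F" using F u by (simp add: deductive_one)
  fix x y assume x: "x \<in> carrier A" "u \<curlyvee> x \<in> F" and y: "y \<in> carrier A"
    and xy: "u \<curlyvee> (x \<leadsto> y) \<in> F"
  have "(u \<curlyvee> x) \<otimes> (u \<curlyvee> (x \<leadsto> y)) = (u \<otimes> (u \<curlyvee> (x \<leadsto> y))) \<curlyvee> (x \<otimes> (u \<curlyvee> (x \<leadsto> y)))"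
    using u x y by (simp add: mult_join)
  also have "x \<otimes> (u \<curlyvee> (x \<leadsto> y)) = (u \<otimes> x) \<curlyvee> (x \<otimes> (x \<leadsto> y))"
    using u x y mult_join[of u "x \<leadsto> y" x] m_comm by simp
  finally have eq: "(u \<curlyvee> x) \<otimes> (u \<curlyvee> (x \<leadsto> y))
      = (u \<otimes> (u \<curlyvee> (x \<leadsto> y))) \<curlyvee> ((u \<otimes> x) \<curlyvee> (x \<otimes> (x \<leadsto> y)))" .
  have "u \<otimes> z \<preceq> u \<curlyvee> y" if "z \<in> carrier A" for z
    using that u y le_trans[OF mult_le1[of u z] join_ge1[of u y]] by simp
  moreover have "x \<otimes> (x \<leadsto> y) \<preceq> u \<curlyvee> y"
    using x u y le_trans[OF imp_mp[of x y] join_ge2[of u y]] by simp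
  ultimately have "(u \<curlyvee> x) \<otimes> (u \<curlyvee> (x \<leadsto> y)) \<preceq> u \<curlyvee> y"
    unfolding eq using u x y by (simp add: join_le_iff)
  then show "u \<curlyvee> y \<in> F"
    using deductive_up[OF F deductive_mult[OF F x(2) xy]] u y by simp
qed auto

text \<open>F is maximal among the deductive systems omitting w. By prelinearity it suffices that a
  join equal to 1 has a member in F.\<close>

lemma prime_deductive:
  assumes w: "w \<in> carrier A" "w \<noteq> \<one>"
  obtains F where "deductive F" "w \<notin> F"
    "\<And>x y. x \<in> carrier A \<Longrightarrow> y \<in> carrier A \<Longrightarrow> (x \<leadsto> y) \<in> F \<or> (y \<leadsto> x) \<in> F"
proof -
  let ?S = "{F. deductive F \<and> w \<notin> F}"
  have "\<exists>M \<in> ?S. \<forall>X \<in> ?S. M \<subseteq> X \<longrightarrow> X = M"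
  proof (rule subset_Zorn_nonempty)
    have "deductive {\<one>}" by (auto simp: deductive_def)
    then show "?S \<noteq> {}" using w by blast
    fix \<C> assume C: "\<C> \<noteq> {}" "subset.chain ?S \<C>"
    have "deductive (\<Union>\<C>)"
      unfolding deductive_def
    proof (intro conjI ballI impI)
      show "\<Union>\<C> \<subseteq> carrier A" "\<one> \<in> \<Union>\<C>"
        using C by (fastforce simp: subset_chain_def dest: deductive_in deductive_one)+
      fix x y assume x: "x \<in> \<Union>\<C>" and y: "y \<in> carrier A" and xy: "(x \<leadsto> y) \<in> \<Union>\<C>"
      then obtain G H where "G \<in> \<C>" "H \<in> \<C>" "x \<in> G" "(x \<leadsto> y) \<in> H" by blast
      then obtain K where "K \<in> \<C>" "x \<in> K" "(x \<leadsto> y) \<in> K"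
        using C unfolding subset_chain_def by blast
      moreover have "deductive K"
        using C \<open>K \<in> \<C>\<close> by (auto simp: subset_chain_def)
      ultimately show "y \<in> \<Union>\<C>" using y deductive_mp by blast
    qed
    then show "\<Union>\<C> \<in> ?S" using C by (auto simp: subset_chain_def)
  qed
  then obtain F where F: "deductive F" "w \<notin> F"
    and max: "\<And>G. deductive G \<Longrightarrow> w \<notin> G \<Longrightarrow> F \<subseteq> G \<Longrightarrow> G = F" by blast
  have FA: "F \<subseteq> carrier A" using F deductive_in by blast
  have sub: "F \<subseteq> {z \<in> carrier A. u \<curlyvee> z \<in> F}" if "u \<in> carrier A" for u
    using that FA F deductive_up[OF F(1) _ join_ge2[of u]] by auto
  \<comment> \<open>Maximality is used twice. At w it shows that w \<curlyvee> u \<in> F forces u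
    \<in> F. So if u \<notin> F, then {z. u \<curlyvee> z \<in> F} still omits w, equals F, and
    contains v since u \<curlyvee> v = 1.\<close>
  have choose: "v \<in> F" if uv: "u \<in> carrier A" "v \<in> carrier A" "u \<curlyvee> v = \<one>" "u \<notin> F" for u v
  proof -
    have "w \<curlyvee> u \<notin> F"
    proof
      assume "w \<curlyvee> u \<in> F"
      moreover have "{z \<in> carrier A. w \<curlyvee> z \<in> F} = F"
        using max[OF deductive_join[OF F(1) w(1)] _ sub[OF w(1)]] F w
          join_eq[of w w] by simp
      ultimately show False using uv by blast
    qed
    then have "{z \<in> carrier A. u \<curlyvee> z \<in> F} = F"
      using max[OF deductive_join[OF F(1) uv(1)] _ sub[OF uv(1)]] w uv join_commute by simp
    moreover have "u \<curlyvee> v \<in> F" using uv F by (simp add: deductive_one)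
    ultimately show "v \<in> F" using uv by blast
  qed
  have "(x \<leadsto> y) \<in> F \<or> (y \<leadsto> x) \<in> F" if "x \<in> carrier A" "y \<in> carrier A" for x y
    using that choose[of "x \<leadsto> y" "y \<leadsto> x"] prelinear[of x y] by auto
  with F that show thesis by blast
qed

text \<open>The quotient by the prime deductive system is realised on a set of representatives, so that
  it lives on the same type.\<close>

lemma chain_quotient:
  assumes w: "w \<in> carrier A" "w \<noteq> \<one>"
  obtains D :: "'a rl" and f where "wajsberg_algebra D" "rl_hom f A D" "carrier D = f ` carrier A"
    "\<And>x y. x \<in> carrier D \<Longrightarrow> y \<in> carrier D \<Longrightarrow> x \<preceq>\<^bsub>D\<^esub> y \<or> y \<preceq>\<^bsub>D\<^esub> x" "f w \<noteq> \<one>\<^bsub>D\<^esub>"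
proof -
  obtain F where F: "deductive F" "w \<notin> F"
    and prime: "\<And>x y. x \<in> carrier A \<Longrightarrow> y \<in> carrier A \<Longrightarrow> (x \<leadsto> y) \<in> F \<or> (y \<leadsto> x) \<in> F"
    using prime_deductive[OF w] by blast
  have F1: "\<one> \<in> F" using F by (simp add: deductive_one)
  define sim where "sim x y \<longleftrightarrow> (x \<leadsto> y) \<in> F \<and> (y \<leadsto> x) \<in> F" for x y
  have refl: "sim x x" if "x \<in> carrier A" for x
    using that F1 by (simp add: sim_def)
  have sym: "sim x y \<Longrightarrow> sim y x" for x y by (simp add: sim_def)
  have tr: "(x \<leadsto> z) \<in> F" if "(x \<leadsto> y) \<in> F" "(y \<leadsto> z) \<in> F" "x \<in> carrier A" "y \<in> carrier A" "z \<in> carrier A" for x y z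
    using deductive_mp[OF F(1) that(2) deductive_up[OF F(1) that(1) imp_trans]] that by simp
  have trans: "sim x z" if "sim x y" "sim y z" "x \<in> carrier A" "y \<in> carrier A" "z \<in> carrier A" for x y z
    using that tr[of x y z] tr[of z y x] unfolding sim_def by blast
  have cong_imp: "sim (x \<leadsto> y) (x' \<leadsto> y')"
    if "sim x x'" "sim y y'" and c: "x \<in> carrier A" "y \<in> carrier A" "x' \<in> carrier A" "y' \<in> carrier A" for x y x' y'
  proof (rule trans)
    show "sim (x \<leadsto> y) (x' \<leadsto> y)"
      using that deductive_up[OF F(1) _ imp_trans[of x x' y]] deductive_up[OF F(1) _ imp_trans[of x' x y]]
      by (simp add: sim_def)
    show "sim (x' \<leadsto> y) (x' \<leadsto> y')"
      using that deductive_up[OF F(1) _ imp_trans2[of x' y y']] deductive_up[OF F(1) _ imp_trans2[of x' y' y]]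
      by (simp add: sim_def)
  qed (use c in auto)
  \<comment> \<open>Multiplication, join and meet are terms in \<leadsto> and 0, so compatibility
    with \<leadsto> is enough.\<close>
  have cong_mult: "sim (x \<otimes> y) (x' \<otimes> y')"
    if "sim x x'" "sim y y'" "x \<in> carrier A" "y \<in> carrier A" "x' \<in> carrier A" "y' \<in> carrier A" for x y x' y'
    using that by (simp add: mult_neg_imp neg_def) (intro cong_imp; (intro imp_in refl zero_in)?)
  have cong_join: "sim (x \<curlyvee> y) (x' \<curlyvee> y')"
    if "sim x x'" "sim y y'" "x \<in> carrier A" "y \<in> carrier A" "x' \<in> carrier A" "y' \<in> carrier A" for x y x' y'
    using that by (simp add: join_eq) (intro cong_imp; (intro imp_in)?)
  have cong_meet: "sim (x \<curlywedge> y) (x' \<curlywedge> y')"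
    if "sim x x'" "sim y y'" "x \<in> carrier A" "y \<in> carrier A" "x' \<in> carrier A" "y' \<in> carrier A" for x y x' y'
    using that by (simp add: meet_eq) (intro cong_imp cong_mult; (intro imp_in)?)
  define r where "r x = (SOME y. y \<in> carrier A \<and> sim x y)" for x
  have r: "r x \<in> carrier A" "sim x (r x)" if "x \<in> carrier A" for x
    using someI[of "\<lambda>y. y \<in> carrier A \<and> sim x y" x] that refl unfolding r_def by auto
  have r_eq: "r x = r y" if "sim x y" "x \<in> carrier A" "y \<in> carrier A" for x y
  proof -
    have "sim x z \<longleftrightarrow> sim y z" if "z \<in> carrier A" for z
      using that \<open>sim x y\<close> \<open>x \<in> carrier A\<close> \<open>y \<in> carrier A\<close> trans sym by blast
    then show ?thesis unfolding r_def by metis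
  qed
  define D where "D = \<lparr>carrier = r ` carrier A, monoid.mult = (\<lambda>x y. r (x \<otimes> y)), one = r \<one>,
     join = (\<lambda>x y. r (x \<curlyvee> y)), meet = (\<lambda>x y. r (x \<curlywedge> y)), imp = (\<lambda>x y. r (x \<leadsto> y)), zero = r \<zero>\<rparr>"
  have hom: "rl_hom r A D"
    unfolding rl_hom_def D_def using r
    by (auto intro!: r_eq cong_imp cong_mult cong_join cong_meet)
  have surj: "carrier D = r ` carrier A" by (simp add: D_def)
  have one: "r x = \<one>\<^bsub>D\<^esub> \<longleftrightarrow> x \<in> F" if x: "x \<in> carrier A" for x
  proof -
    have "sim x \<one> \<longleftrightarrow> x \<in> F"
      using x F1 by (simp add: sim_def)
    moreover have "r x = r \<one> \<longleftrightarrow> sim x \<one>"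
    proof
      assume "r x = r \<one>"
      then show "sim x \<one>"
        using trans[of x "r x" \<one>] r[of x] r[of \<one>] sym[of \<one> "r \<one>"] x by simp
    qed (use r_eq[of x \<one>] x in auto)
    ultimately show ?thesis by (simp add: D_def)
  qed
  show thesis
  proof
    show "wajsberg_algebra D" using hom_image_wajsberg[OF hom surj] .
    show "x \<preceq>\<^bsub>D\<^esub> y \<or> y \<preceq>\<^bsub>D\<^esub> x" if xy: "x \<in> carrier D" "y \<in> carrier D" for x y
    proof -
      obtain x' y' where "x' \<in> carrier A" "y' \<in> carrier A" "x = r x'" "y = r y'"
        using xy by (auto simp: surj)
      then show ?thesis
        using prime[of x' y'] by (simp add: hom_image_below[OF hom] one)
    qed
    show "r w \<noteq> \<one>\<^bsub>D\<^esub>" using one w F by simp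
  qed (fact hom surj)+
qed

end

section \<open>Bounded K-lattices and their negative cones\<close>

context bounded_K_lattice
begin

lemma tilde_in [simp]: "x \<in> carrier A \<Longrightarrow> \<sim> x \<in> carrier A"
  by (simp add: tilde_def)

lemma tilde_join: "x \<in> carrier A \<Longrightarrow> y \<in> carrier A \<Longrightarrow> \<sim> (x \<curlyvee> y) = \<sim> x \<curlywedge> \<sim> y"
  by (simp add: tilde_def join_imp)

lemma tilde_meet: "x \<in> carrier A \<Longrightarrow> y \<in> carrier A \<Longrightarrow> \<sim> (x \<curlywedge> y) = \<sim> x \<curlyvee> \<sim> y"
  using tilde_join[of "\<sim> x" "\<sim> y"] tilde_tilde[of "\<sim> x \<curlyvee> \<sim> y"] by (simp add: tilde_tilde)

lemma tilde_mult: "x \<in> carrier A \<Longrightarrow> y \<in> carrier A \<Longrightarrow> \<sim> (x \<otimes> y) = x \<leadsto> \<sim> y"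
  by (simp add: tilde_def imp_curry)

lemma tilde_imp: "x \<in> carrier A \<Longrightarrow> y \<in> carrier A \<Longrightarrow> \<sim> (x \<leadsto> y) = x \<otimes> \<sim> y"
  using tilde_mult[of x "\<sim> y"] tilde_tilde[of "x \<otimes> \<sim> y"] by (simp add: tilde_tilde)

lemma join_meet_one: "x \<in> carrier A \<Longrightarrow> y \<in> carrier A \<Longrightarrow> (x \<curlyvee> y) \<curlywedge> \<one> = (x \<curlywedge> \<one>) \<curlyvee> (y \<curlywedge> \<one>)"
  using meet_distrib[of \<one> x y] by (simp add: meet_commute[of _ \<one>])

lemma meet_meet_one: "x \<in> carrier A \<Longrightarrow> y \<in> carrier A \<Longrightarrow> (x \<curlywedge> y) \<curlywedge> \<one> = (x \<curlywedge> \<one>) \<curlywedge> (y \<curlywedge> \<one>)"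
  by (rule eqI_below) (auto simp: le_meet_iff)

text \<open>The additional factor u \<leadsto> \<one> lies above \<one> and disappears under the
  meet with \<one>. So residuals of cone elements can be computed inside the cone.\<close>

lemma imp_cone:
  assumes u: "u \<in> carrier A" "u \<preceq> \<one>" and w: "w \<in> carrier A"
  shows "(u \<leadsto> (w \<curlywedge> \<one>)) \<curlywedge> \<one> = (u \<leadsto> w) \<curlywedge> \<one>"
proof -
  have "\<one> \<preceq> u \<leadsto> \<one>" using u by (simp add: one_le_imp)
  then have *: "(u \<leadsto> \<one>) \<curlywedge> \<one> = \<one>"
    using u by (simp add: below_def meet_commute)
  have "(u \<leadsto> (w \<curlywedge> \<one>)) \<curlywedge> \<one> = (u \<leadsto> w) \<curlywedge> ((u \<leadsto> \<one>) \<curlywedge> \<one>)"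
    using u w by (simp add: imp_meet meet_assoc)
  then show ?thesis by (simp add: *)
qed

lemma tilde_le_one:
  assumes "u \<in> carrier A" "u \<preceq> \<one>"
  shows "\<sim> u \<curlywedge> \<one> = \<one>"
proof -
  have "\<one> \<preceq> \<sim> u" using assms by (simp add: tilde_def one_le_imp)
  then show ?thesis using assms by (simp add: below_def meet_commute)
qed

definition cone_pair :: "'a \<Rightarrow> 'a \<times> 'a" where "cone_pair x = (x \<curlywedge> \<one>, \<sim> x \<curlywedge> \<one>)"

text \<open>This is \<open>imp_decomp\<close> met with \<one>, with \<open>imp_cone\<close> applied
  to both halves. The right side is the first component of the implication of the two pairs in K of
  the cone.\<close>

lemma imp_meet_one:
  assumes "x \<in> carrier A" "y \<in> carrier A"
  shows "(x \<leadsto> y) \<curlywedge> \<one> = (((x \<curlywedge> \<one>) \<leadsto> (y \<curlywedge> \<one>)) \<curlywedge> \<one>) \<curlywedge> (((\<sim> y \<curlywedge> \<one>) \<leadsto> (\<sim> x \<curlywedge> \<one>)) \<curlywedge> \<one>)"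
proof -
  have "(x \<leadsto> y) \<curlywedge> \<one> = (((x \<curlywedge> \<one>) \<leadsto> y) \<curlywedge> ((\<sim> y \<curlywedge> \<one>) \<leadsto> \<sim> x)) \<curlywedge> \<one>"
    using assms by (simp add: imp_decomp)
  then show ?thesis
    using assms by (simp only: meet_meet_one imp_in meet_in tilde_in one_in imp_cone meet_le2)
qed

text \<open>Second components are first components of \<sim>-images. The laws \<sim>(xy) = x
  \<leadsto> \<sim>y and \<sim>(x \<leadsto> y) = x \<otimes> \<sim>y exchange products and
  implications, which is how the formulas of \<open>K_alg\<close> arise.\<close>

lemma rl_hom_cone_pair: "rl_hom cone_pair A (K_alg (neg_cone A))"
  unfolding rl_hom_def
proof (intro conjI ballI)
  fix x y assume x: "x \<in> carrier A" and y: "y \<in> carrier A"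
  show "cone_pair x \<in> carrier (K_alg (neg_cone A))"
    using x by (simp add: cone_pair_def K_alg_def neg_cone_def)
  show "cone_pair (x \<curlyvee> y) = cone_pair x \<curlyvee>\<^bsub>K_alg (neg_cone A)\<^esub> cone_pair y"
    using x y by (simp add: cone_pair_def K_alg_def neg_cone_def tilde_join join_meet_one meet_meet_one)
  show "cone_pair (x \<curlywedge> y) = cone_pair x \<curlywedge>\<^bsub>K_alg (neg_cone A)\<^esub> cone_pair y"
    using x y by (simp add: cone_pair_def K_alg_def neg_cone_def tilde_meet join_meet_one meet_meet_one)
  show "cone_pair (x \<otimes> y) = cone_pair x \<otimes>\<^bsub>K_alg (neg_cone A)\<^esub> cone_pair y"
    using x y imp_meet_one[of x "\<sim> y"]
    by (simp add: cone_pair_def K_alg_def neg_cone_def tilde_mult mult_meet_one tilde_tilde)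
  show "cone_pair (x \<leadsto> y) = (cone_pair x \<leadsto>\<^bsub>K_alg (neg_cone A)\<^esub> cone_pair y)"
    using x y imp_meet_one[of x y]
    by (simp add: cone_pair_def K_alg_def neg_cone_def tilde_imp mult_meet_one)
next
  have "\<zero> \<preceq> \<one>" by (simp add: zero_least)
  then show "cone_pair \<zero> = \<zero>\<^bsub>K_alg (neg_cone A)\<^esub>"
    by (simp add: cone_pair_def K_alg_def neg_cone_def tilde_le_one below_def)
qed (simp add: cone_pair_def K_alg_def neg_cone_def tilde_def)

text \<open>Equal pairs put both conjuncts of \<open>imp_meet_one\<close> above \<one>, hence \<one>
  \<preceq> x \<leadsto> y, and symmetrically.\<close>

lemma inj_cone_pair:
  assumes "x \<in> carrier A" "y \<in> carrier A" "cone_pair x = cone_pair y"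
  shows "x = y"
proof -
  have le: "u \<preceq> v" if "u \<in> carrier A" "v \<in> carrier A" "cone_pair u = cone_pair v" for u v
  proof -
    have "\<one> \<preceq> (u \<curlywedge> \<one>) \<leadsto> (v \<curlywedge> \<one>)" "\<one> \<preceq> (\<sim> v \<curlywedge> \<one>) \<leadsto> (\<sim> u \<curlywedge> \<one>)"
      using that by (simp_all add: cone_pair_def one_le_imp)
    then have "\<one> \<preceq> (u \<leadsto> v) \<curlywedge> \<one>"
      using that by (subst imp_meet_one) (simp_all add: le_meet_iff)
    then show ?thesis using that by (simp add: le_meet_iff one_le_imp)
  qed
  show ?thesis using le[of x y] le[of y x] assms le_antisym by simp
qed

end

text \<open>B is the image of A under \<open>cone_pair\<close> followed by one chain quotient in
  both components, so it inherits all equations of A, and the quotient is chosen to keep s = t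
  false.\<close>

lemma representation:
  fixes A :: "'a rl"
  assumes A: "bounded_K_lattice A" and cone: "wajsberg_algebra (neg_cone A)"
    and e: "range e \<subseteq> carrier A" and neq: "eval A e s \<noteq> eval A e t"
  obtains D :: "'a rl" and B where "wajsberg_algebra D"
    "\<And>x y. x \<in> carrier D \<Longrightarrow> y \<in> carrier D \<Longrightarrow> x \<preceq>\<^bsub>D\<^esub> y \<or> y \<preceq>\<^bsub>D\<^esub> x"
    "subuniverse B (K_alg D)" "carrier D \<times> {\<one>\<^bsub>D\<^esub>} \<subseteq> B"
    "\<And>E. satisfies A E \<Longrightarrow> satisfies ((K_alg D)\<lparr>carrier := B\<rparr>) E"
    "\<not> satisfies ((K_alg D)\<lparr>carrier := B\<rparr>) {(s, t)}"
proof -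
  interpret A: bounded_K_lattice A by fact
  interpret C: wajsberg_algebra "neg_cone A" by fact
  let ?C = "neg_cone A"
  have ev: "eval A e s \<in> carrier A" "eval A e t \<in> carrier A"
    using e by (simp_all add: eval_closed A.rl_algebra_axioms)
  have c: "A.cone_pair x \<in> carrier ?C \<times> carrier ?C" if "x \<in> carrier A" for x
    using A.rl_hom_cone_pair that by (auto simp: rl_hom_def K_alg_def)
  have "A.cone_pair (eval A e s) \<noteq> A.cone_pair (eval A e t)"
    using A.inj_cone_pair ev neq by blast
  then obtain g :: "'a \<times> 'a \<Rightarrow> 'a" where g: "g = fst \<or> g = snd"
    "g (A.cone_pair (eval A e s)) \<noteq> g (A.cone_pair (eval A e t))"
    by (metis prod.expand)
  define u v where "u = g (A.cone_pair (eval A e s))" and "v = g (A.cone_pair (eval A e t))"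
  have uv: "u \<in> carrier ?C" "v \<in> carrier ?C" "u \<noteq> v"
    using g c[OF ev(1)] c[OF ev(2)] by (auto simp: u_def v_def)
  \<comment> \<open>A quotient that keeps one of these implications away from 1 keeps u and v
    apart.\<close>
  then have "(u \<leadsto>\<^bsub>?C\<^esub> v) \<noteq> \<one>\<^bsub>?C\<^esub> \<or> (v \<leadsto>\<^bsub>?C\<^esub> u) \<noteq> \<one>\<^bsub>?C\<^esub>"
    using C.le_antisym C.imp_eq_one by blast
  then obtain w where w: "w \<in> carrier ?C" "w \<noteq> \<one>\<^bsub>?C\<^esub>" "w = (u \<leadsto>\<^bsub>?C\<^esub> v) \<or> w = (v \<leadsto>\<^bsub>?C\<^esub> u)"
    using uv C.imp_in by blast
  obtain D :: "'a rl" and r where D: "wajsberg_algebra D" "rl_hom r ?C D" "carrier D = r ` carrier ?C"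
    "\<And>x y. x \<in> carrier D \<Longrightarrow> y \<in> carrier D \<Longrightarrow> x \<preceq>\<^bsub>D\<^esub> y \<or> y \<preceq>\<^bsub>D\<^esub> x" "r w \<noteq> \<one>\<^bsub>D\<^esub>"
    using C.chain_quotient[OF w(1,2)] by blast
  interpret D: wajsberg_algebra D by fact
  have ruv: "r u \<noteq> r v"
  proof
    assume "r u = r v"
    then have "r w = (r u \<leadsto>\<^bsub>D\<^esub> r u)"
      using w uv D(2) by (auto simp: rl_hom_def)
    also have "\<dots> = \<one>\<^bsub>D\<^esub>" using uv D by simp
    finally show False using D by blast
  qed
  define f where "f = map_prod r r \<circ> A.cone_pair"
  have f: "rl_hom f A (K_alg D)"
    unfolding f_def by (rule rl_hom_comp[OF A.rl_hom_cone_pair rl_hom_K_alg[OF C.rl_algebra_axioms D(2)]])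
  define B where "B = f ` carrier A"
  have fB: "rl_hom f A ((K_alg D)\<lparr>carrier := B\<rparr>)"
    unfolding B_def by (rule rl_hom_range[OF f])
  have fneq: "f (eval A e s) \<noteq> f (eval A e t)"
  proof
    assume "f (eval A e s) = f (eval A e t)"
    then have "r u = r v"
      using g by (auto simp: u_def v_def f_def map_prod_def split: prod.splits)
    then show False using ruv by blast
  qed
  show thesis
  proof
    show "subuniverse B (K_alg D)"
      unfolding B_def by (rule subuniverse_image[OF A.rl_algebra_axioms f])
    \<comment> \<open>For x \<preceq> \<one> the second component \<sim>x \<curlywedge> \<one> is
      \<one>, and r maps the cone onto D.\<close>
    show "carrier D \<times> {\<one>\<^bsub>D\<^esub>} \<subseteq> B"
    proof safe
      fix d assume "d \<in> carrier D"
      then obtain x where x: "x \<in> carrier A" "x \<preceq>\<^bsub>A\<^esub> \<one>\<^bsub>A\<^esub>" "d = r x"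
        using D(3) by (auto simp: neg_cone_def)
      then have "f x = (d, \<one>\<^bsub>D\<^esub>)"
        using D(2) by (simp add: f_def A.cone_pair_def A.tilde_le_one rl_hom_def)
          (simp add: below_def neg_cone_def)
      then show "(d, \<one>\<^bsub>D\<^esub>) \<in> B" using x by (force simp: B_def)
    qed
    show "satisfies ((K_alg D)\<lparr>carrier := B\<rparr>) E" if "satisfies A E" for E
      by (rule satisfies_image[OF A.rl_algebra_axioms fB _ that]) (simp add: B_def)
    show "\<not> satisfies ((K_alg D)\<lparr>carrier := B\<rparr>) {(s, t)}"
    proof
      assume "satisfies ((K_alg D)\<lparr>carrier := B\<rparr>) {(s, t)}"
      moreover have "range (\<lambda>n. f (e n)) \<subseteq> carrier ((K_alg D)\<lparr>carrier := B\<rparr>)"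
        using e by (auto simp: B_def)
      ultimately have "eval ((K_alg D)\<lparr>carrier := B\<rparr>) (\<lambda>n. f (e n)) s = eval ((K_alg D)\<lparr>carrier := B\<rparr>) (\<lambda>n. f (e n)) t"
        by (simp add: satisfies_def)
      then show False
        using fneq by (simp add: eval_hom[OF A.rl_algebra_axioms fB e])
    qed
  qed (use D in auto)
qed

section \<open>Eventual embeddings\<close>

text \<open>A sequence of maps that is eventually an embedding on every finite part of \<open>X\<close>; this plays
  the role of an embedding of \<open>X\<close> into an ultraproduct of the \<open>Y n\<close>.\<close>

definition approx_hom :: "(nat \<Rightarrow> 'a \<Rightarrow> 'b) \<Rightarrow> 'a rl \<Rightarrow> (nat \<Rightarrow> 'b rl) \<Rightarrow> bool" where
  "approx_hom h X Y \<longleftrightarrow>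
     (\<forall>x \<in> carrier X. \<forall>\<^sub>F n in sequentially. h n x \<in> carrier (Y n)) \<and>
     (\<forall>x \<in> carrier X. \<forall>y \<in> carrier X. \<forall>\<^sub>F n in sequentially.
        h n (x \<otimes>\<^bsub>X\<^esub> y) = h n x \<otimes>\<^bsub>Y n\<^esub> h n y \<and> h n (x \<curlyvee>\<^bsub>X\<^esub> y) = h n x \<curlyvee>\<^bsub>Y n\<^esub> h n y \<and>
        h n (x \<curlywedge>\<^bsub>X\<^esub> y) = h n x \<curlywedge>\<^bsub>Y n\<^esub> h n y \<and> h n (x \<leadsto>\<^bsub>X\<^esub> y) = (h n x \<leadsto>\<^bsub>Y n\<^esub> h n y)) \<and>
     (\<forall>\<^sub>F n in sequentially. h n \<one>\<^bsub>X\<^esub> = \<one>\<^bsub>Y n\<^esub> \<and> h n \<zero>\<^bsub>X\<^esub> = \<zero>\<^bsub>Y n\<^esub>) \<and>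
     (\<forall>x \<in> carrier X. \<forall>y \<in> carrier X. x \<noteq> y \<longrightarrow> (\<forall>\<^sub>F n in sequentially. h n x \<noteq> h n y))"

lemma approx_homD:
  assumes "approx_hom h X Y"
  shows "x \<in> carrier X \<Longrightarrow> \<forall>\<^sub>F n in sequentially. h n x \<in> carrier (Y n)"
    and "\<lbrakk>x \<in> carrier X; y \<in> carrier X\<rbrakk> \<Longrightarrow> \<forall>\<^sub>F n in sequentially.
        h n (x \<otimes>\<^bsub>X\<^esub> y) = h n x \<otimes>\<^bsub>Y n\<^esub> h n y \<and> h n (x \<curlyvee>\<^bsub>X\<^esub> y) = h n x \<curlyvee>\<^bsub>Y n\<^esub> h n y \<and>
        h n (x \<curlywedge>\<^bsub>X\<^esub> y) = h n x \<curlywedge>\<^bsub>Y n\<^esub> h n y \<and> h n (x \<leadsto>\<^bsub>X\<^esub> y) = (h n x \<leadsto>\<^bsub>Y n\<^esub> h n y)"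
    and "\<forall>\<^sub>F n in sequentially. h n \<one>\<^bsub>X\<^esub> = \<one>\<^bsub>Y n\<^esub> \<and> h n \<zero>\<^bsub>X\<^esub> = \<zero>\<^bsub>Y n\<^esub>"
    and "\<lbrakk>x \<in> carrier X; y \<in> carrier X; x \<noteq> y\<rbrakk> \<Longrightarrow> \<forall>\<^sub>F n in sequentially. h n x \<noteq> h n y"
  using assms by (simp_all add: approx_hom_def)

text \<open>A failure of s = t involves finitely many values, those of the subterms, and on these h
  n is eventually an embedding.\<close>

lemma satisfies_approx:
  assumes h: "approx_hom h X Y" and X: "rl_algebra X" and Y: "\<And>n. rl_algebra (Y n)"
    and E: "\<And>n. satisfies (Y n) E"
  shows "satisfies X E"
  unfolding satisfies_def
proof safe
  fix s t and e :: "nat \<Rightarrow> 'a" assume st: "(s, t) \<in> E" and e: "range e \<subseteq> carrier X"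
  note D = approx_homD[OF h]
  \<comment> \<open>Each variable eventually lands in Y n, but perhaps no n serves all variables at
    once; the default \<one> makes every \<open>e' n\<close> a valuation.\<close>
  define e' where "e' n k = (if h n (e k) \<in> carrier (Y n) then h n (e k) else \<one>\<^bsub>Y n\<^esub>)" for n k
  have e': "range (e' n) \<subseteq> carrier (Y n)" for n
    using rl_algebra.one_in[OF Y] by (auto simp: e'_def)
  have ev: "\<forall>\<^sub>F n in sequentially. eval (Y n) (e' n) u = h n (eval X e u)" for u
  proof (induction u)
    case (Var k)
    have "e k \<in> carrier X" using e by auto
    from D(1)[OF this] show ?case by eventually_elim (simp add: e'_def)
  next
    case (Join u v)
    with D(2)[OF eval_closed[OF X e] eval_closed[OF X e], of u v] show ?case
      by eventually_elim simp
  next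
    case (Meet u v)
    with D(2)[OF eval_closed[OF X e] eval_closed[OF X e], of u v] show ?case
      by eventually_elim simp
  next
    case (Mult u v)
    with D(2)[OF eval_closed[OF X e] eval_closed[OF X e], of u v] show ?case
      by eventually_elim simp
  next
    case (Imp u v)
    with D(2)[OF eval_closed[OF X e] eval_closed[OF X e], of u v] show ?case
      by eventually_elim simp
  next
    case Zero
    from D(3) show ?case by eventually_elim simp
  next
    case One
    from D(3) show ?case by eventually_elim simp
  qed
  show "eval X e s = eval X e t"
  proof (rule ccontr)
    assume "eval X e s \<noteq> eval X e t"
    from D(4)[OF eval_closed[OF X e] eval_closed[OF X e] this] ev[of s] ev[of t]
    have "\<forall>\<^sub>F n in sequentially. eval (Y n) (e' n) s \<noteq> eval (Y n) (e' n) t"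
      by eventually_elim simp
    moreover have "eval (Y n) (e' n) s = eval (Y n) (e' n) t" for n
      using E[of n] st e'[of n] unfolding satisfies_def by blast
    ultimately show False by simp
  qed
qed

lemma approx_hom_embedding:
  assumes "rl_hom f X Y" "inj_on f (carrier X)"
  shows "approx_hom (\<lambda>_. f) X (\<lambda>_. Y)"
  using assms by (auto simp: approx_hom_def rl_hom_def inj_on_def)

lemma satisfies_embedding:
  assumes "rl_hom f X Y" "inj_on f (carrier X)" "rl_algebra X" "rl_algebra Y" "satisfies Y E"
  shows "satisfies X E"
  using satisfies_approx[OF approx_hom_embedding[OF assms(1,2)]] assms by blast

lemma satisfies_subuniverse:
  assumes "rl_algebra A" "subuniverse B A" "satisfies A E"
  shows "satisfies (A\<lparr>carrier := B\<rparr>) E"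
  by (rule satisfies_embedding[of id _ A]) (use assms in \<open>auto simp: rl_hom_def subuniverse_def\<close>)

lemma rl_algebra_K_alg:
  assumes "rl_algebra A" shows "rl_algebra (K_alg A)"
proof -
  interpret rl_algebra A by fact
  show ?thesis
    by unfold_locales (auto simp: K_alg_def mult_in join_in meet_in imp_in one_in zero_in)
qed

lemma approx_hom_K_alg:
  assumes X: "rl_algebra X" and h: "approx_hom h X Y"
  shows "approx_hom (\<lambda>n. map_prod (h n) (h n)) (K_alg X) (\<lambda>n. K_alg (Y n))"
proof -
  interpret rl_algebra X by fact
  note D = approx_homD[OF h]
  show ?thesis
    unfolding approx_hom_def
  proof (intro conjI ballI impI)
    fix x assume "x \<in> carrier (K_alg X)"
    then obtain a b where x: "x = (a, b)" "a \<in> carrier X" "b \<in> carrier X"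
      by (auto simp: K_alg_def)
    show "\<forall>\<^sub>F n in sequentially. map_prod (h n) (h n) x \<in> carrier (K_alg (Y n))"
      using D(1)[OF x(2)] D(1)[OF x(3)] by eventually_elim (simp add: x K_alg_def)
  next
    fix x y assume "x \<in> carrier (K_alg X)" "y \<in> carrier (K_alg X)"
    then obtain a b c d where x: "x = (a, b)" "a \<in> carrier X" "b \<in> carrier X"
      and y: "y = (c, d)" "c \<in> carrier X" "d \<in> carrier X"
      by (auto simp: K_alg_def)
    show "\<forall>\<^sub>F n in sequentially.
        map_prod (h n) (h n) (x \<otimes>\<^bsub>K_alg X\<^esub> y) = map_prod (h n) (h n) x \<otimes>\<^bsub>K_alg (Y n)\<^esub> map_prod (h n) (h n) y \<and>
        map_prod (h n) (h n) (x \<curlyvee>\<^bsub>K_alg X\<^esub> y) = map_prod (h n) (h n) x \<curlyvee>\<^bsub>K_alg (Y n)\<^esub> map_prod (h n) (h n) y \<and>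
        map_prod (h n) (h n) (x \<curlywedge>\<^bsub>K_alg X\<^esub> y) = map_prod (h n) (h n) x \<curlywedge>\<^bsub>K_alg (Y n)\<^esub> map_prod (h n) (h n) y \<and>
        map_prod (h n) (h n) (x \<leadsto>\<^bsub>K_alg X\<^esub> y) = (map_prod (h n) (h n) x \<leadsto>\<^bsub>K_alg (Y n)\<^esub> map_prod (h n) (h n) y)"
      using D(2)[OF x(2) y(2)] D(2)[OF x(3) y(3)] D(2)[OF x(2) y(3)] D(2)[OF y(2) x(3)] D(2)[OF y(3) x(3)]
        D(2)[OF imp_in[OF x(2) y(3)] imp_in[OF y(2) x(3)]]
        D(2)[OF imp_in[OF x(2) y(2)] imp_in[OF y(3) x(3)]]
      by eventually_elim (simp add: x y K_alg_def)
  next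
    show "\<forall>\<^sub>F n in sequentially. map_prod (h n) (h n) \<one>\<^bsub>K_alg X\<^esub> = \<one>\<^bsub>K_alg (Y n)\<^esub> \<and>
        map_prod (h n) (h n) \<zero>\<^bsub>K_alg X\<^esub> = \<zero>\<^bsub>K_alg (Y n)\<^esub>"
      using D(3) by eventually_elim (simp add: K_alg_def)
  next
    fix x y assume *: "x \<in> carrier (K_alg X)" "y \<in> carrier (K_alg X)" "x \<noteq> y"
    then obtain a b c d where x: "x = (a, b)" "a \<in> carrier X" "b \<in> carrier X"
      and y: "y = (c, d)" "c \<in> carrier X" "d \<in> carrier X"
      by (auto simp: K_alg_def)
    show "\<forall>\<^sub>F n in sequentially. map_prod (h n) (h n) x \<noteq> map_prod (h n) (h n) y"
    proof (cases "a = c")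
      case True
      then have "b \<noteq> d" using * x y by simp
      from D(4)[OF x(3) y(3) this] show ?thesis by eventually_elim (simp add: x y)
    next
      case False
      from D(4)[OF x(2) y(2) this] show ?thesis by eventually_elim (simp add: x y)
    qed
  qed
qed

lemma approx_hom_sub:
  assumes "approx_hom h X Y" "S \<subseteq> carrier X"
    "\<And>x. x \<in> S \<Longrightarrow> \<forall>\<^sub>F n in sequentially. h n x \<in> T n"
  shows "approx_hom h (X\<lparr>carrier := S\<rparr>) (\<lambda>n. (Y n)\<lparr>carrier := T n\<rparr>)"
  using assms unfolding approx_hom_def by (simp add: subset_iff)

text \<open>The universe \<open>{(u, v). u \<oplus> v = \<one>}\<close> of the smallest admissible subalgebra, with \<open>u \<oplus> v = \<one>\<close>
  written as \<open>\<not> u \<le> v\<close>.\<close>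

definition K0_set :: "'a rl \<Rightarrow> ('a \<times> 'a) set" where
  "K0_set A = {(u, v). u \<in> carrier A \<and> v \<in> carrier A \<and> (u \<leadsto>\<^bsub>A\<^esub> \<zero>\<^bsub>A\<^esub>) \<preceq>\<^bsub>A\<^esub> v}"

text \<open>Inside B, (1, uv) is (uv, 1) \<leadsto> (1, 1), and (u, 1) \<otimes> (1, uv) = (u, u
  \<leadsto> uv) = (u, v) by \<open>imp_mult_right\<close>.\<close>

lemma (in wajsberg_algebra) K0_set_subset:
  assumes B: "subuniverse B (K_alg A)" and cone: "carrier A \<times> {\<one>} \<subseteq> B"
  shows "K0_set A \<subseteq> B"
proof safe
  fix u v assume "(u, v) \<in> K0_set A"
  then have uv: "u \<in> carrier A" "v \<in> carrier A" "neg u \<preceq> v"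
    by (auto simp: K0_set_def neg_def)
  interpret B: rl_algebra "(K_alg A)\<lparr>carrier := B\<rparr>"
    using B by (simp add: subuniverse_def)
  have "(u \<otimes> v, \<one>) \<in> B" "(u, \<one>) \<in> B" "(\<one>, \<one>) \<in> B"
    using uv cone by auto
  from B.imp_in[of "(u \<otimes> v, \<one>)" "(\<one>, \<one>)"] this
  have "(\<one>, u \<otimes> v) \<in> B"
    using uv by (simp add: K_alg_def)
  with B.mult_in[of "(u, \<one>)" "(\<one>, u \<otimes> v)"] \<open>(u, \<one>) \<in> B\<close>
  show "(u, v) \<in> B"
    using uv by (simp add: K_alg_def imp_mult_right)
qed

text \<open>The condition \<not>u \<preceq> v is an identity between meets, so h n preserves it
  eventually and the pair lands in \<open>K0_set (D n)\<close>, which is part of B n. Allowing any S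
  inside \<open>K0_set X\<close> covers \<open>K0_alg chang\<close>, whose universe is an
  intersection.\<close>

lemma approx_hom_K0:
  assumes X: "rl_algebra X" and h: "approx_hom h X D"
    and D: "\<And>n. wajsberg_algebra (D n)" and B: "\<And>n. subuniverse (B n) (K_alg (D n))"
      "\<And>n. carrier (D n) \<times> {\<one>\<^bsub>D n\<^esub>} \<subseteq> B n"
    and S: "S \<subseteq> K0_set X"
  shows "approx_hom (\<lambda>n. map_prod (h n) (h n)) ((K_alg X)\<lparr>carrier := S\<rparr>)
    (\<lambda>n. (K_alg (D n))\<lparr>carrier := B n\<rparr>)"
proof (rule approx_hom_sub[OF approx_hom_K_alg[OF X h]])
  show "S \<subseteq> carrier (K_alg X)" using S by (auto simp: K0_set_def K_alg_def)
  fix x assume "x \<in> S"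
  then obtain u v where x: "x = (u, v)" "u \<in> carrier X" "v \<in> carrier X"
    and uv: "(u \<leadsto>\<^bsub>X\<^esub> \<zero>\<^bsub>X\<^esub>) \<curlywedge>\<^bsub>X\<^esub> v = (u \<leadsto>\<^bsub>X\<^esub> \<zero>\<^bsub>X\<^esub>)"
    using S by (auto simp: K0_set_def below_def)
  note h = approx_homD[OF h]
  have z: "\<zero>\<^bsub>X\<^esub> \<in> carrier X" "(u \<leadsto>\<^bsub>X\<^esub> \<zero>\<^bsub>X\<^esub>) \<in> carrier X"
    using X x by (auto intro: rl_algebra.zero_in rl_algebra.imp_in)
  show "\<forall>\<^sub>F n in sequentially. map_prod (h n) (h n) x \<in> B n"
    using h(1)[OF x(2)] h(1)[OF x(3)] h(3) h(2)[OF x(2) z(1)] h(2)[OF z(2) x(3)]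
  proof eventually_elim
    case (elim n)
    then have "map_prod (h n) (h n) x \<in> K0_set (D n)"
      by (simp add: K0_set_def below_def x) (metis uv)
    then show ?case
      using wajsberg_algebra.K0_set_subset[OF D B] by blast
  qed
qed

lemma satisfies_K0:
  assumes "rl_algebra X" "approx_hom h X D"
    "\<And>n. wajsberg_algebra (D n)" "\<And>n. subuniverse (B n) (K_alg (D n))"
    "\<And>n. carrier (D n) \<times> {\<one>\<^bsub>D n\<^esub>} \<subseteq> B n"
    "S \<subseteq> K0_set X" "rl_algebra ((K_alg X)\<lparr>carrier := S\<rparr>)"
    "\<And>n. satisfies ((K_alg (D n))\<lparr>carrier := B n\<rparr>) E"
  shows "satisfies ((K_alg X)\<lparr>carrier := S\<rparr>) E"
  using satisfies_approx[OF approx_hom_K0[OF assms(1-6)] assms(7)] assms(4,8)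
  by (simp add: subuniverse_def)

text \<open>In a Wajsberg algebra all operations are terms in \<open>\<leadsto>\<close> and \<open>\<zero>\<close>.\<close>

lemma approx_hom_impI:
  assumes X: "rl_algebra X"
    and Xm: "\<And>x y. x \<in> carrier X \<Longrightarrow> y \<in> carrier X \<Longrightarrow>
      x \<otimes>\<^bsub>X\<^esub> y = ((x \<leadsto>\<^bsub>X\<^esub> (y \<leadsto>\<^bsub>X\<^esub> \<zero>\<^bsub>X\<^esub>)) \<leadsto>\<^bsub>X\<^esub> \<zero>\<^bsub>X\<^esub>)"
    and Xj: "\<And>x y. x \<in> carrier X \<Longrightarrow> y \<in> carrier X \<Longrightarrow> x \<curlyvee>\<^bsub>X\<^esub> y = ((x \<leadsto>\<^bsub>X\<^esub> y) \<leadsto>\<^bsub>X\<^esub> y)"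
    and Xn: "\<And>x y. x \<in> carrier X \<Longrightarrow> y \<in> carrier X \<Longrightarrow> x \<curlywedge>\<^bsub>X\<^esub> y = x \<otimes>\<^bsub>X\<^esub> (x \<leadsto>\<^bsub>X\<^esub> y)"
    and X1: "\<one>\<^bsub>X\<^esub> = (\<zero>\<^bsub>X\<^esub> \<leadsto>\<^bsub>X\<^esub> \<zero>\<^bsub>X\<^esub>)"
    and Y: "\<And>n. wajsberg_algebra (Y n)"
    and h: "\<And>x. x \<in> carrier X \<Longrightarrow> \<forall>\<^sub>F n in sequentially. h n x \<in> carrier (Y n)"
    and h0: "\<forall>\<^sub>F n in sequentially. h n \<zero>\<^bsub>X\<^esub> = \<zero>\<^bsub>Y n\<^esub>"
    and hi: "\<And>x y. x \<in> carrier X \<Longrightarrow> y \<in> carrier X \<Longrightarrow>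
      \<forall>\<^sub>F n in sequentially. h n (x \<leadsto>\<^bsub>X\<^esub> y) = (h n x \<leadsto>\<^bsub>Y n\<^esub> h n y)"
    and inj: "\<And>x y. x \<in> carrier X \<Longrightarrow> y \<in> carrier X \<Longrightarrow> x \<noteq> y \<Longrightarrow>
      \<forall>\<^sub>F n in sequentially. h n x \<noteq> h n y"
  shows "approx_hom h X Y"
proof -
  interpret X: rl_algebra X by fact
  note [simp] = X.mult_in X.join_in X.meet_in X.imp_in X.one_in X.zero_in
  have hm: "\<forall>\<^sub>F n in sequentially. h n (x \<otimes>\<^bsub>X\<^esub> y) = h n x \<otimes>\<^bsub>Y n\<^esub> h n y"
    if "x \<in> carrier X" "y \<in> carrier X" for x y
    using h0 h[OF that(1)] h[OF that(2)] hi[OF that(2) X.zero_in]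
      hi[of x "y \<leadsto>\<^bsub>X\<^esub> \<zero>\<^bsub>X\<^esub>", OF that(1) X.imp_in[OF that(2) X.zero_in]]
      hi[of "x \<leadsto>\<^bsub>X\<^esub> (y \<leadsto>\<^bsub>X\<^esub> \<zero>\<^bsub>X\<^esub>)" "\<zero>\<^bsub>X\<^esub>", OF X.imp_in[OF that(1) X.imp_in[OF that(2) X.zero_in]] X.zero_in]
    by eventually_elim
      (use that in \<open>simp add: Xm wajsberg_algebra.mult_neg_imp[OF Y] wajsberg_algebra.neg_def[OF Y]\<close>)
  show ?thesis
    unfolding approx_hom_def
  proof (intro conjI ballI impI)
    fix x y assume x: "x \<in> carrier X" and y: "y \<in> carrier X"
    show "\<forall>\<^sub>F n in sequentially.
        h n (x \<otimes>\<^bsub>X\<^esub> y) = h n x \<otimes>\<^bsub>Y n\<^esub> h n y \<and> h n (x \<curlyvee>\<^bsub>X\<^esub> y) = h n x \<curlyvee>\<^bsub>Y n\<^esub> h n y \<and>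
        h n (x \<curlywedge>\<^bsub>X\<^esub> y) = h n x \<curlywedge>\<^bsub>Y n\<^esub> h n y \<and> h n (x \<leadsto>\<^bsub>X\<^esub> y) = (h n x \<leadsto>\<^bsub>Y n\<^esub> h n y)"
      using h[OF x] h[OF y] hm[OF x y] hi[OF x y] hi[OF X.imp_in[OF x y] y] hm[OF x X.imp_in[OF x y]]
      by eventually_elim
        (use x y in \<open>simp add: Xj Xn wajsberg_algebra.join_eq[OF Y] wajsberg_algebra.meet_eq[OF Y]\<close>)
  next
    show "\<forall>\<^sub>F n in sequentially. h n \<one>\<^bsub>X\<^esub> = \<one>\<^bsub>Y n\<^esub> \<and> h n \<zero>\<^bsub>X\<^esub> = \<zero>\<^bsub>Y n\<^esub>"
      using h0 hi[OF X.zero_in X.zero_in] h[OF X.zero_in]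
    proof eventually_elim
      case (elim n)
      interpret Y: wajsberg_algebra "Y n" by (rule Y)
      show ?case using elim by (simp add: X1)
    qed
  qed (use h inj in auto)
qed

section \<open>Lukasiewicz chains and the Chang algebra\<close>

lemma subuniverseI:
  assumes "B \<subseteq> carrier A" "\<one>\<^bsub>A\<^esub> \<in> B" "\<zero>\<^bsub>A\<^esub> \<in> B"
    "\<And>x y. x \<in> B \<Longrightarrow> y \<in> B \<Longrightarrow> x \<otimes>\<^bsub>A\<^esub> y \<in> B"
    "\<And>x y. x \<in> B \<Longrightarrow> y \<in> B \<Longrightarrow> x \<curlyvee>\<^bsub>A\<^esub> y \<in> B"
    "\<And>x y. x \<in> B \<Longrightarrow> y \<in> B \<Longrightarrow> x \<curlywedge>\<^bsub>A\<^esub> y \<in> B"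
    "\<And>x y. x \<in> B \<Longrightarrow> y \<in> B \<Longrightarrow> (x \<leadsto>\<^bsub>A\<^esub> y) \<in> B"
  shows "subuniverse B A"
  using assms by (simp add: subuniverse_def rl_algebra_def)

lemma luk_simps [simp]:
  "x \<otimes>\<^bsub>luk n\<^esub> y = max 0 (x + y - 1)" "\<one>\<^bsub>luk n\<^esub> = 1" "x \<curlyvee>\<^bsub>luk n\<^esub> y = max x y"
  "x \<curlywedge>\<^bsub>luk n\<^esub> y = min x y" "(x \<leadsto>\<^bsub>luk n\<^esub> y) = min 1 (1 - x + y)" "\<zero>\<^bsub>luk n\<^esub> = 0"
  by (simp_all add: luk_def)

lemma below_luk [simp]: "x \<preceq>\<^bsub>luk n\<^esub> y \<longleftrightarrow> x \<le> y"
  by (auto simp: below_def min_def)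

lemma carrier_luk: "carrier (luk n) = {real k / real n |k. k \<le> n}"
  by (simp add: luk_def)

lemma luk_bounds: "x \<in> carrier (luk n) \<Longrightarrow> 0 \<le> x \<and> x \<le> 1"
  unfolding carrier_luk by (auto intro: divide_le_eq_1[THEN iffD2])

lemma luk_in: "k \<le> n \<Longrightarrow> real k / real n \<in> carrier (luk n)"
  by (auto simp: carrier_luk)

lemma wajsberg_luk:
  assumes "n \<ge> 1" shows "wajsberg_algebra (luk n)"
proof -
  have n: "real n > 0" using assms by simp
  \<comment> \<open>Closure is a matter of numerators; subtraction on \<open>nat\<close> is
    truncated and so takes the place of \<open>max 0\<close>.\<close>
  have cl: "max 0 (real j / real n + real k / real n - 1) = real (j + k - n) / real n"
    "min 1 (1 - real j / real n + real k / real n) = real (min n (n - j + k)) / real n"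
    if "j \<le> n" "k \<le> n" for j k
    using n that by (auto simp: divide_simps max_def min_def of_nat_diff)
  interpret rl_algebra "luk n"
  proof
    show "x \<otimes>\<^bsub>luk n\<^esub> y \<in> carrier (luk n)" if xy: "x \<in> carrier (luk n)" "y \<in> carrier (luk n)" for x y
    proof -
      obtain j k where jk: "j \<le> n" "k \<le> n" "x = real j / real n" "y = real k / real n"
        using xy unfolding carrier_luk by blast
      then show ?thesis
        by (simp only: luk_simps cl) (auto intro!: luk_in)
    qed
    show "(x \<leadsto>\<^bsub>luk n\<^esub> y) \<in> carrier (luk n)" if xy: "x \<in> carrier (luk n)" "y \<in> carrier (luk n)" for x y
    proof -
      obtain j k where jk: "j \<le> n" "k \<le> n" "x = real j / real n" "y = real k / real n"
        using xy unfolding carrier_luk by blast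
      then show ?thesis
        by (simp only: luk_simps cl) (auto intro!: luk_in)
    qed
    show "\<one>\<^bsub>luk n\<^esub> \<in> carrier (luk n)"
      using n by (auto simp: carrier_luk intro!: exI[of _ n])
    show "\<zero>\<^bsub>luk n\<^esub> \<in> carrier (luk n)"
      by (auto simp: carrier_luk intro!: exI[of _ 0])
  qed (auto simp: max_def min_def)
  interpret comm_monoid "luk n"
  proof (rule comm_monoidI)
    show "x \<otimes>\<^bsub>luk n\<^esub> y \<otimes>\<^bsub>luk n\<^esub> z = x \<otimes>\<^bsub>luk n\<^esub> (y \<otimes>\<^bsub>luk n\<^esub> z)"
      if "x \<in> carrier (luk n)" "y \<in> carrier (luk n)" "z \<in> carrier (luk n)" for x y z
      using that[THEN luk_bounds] by (auto simp: max_def)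
  qed (use mult_in one_in in \<open>auto dest: luk_bounds\<close>)
  show ?thesis
    by unfold_locales (auto simp: max_def min_def dest!: luk_bounds)
qed

lemmas rl_algebra_luk = wajsberg_algebra.axioms(1)[OF wajsberg_luk,
    THEN bounded_comm_residuated_lattice.axioms(1), THEN comm_residuated_lattice.axioms(1)]

lemma K_luk_simps [simp]:
  "carrier (K_alg (luk n)) = carrier (luk n) \<times> carrier (luk n)"
  "(a, b) \<otimes>\<^bsub>K_alg (luk n)\<^esub> (c, d) = (max 0 (a + c - 1), min (min 1 (1 - a + d)) (min 1 (1 - c + b)))"
  "(a, b) \<curlyvee>\<^bsub>K_alg (luk n)\<^esub> (c, d) = (max a c, min b d)"
  "(a, b) \<curlywedge>\<^bsub>K_alg (luk n)\<^esub> (c, d) = (min a c, max b d)"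
  "((a, b) \<leadsto>\<^bsub>K_alg (luk n)\<^esub> (c, d)) = (min (min 1 (1 - a + c)) (min 1 (1 - d + b)), max 0 (a + d - 1))"
  "\<one>\<^bsub>K_alg (luk n)\<^esub> = (1, 1)" "\<zero>\<^bsub>K_alg (luk n)\<^esub> = (0, 1)"
  by (simp_all add: K_alg_def)

lemma K0p_eq: "K0p p = (K_alg (luk p))\<lparr>carrier := K0_set (luk p)\<rparr>"
proof -
  have "oplus u v = 1 \<longleftrightarrow> min 1 (1 - u) \<le> v" if "u \<in> carrier (luk p)" "v \<in> carrier (luk p)" for u v
    using luk_bounds[OF that(1)] luk_bounds[OF that(2)] by (auto simp: oplus_def min_def)
  then show ?thesis
    unfolding K0p_def K0_set_def by (intro arg_cong[of _ _ "\<lambda>S. (K_alg (luk p))\<lparr>carrier := S\<rparr>"]) auto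
qed

lemma subuniverse_K0_luk:
  assumes "n \<ge> 1" shows "subuniverse (K0_set (luk n)) (K_alg (luk n))"
proof -
  interpret rl_algebra "K_alg (luk n)"
    using rl_algebra_K_alg rl_algebra_luk assms by blast
  have K0: "(u, v) \<in> K0_set (luk n) \<longleftrightarrow> (u, v) \<in> carrier (K_alg (luk n)) \<and> u + v \<ge> 1" for u v
    using luk_bounds[of u n] luk_bounds[of v n] by (auto simp: K0_set_def)
  have bd: "0 \<le> u \<and> u \<le> 1 \<and> 0 \<le> v \<and> v \<le> 1" if "(u, v) \<in> K0_set (luk n)" for u v
    using that luk_bounds[of u n] luk_bounds[of v n] by (auto simp: K0_set_def)
  show ?thesis
  proof (rule subuniverseI)
    show "K0_set (luk n) \<subseteq> carrier (K_alg (luk n))"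
      by (auto simp: K0_set_def)
    have sub: "x \<in> K0_set (luk n) \<Longrightarrow> x \<in> carrier (K_alg (luk n))" for x
      by (auto simp: K0_set_def)
    fix x y assume xy: "x \<in> K0_set (luk n)" "y \<in> K0_set (luk n)"
    then obtain a b c d where x: "x = (a, b)" "a + b \<ge> 1" and y: "y = (c, d)" "c + d \<ge> 1"
      by (cases x; cases y) (auto simp: K0)
    note b = bd[of a b] bd[of c d] xy[unfolded x y]
    note c = sub[OF xy(1)] sub[OF xy(2)]
    show "x \<otimes>\<^bsub>K_alg (luk n)\<^esub> y \<in> K0_set (luk n)"
      using mult_in[OF c] b x y by (simp add: K0 del: K_luk_simps(1))
    show "x \<curlyvee>\<^bsub>K_alg (luk n)\<^esub> y \<in> K0_set (luk n)"
      using join_in[OF c] b x y by (simp add: K0 del: K_luk_simps(1))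
    show "x \<curlywedge>\<^bsub>K_alg (luk n)\<^esub> y \<in> K0_set (luk n)"
      using meet_in[OF c] b x y by (simp add: K0 del: K_luk_simps(1))
    show "(x \<leadsto>\<^bsub>K_alg (luk n)\<^esub> y) \<in> K0_set (luk n)"
      using imp_in[OF c] b x y by (simp add: K0 del: K_luk_simps(1))
  next
    show "\<one>\<^bsub>K_alg (luk n)\<^esub> \<in> K0_set (luk n)"
      using one_in by (simp add: K0 del: K_luk_simps(1))
    show "\<zero>\<^bsub>K_alg (luk n)\<^esub> \<in> K0_set (luk n)"
      using zero_in by (simp add: K0 del: K_luk_simps(1))
  qed
qed

lemma rl_algebra_K0p: "n \<ge> 1 \<Longrightarrow> rl_algebra (K0p n)"
  using subuniverse_K0_luk by (simp add: K0p_eq subuniverse_def)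

section \<open>Lukasiewicz chains inside Wajsberg algebras\<close>

context wajsberg_algebra
begin

text \<open>Here (N+1)a = a \<oplus> \<not>a = 1, so cancellation at N + 1 turns negation into
  subtraction from N + 1.\<close>

lemma cyclic_neg:
  assumes "a \<in> carrier A" "nm N a = neg a" "l \<le> Suc N"
  shows "neg (nm l a) = nm (Suc N - l) a"
  using assms nm_plus_neg[of a N "Suc N - l" "Suc N"] by simp

text \<open>The index on the right is the numerator of j/(N+1) \<leadsto> k/(N+1) in
  \<open>luk (Suc N)\<close>.\<close>

lemma cyclic_imp:
  assumes a: "a \<in> carrier A" "nm N a = neg a" and jk: "j \<le> Suc N" "k \<le> Suc N"
  shows "nm j a \<leadsto> nm k a = nm (min (Suc N) (Suc N - j + k)) a"
proof (cases "j \<le> k")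
  case True
  then have "nm j a \<leadsto> nm k a = \<one>"
    using a by (simp add: imp_eq_one nm_mono)
  moreover have "min (Suc N) (Suc N - j + k) = Suc N"
    using True jk by simp
  ultimately show ?thesis
    using a by simp
next
  case False
  then have "nm j a \<leadsto> nm k a = neg (nm (j - k) a)"
    using a jk nm_plus_neg[of a N k j] plus_comm[of "nm k a" "neg (nm j a)"]
    by (simp add: imp_eq_plus)
  also have "\<dots> = nm (Suc N - (j - k)) a"
    using a jk cyclic_neg[of a N "j - k"] by simp
  also have "Suc N - (j - k) = min (Suc N) (Suc N - j + k)"
    using False jk by simp
  finally show ?thesis .
qed

text \<open>A genuine embedding, taken as a constant sequence: j/(N+1) goes to ja, and the floor
  recovers the numerator j.\<close>

lemma approx_hom_luk:
  assumes a: "a \<in> carrier A" "a \<noteq> \<zero>" "nm N a = neg a"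
  shows "approx_hom (\<lambda>_ x. nm (nat \<lfloor>x * real (Suc N)\<rfloor>) a) (luk (Suc N)) (\<lambda>_. A)"
proof (rule approx_hom_impI)
  let ?m = "Suc N"
  have idx: "nat \<lfloor>real k / real ?m * real ?m\<rfloor> = k" for k
    by (simp del: of_nat_Suc)
  have imp: "min 1 (1 - real j / real ?m + real k / real ?m) = real (min ?m (?m - j + k)) / real ?m"
    if "j \<le> ?m" for j k
    using that by (auto simp: divide_simps min_def of_nat_diff simp del: of_nat_Suc)
  show "rl_algebra (luk ?m)" by (rule rl_algebra_luk) simp
  show "wajsberg_algebra A" by (rule wajsberg_algebra_axioms)
  fix x y assume x: "x \<in> carrier (luk ?m)" and y: "y \<in> carrier (luk ?m)"
  note bx = luk_bounds[OF x] luk_bounds[OF y]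
  show "x \<otimes>\<^bsub>luk ?m\<^esub> y = ((x \<leadsto>\<^bsub>luk ?m\<^esub> (y \<leadsto>\<^bsub>luk ?m\<^esub> \<zero>\<^bsub>luk ?m\<^esub>)) \<leadsto>\<^bsub>luk ?m\<^esub> \<zero>\<^bsub>luk ?m\<^esub>)"
    "x \<curlyvee>\<^bsub>luk ?m\<^esub> y = ((x \<leadsto>\<^bsub>luk ?m\<^esub> y) \<leadsto>\<^bsub>luk ?m\<^esub> y)"
    "x \<curlywedge>\<^bsub>luk ?m\<^esub> y = x \<otimes>\<^bsub>luk ?m\<^esub> (x \<leadsto>\<^bsub>luk ?m\<^esub> y)"
    using bx by (auto simp: max_def min_def)
  obtain j k where jk: "j \<le> ?m" "k \<le> ?m" "x = real j / real ?m" "y = real k / real ?m"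
    using x y unfolding carrier_luk by blast
  show "\<forall>\<^sub>F n in sequentially. nm (nat \<lfloor>(x \<leadsto>\<^bsub>luk ?m\<^esub> y) * real ?m\<rfloor>) a
      = nm (nat \<lfloor>x * real ?m\<rfloor>) a \<leadsto> nm (nat \<lfloor>y * real ?m\<rfloor>) a"
    using jk a by (simp only: luk_simps imp idx cyclic_imp) simp
  assume "x \<noteq> y"
  then have "j \<noteq> k" using jk by auto
  then have "nm j a \<noteq> nm k a"
    using nm_inj[of a N j k] nm_inj[of a N k j] a jk by (cases "j < k") auto
  then show "\<forall>\<^sub>F n in sequentially. nm (nat \<lfloor>x * real ?m\<rfloor>) a \<noteq> nm (nat \<lfloor>y * real ?m\<rfloor>) a"
    using jk by (simp only: idx) simp
qed (use a in auto)

lemma satisfies_K0p_cyclic: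
  assumes a: "a \<in> carrier A" "a \<noteq> \<zero>" "nm N a = neg a"
    and B: "subuniverse B (K_alg A)" "carrier A \<times> {\<one>} \<subseteq> B"
    and E: "satisfies ((K_alg A)\<lparr>carrier := B\<rparr>) E"
  shows "satisfies (K0p (Suc N)) E"
  unfolding K0p_eq
  by (rule satisfies_K0[OF rl_algebra_luk approx_hom_luk[OF a], where B = "\<lambda>_. B"])
    (use B E wajsberg_algebra_axioms rl_algebra_K0p[of "Suc N"] in \<open>auto simp: K0p_eq\<close>)

end

lemma satisfies_K0p_dvd:
  assumes "p dvd m" "m \<ge> 1" and E: "satisfies (K0p m) E"
  shows "satisfies (K0p p) E"
proof -
  have p: "p \<ge> 1" using assms by (auto intro: Suc_leI dvd_pos_nat)
  have sub: "carrier (luk p) \<subseteq> carrier (luk m)"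
  proof
    fix x assume "x \<in> carrier (luk p)"
    then obtain k where k: "k \<le> p" "x = real k / real p" by (auto simp: carrier_luk)
    obtain q where q: "m = p * q" using assms by blast
    then have "x = real (k * q) / real m" "k * q \<le> m"
      using k assms by auto
    then show "x \<in> carrier (luk m)" by (simp only: luk_in)
  qed
  then have "K0_set (luk p) \<subseteq> K0_set (luk m)"
    by (auto simp: K0_set_def)
  \<comment> \<open>The operations of \<open>luk n\<close> are the same for all n, so the inclusion
    of carriers is an embedding.\<close>
  then have "rl_hom id (K0p p) (K0p m)"
    by (auto simp: rl_hom_def K0p_eq K_alg_def luk_def)
  then show ?thesis
    using satisfies_embedding[of id "K0p p" "K0p m" E] rl_algebra_K0p p assms by simp
qed

section \<open>The Chang algebra\<close>

lemma chang_simps [simp]: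
  "p \<otimes>\<^bsub>chang\<^esub> q = max (0, 0) (p + q - (1, 0))" "\<one>\<^bsub>chang\<^esub> = (1, 0)" "p \<curlyvee>\<^bsub>chang\<^esub> q = max p q"
  "p \<curlywedge>\<^bsub>chang\<^esub> q = min p q" "(p \<leadsto>\<^bsub>chang\<^esub> q) = min (1, 0) ((1, 0) - p + q)" "\<zero>\<^bsub>chang\<^esub> = (0, 0)"
  by (simp_all add: chang_def)

lemma below_chang [simp]: "x \<preceq>\<^bsub>chang\<^esub> y \<longleftrightarrow> x \<le> y"
  by (auto simp: below_def min_def)

text \<open>The infinitesimals (0, k) and their negations (1, -k).\<close>

lemma carrier_chang: "carrier chang = {(0, int k) |k. True} \<union> {(1, - int k) |k. True}"
proof -
  have "p \<in> carrier chang \<longleftrightarrow> (fst p = 0 \<and> snd p \<ge> 0) \<or> (fst p = 1 \<and> snd p \<le> 0)" for p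
    by (cases p) (auto simp: chang_def)
  moreover have "y \<ge> 0 \<longleftrightarrow> (\<exists>k. y = int k)" "y \<le> 0 \<longleftrightarrow> (\<exists>k. y = - int k)" for y :: int
    by (auto simp: zero_le_imp_eq_int nonneg_int_cases) (metis minus_minus neg_0_le_iff_le nonneg_int_cases)
  ultimately show ?thesis by (auto simp: prod_eq_iff set_eq_iff)
qed

lemma chang_cases:
  assumes "p \<in> carrier chang"
  obtains k where "p = (0, int k)" | k where "p = (1, - int k)"
  using assms by (auto simp: carrier_chang)

lemma rl_algebra_chang: "rl_algebra chang"
  by unfold_locales (auto simp: chang_def max_def min_def)

text \<open>The infinitesimal (0, 1) goes to a n, so (0, k) goes to k (a n) and (1, -k) to its
  negation. Once n exceeds the indices involved, no sum is truncated and the rules for multiples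
  compute every implication.\<close>

lemma approx_hom_chang:
  assumes D: "\<And>n. wajsberg_algebra (D n)" and a: "\<And>n. a n \<in> carrier (D n)" "\<And>n. a n \<noteq> \<zero>\<^bsub>D n\<^esub>"
    "\<And>n. wajsberg_algebra.nm (D n) n (a n) \<preceq>\<^bsub>D n\<^esub> wajsberg_algebra.neg (D n) (a n)"
  shows "approx_hom (\<lambda>n p. if fst p = 0 then wajsberg_algebra.nm (D n) (nat (snd p)) (a n)
      else wajsberg_algebra.neg (D n) (wajsberg_algebra.nm (D n) (nat (- snd p)) (a n))) chang D"
    (is "approx_hom ?h chang D")
proof (rule approx_hom_impI)
  show "rl_algebra chang" by (rule rl_algebra_chang)
  fix x y assume x: "x \<in> carrier chang" and y: "y \<in> carrier chang"
  show "x \<otimes>\<^bsub>chang\<^esub> y = ((x \<leadsto>\<^bsub>chang\<^esub> (y \<leadsto>\<^bsub>chang\<^esub> \<zero>\<^bsub>chang\<^esub>)) \<leadsto>\<^bsub>chang\<^esub> \<zero>\<^bsub>chang\<^esub>)"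
    "x \<curlyvee>\<^bsub>chang\<^esub> y = ((x \<leadsto>\<^bsub>chang\<^esub> y) \<leadsto>\<^bsub>chang\<^esub> y)"
    "x \<curlywedge>\<^bsub>chang\<^esub> y = x \<otimes>\<^bsub>chang\<^esub> (x \<leadsto>\<^bsub>chang\<^esub> y)"
    by (cases rule: chang_cases[OF x]; cases rule: chang_cases[OF y];
        simp add: max_def min_def zero_prod_def)+
  show "\<forall>\<^sub>F n in sequentially. ?h n (x \<leadsto>\<^bsub>chang\<^esub> y) = (?h n x \<leadsto>\<^bsub>D n\<^esub> ?h n y)"
  proof -
    let ?s = "nat \<bar>snd x\<bar> + nat \<bar>snd y\<bar>"
    have "?h n (x \<leadsto>\<^bsub>chang\<^esub> y) = (?h n x \<leadsto>\<^bsub>D n\<^esub> ?h n y)" if n: "n \<ge> ?s" for n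
    proof -
      interpret D: wajsberg_algebra "D n" by (rule D)
      note an = a(1)[of n] a(3)[of n]
      have nm: "D.nm k (a n) \<in> carrier (D n)" for k using an by simp
      show ?thesis
      proof (cases rule: chang_cases[OF x]; cases rule: chang_cases[OF y])
        fix k l assume kl: "x = (0, int k)" "y = (0, int l)"
        show ?thesis
        proof (cases "k \<le> l")
          case True
          then have "D.nm k (a n) \<leadsto>\<^bsub>D n\<^esub> D.nm l (a n) = \<one>\<^bsub>D n\<^esub>"
            using an by (simp add: D.imp_eq_one D.nm_mono)
          then show ?thesis
            using kl True by (simp add: min_def)
        next
          case False
          then show ?thesis
            using kl an n D.nm_plus_neg[of "a n" n l k] D.plus_comm[of "D.nm l (a n)" "D.neg (D.nm k (a n))"]
            by (simp add: D.imp_eq_plus min_def nat_diff_distrib')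
        qed
      next
        fix k l assume kl: "x = (0, int k)" "y = (1, - int l)"
        then have "D.nm k (a n) \<leadsto>\<^bsub>D n\<^esub> D.neg (D.nm l (a n)) = \<one>\<^bsub>D n\<^esub>"
          using an n by (simp add: D.imp_eq_one D.nm_le_neg)
        then show ?thesis
          using kl by (simp add: min_def)
      next
        fix k l assume kl: "x = (1, - int k)" "y = (0, int l)"
        have "nat (int k + int l) = k + l" by simp
        then show ?thesis
          using kl an D.nm_add[of "a n" k l] by (simp add: D.imp_eq_plus min_def)
      next
        fix k l assume kl: "x = (1, - int k)" "y = (1, - int l)"
        show ?thesis
        proof (cases "l \<le> k")
          case True
          then have "D.nm l (a n) \<leadsto>\<^bsub>D n\<^esub> D.nm k (a n) = \<one>\<^bsub>D n\<^esub>"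
            using an by (simp add: D.imp_eq_one D.nm_mono)
          then show ?thesis
            using kl True an by (simp add: D.contrapos min_def)
        next
          case False
          then show ?thesis
            using kl an n D.nm_plus_neg[of "a n" n k l]
            by (simp add: D.imp_eq_plus min_def nat_diff_distrib')
        qed
      qed
    qed
    then show ?thesis by (rule eventually_sequentiallyI)
  qed
  assume neq: "x \<noteq> y"
  show "\<forall>\<^sub>F n in sequentially. ?h n x \<noteq> ?h n y"
  proof -
    let ?s = "nat \<bar>snd x\<bar> + nat \<bar>snd y\<bar>"
    have "?h n x \<noteq> ?h n y" if n: "n \<ge> ?s" for n
    proof -
      interpret D: wajsberg_algebra "D n" by (rule D)
      note an = a(1)[of n] a(2)[of n] a(3)[of n]
      have ne: "D.nm k (a n) \<noteq> D.nm l (a n)" if "k \<noteq> l" "k \<le> n" "l \<le> n" for k l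
        using D.nm_inj[of "a n" n k l] D.nm_inj[of "a n" n l k] an that by (cases "k < l") auto
      show ?thesis
        by (cases rule: chang_cases[OF x]; cases rule: chang_cases[OF y])
          (use neq n an ne D.nm_neq_neg[of "a n" n] in \<open>auto simp: D.neg_inject dest: sym\<close>)
    qed
    then show ?thesis by (rule eventually_sequentiallyI)
  qed
next
  fix x assume x: "x \<in> carrier chang"
  have "?h n x \<in> carrier (D n)" for n
  proof -
    interpret D: wajsberg_algebra "D n" by (rule D)
    show ?thesis using a(1) by simp
  qed
  then show "\<forall>\<^sub>F n in sequentially. ?h n x \<in> carrier (D n)" by simp
next
  have "?h n \<zero>\<^bsub>chang\<^esub> = \<zero>\<^bsub>D n\<^esub>" for n
  proof -
    interpret D: wajsberg_algebra "D n" by (rule D)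
    show ?thesis by simp
  qed
  then show "\<forall>\<^sub>F n in sequentially. ?h n \<zero>\<^bsub>chang\<^esub> = \<zero>\<^bsub>D n\<^esub>" by simp
qed (use D in \<open>auto simp: max_def min_def\<close>)

lemma K_chang_simps [simp]:
  "carrier (K_alg chang) = carrier chang \<times> carrier chang"
  "(a, b) \<otimes>\<^bsub>K_alg chang\<^esub> (c, d) = (a \<otimes>\<^bsub>chang\<^esub> c, (a \<leadsto>\<^bsub>chang\<^esub> d) \<curlywedge>\<^bsub>chang\<^esub> (c \<leadsto>\<^bsub>chang\<^esub> b))"
  "(a, b) \<curlyvee>\<^bsub>K_alg chang\<^esub> (c, d) = (max a c, min b d)"
  "(a, b) \<curlywedge>\<^bsub>K_alg chang\<^esub> (c, d) = (min a c, max b d)"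
  "((a, b) \<leadsto>\<^bsub>K_alg chang\<^esub> (c, d)) = ((a \<leadsto>\<^bsub>chang\<^esub> c) \<curlywedge>\<^bsub>chang\<^esub> (d \<leadsto>\<^bsub>chang\<^esub> b), a \<otimes>\<^bsub>chang\<^esub> d)"
  "\<one>\<^bsub>K_alg chang\<^esub> = ((1, 0), (1, 0))" "\<zero>\<^bsub>K_alg chang\<^esub> = ((0, 0), (1, 0))"
  by (simp_all add: K_alg_def)

lemma K0_set_chang:
  "K0_set chang = {((0, int k), (1, - int l)) |k l. l \<le> k} \<union> {((1, - int k), (0, int l)) |k l. k \<le> l}
    \<union> {((1, - int k), (1, - int l)) |k l. True}"
  by (auto simp: K0_set_def carrier_chang min_def split: if_splits)

lemma subuniverse_K0_chang: "subuniverse (K0_set chang) (K_alg chang)"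
proof -
  interpret rl_algebra "K_alg chang"
    using rl_algebra_K_alg rl_algebra_chang by blast
  have K0: "z \<in> K0_set chang \<longleftrightarrow> z \<in> carrier (K_alg chang) \<and> (1, 0) - fst z \<le> snd z" for z
    by (cases z) (auto simp: K0_set_def carrier_chang min_def split: if_splits)
  show ?thesis
  proof (rule subuniverseI)
    show "K0_set chang \<subseteq> carrier (K_alg chang)"
      by (auto simp: K0_set_def)
    have sub: "x \<in> K0_set chang \<Longrightarrow> x \<in> carrier (K_alg chang)" for x
      by (auto simp: K0_set_def)
    fix x y assume xy: "x \<in> K0_set chang" "y \<in> K0_set chang"
    note c = sub[OF xy(1)] sub[OF xy(2)]
    have "(1, 0) - fst (x \<otimes>\<^bsub>K_alg chang\<^esub> y) \<le> snd (x \<otimes>\<^bsub>K_alg chang\<^esub> y)"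
      using xy unfolding K0_set_chang by (elim UnE) (auto simp: max_def min_def zero_prod_def split: if_splits)
    then show "x \<otimes>\<^bsub>K_alg chang\<^esub> y \<in> K0_set chang"
      using mult_in[OF c] by (simp add: K0)
    have "(1, 0) - fst (x \<curlyvee>\<^bsub>K_alg chang\<^esub> y) \<le> snd (x \<curlyvee>\<^bsub>K_alg chang\<^esub> y)"
      using xy unfolding K0_set_chang by (elim UnE) (auto simp: max_def min_def zero_prod_def split: if_splits)
    then show "x \<curlyvee>\<^bsub>K_alg chang\<^esub> y \<in> K0_set chang"
      using join_in[OF c] by (simp add: K0)
    have "(1, 0) - fst (x \<curlywedge>\<^bsub>K_alg chang\<^esub> y) \<le> snd (x \<curlywedge>\<^bsub>K_alg chang\<^esub> y)"
      using xy unfolding K0_set_chang by (elim UnE) (auto simp: max_def min_def zero_prod_def split: if_splits)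
    then show "x \<curlywedge>\<^bsub>K_alg chang\<^esub> y \<in> K0_set chang"
      using meet_in[OF c] by (simp add: K0)
    have "(1, 0) - fst ((x \<leadsto>\<^bsub>K_alg chang\<^esub> y)) \<le> snd ((x \<leadsto>\<^bsub>K_alg chang\<^esub> y))"
      using xy unfolding K0_set_chang by (elim UnE) (auto simp: max_def min_def zero_prod_def split: if_splits)
    then show "(x \<leadsto>\<^bsub>K_alg chang\<^esub> y) \<in> K0_set chang"
      using imp_in[OF c] by (simp add: K0)
  next
    show "\<one>\<^bsub>K_alg chang\<^esub> \<in> K0_set chang"
      by (auto simp: K0_set_chang)
    show "\<zero>\<^bsub>K_alg chang\<^esub> \<in> K0_set chang"
      by (auto simp: K0_set_chang)
  qed
qed

text \<open>A pair is below the unit exactly when its second component is the top, and all such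
  pairs satisfy u \<oplus> v = 1.\<close>

lemma admissible_K0_chang: "admissible (K0_set chang) (K_alg chang)"
proof -
  have "{x \<in> K0_set chang. x \<preceq>\<^bsub>K_alg chang\<^esub> \<one>\<^bsub>K_alg chang\<^esub>}
      = {x \<in> carrier (K_alg chang). x \<preceq>\<^bsub>K_alg chang\<^esub> \<one>\<^bsub>K_alg chang\<^esub>}"
  proof -
    have le: "z \<preceq>\<^bsub>K_alg chang\<^esub> \<one>\<^bsub>K_alg chang\<^esub> \<longleftrightarrow> snd z = (1, 0)" if "z \<in> carrier (K_alg chang)" for z
    proof -
      obtain u v where z: "z = (u, v)" by (cases z)
      then have "u \<le> (1, 0)" "v \<le> (1, 0)"
        using that by (auto simp: chang_def K_alg_def)
      then show ?thesis
        unfolding z by (auto simp: below_def min_def max_def)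
    qed
    show ?thesis
      using le by (auto simp: K0_set_def)
  qed
  then show ?thesis
    using subuniverse_K0_chang by (simp add: admissible_def neg_cone_def below_def)
qed

text \<open>S is pinned down from both sides: the upper bound lets it be mapped into every B, the
  lower bound makes it reflect the equations of \<open>chang\<close>.\<close>

lemma K0_alg_chang:
  obtains S where "K0_alg chang = (K_alg chang)\<lparr>carrier := S\<rparr>" "S \<subseteq> K0_set chang"
    "carrier chang \<times> {(1, 0)} \<subseteq> S" "rl_algebra ((K_alg chang)\<lparr>carrier := S\<rparr>)"
proof
  let ?S = "\<Inter>{B. admissible B (K_alg chang)}"
  show "K0_alg chang = (K_alg chang)\<lparr>carrier := ?S\<rparr>"
    by (simp add: K0_alg_def)
  show "?S \<subseteq> K0_set chang" using admissible_K0_chang by blast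
  show "carrier chang \<times> {(1, 0)} \<subseteq> ?S"
  proof clarsimp
    fix i j B assume *: "(i, j) \<in> carrier chang" and "admissible B (K_alg chang)"
    then have "carrier (neg_cone ((K_alg chang)\<lparr>carrier := B\<rparr>)) = carrier (neg_cone (K_alg chang))"
      by (simp add: admissible_def)
    moreover have "((i, j), (1, 0)) \<in> carrier (neg_cone (K_alg chang))"
      using * by (auto simp: neg_cone_def below_def carrier_chang min_def)
    ultimately show "((i, j), (1, 0)) \<in> B"
      by (auto simp: neg_cone_def)
  qed
  have alg: "rl_algebra ((K_alg chang)\<lparr>carrier := B\<rparr>)" if "admissible B (K_alg chang)" for B
    using that by (simp add: admissible_def subuniverse_def)
  show "rl_algebra ((K_alg chang)\<lparr>carrier := ?S\<rparr>)"
    by (rule rl_algebra.intro)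
      (use rl_algebra.mult_in[OF alg] rl_algebra.join_in[OF alg] rl_algebra.meet_in[OF alg]
         rl_algebra.imp_in[OF alg] rl_algebra.one_in[OF alg] rl_algebra.zero_in[OF alg] in auto)
qed

text \<open>D and B may vary with n. The case analysis uses one chain with ever smaller elements,
  the limit argument for \<open>K0p\<close> uses longer and longer finite chains.\<close>

lemma satisfies_K0_chang:
  assumes D: "\<And>n. wajsberg_algebra (D n)" and a: "\<And>n. a n \<in> carrier (D n)" "\<And>n. a n \<noteq> \<zero>\<^bsub>D n\<^esub>"
    "\<And>n. wajsberg_algebra.nm (D n) n (a n) \<preceq>\<^bsub>D n\<^esub> wajsberg_algebra.neg (D n) (a n)"
    and B: "\<And>n. subuniverse (B n) (K_alg (D n))" "\<And>n. carrier (D n) \<times> {\<one>\<^bsub>D n\<^esub>} \<subseteq> B n"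
    and E: "\<And>n. satisfies ((K_alg (D n))\<lparr>carrier := B n\<rparr>) E"
  shows "satisfies (K0_alg chang) E"
proof -
  obtain S where S: "K0_alg chang = (K_alg chang)\<lparr>carrier := S\<rparr>" "S \<subseteq> K0_set chang"
    "rl_algebra ((K_alg chang)\<lparr>carrier := S\<rparr>)"
    by (rule K0_alg_chang)
  show ?thesis
    unfolding S(1)
    by (rule satisfies_K0[OF rl_algebra_chang approx_hom_chang[OF D a] D B S(2,3) E])
qed

section \<open>Equational descriptions\<close>

text \<open>Relativisation to the negative cone: elements below 1 are those of the form x
  \<curlywedge> 1, so equations for the cone become equations for the whole algebra.\<close>

primrec cone :: "rl_term \<Rightarrow> rl_term" where
  "cone (Var n) = Meet (Var n) One"
| "cone (Join s t) = Join (cone s) (cone t)"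
| "cone (Meet s t) = Meet (cone s) (cone t)"
| "cone (Mult s t) = Mult (cone s) (cone t)"
| "cone (Imp s t) = Meet (Imp (cone s) (cone t)) One"
| "cone Zero = Zero"
| "cone One = One"

lemma eval_cone: "eval A e (cone t) = eval (neg_cone A) (\<lambda>n. e n \<curlywedge>\<^bsub>A\<^esub> \<one>\<^bsub>A\<^esub>) t"
  by (induction t) (simp_all add: neg_cone_def)

lemma eval_carrier [simp]: "eval (A\<lparr>carrier := B\<rparr>) e t = eval A e t"
  by (induction t) simp_all

text \<open>Meeting with the unit (1, 1) replaces the second component by 1, and the pairs (a, 1)
  compute like a in D.\<close>

lemma eval_cone_K_alg:
  assumes D: "rl_algebra D" and e: "range e \<subseteq> carrier D \<times> carrier D"
    and top: "\<And>x. x \<in> carrier D \<Longrightarrow> x \<curlywedge>\<^bsub>D\<^esub> \<one>\<^bsub>D\<^esub> = x \<and> x \<curlyvee>\<^bsub>D\<^esub> \<one>\<^bsub>D\<^esub> = \<one>\<^bsub>D\<^esub> \<and> (x \<leadsto>\<^bsub>D\<^esub> \<one>\<^bsub>D\<^esub>) = \<one>\<^bsub>D\<^esub>"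
  shows "eval (K_alg D) e (cone t) = (eval D (\<lambda>n. fst (e n)) t, \<one>\<^bsub>D\<^esub>)"
proof -
  interpret rl_algebra D by fact
  have "range (\<lambda>n. fst (e n)) \<subseteq> carrier D" using e by auto
  note ev = eval_closed[OF D this]
  show ?thesis
  proof (induction t)
    case (Var n)
    have "e n \<in> carrier D \<times> carrier D" using e by auto
    then show ?case using top by (cases "e n") (simp add: K_alg_def)
  qed (use top ev in \<open>auto simp: K_alg_def mult_in imp_in one_in\<close>)
qed

definition val :: "'a \<Rightarrow> 'a \<Rightarrow> 'a \<Rightarrow> nat \<Rightarrow> 'a" where
  "val x y z n = (if n = 0 then x else if n = 1 then y else z)"

lemma val_simps [simp]: "val x y z 0 = x" "val x y z (Suc 0) = y" "val x y z 2 = z"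
  by (simp_all add: val_def)

lemma satisfiesD:
  "\<lbrakk>satisfies A E; (s, t) \<in> E; x \<in> carrier A; y \<in> carrier A; z \<in> carrier A\<rbrakk>
    \<Longrightarrow> eval A (val x y z) s = eval A (val x y z) t"
proof -
  assume *: "satisfies A E" "(s, t) \<in> E" and "x \<in> carrier A" "y \<in> carrier A" "z \<in> carrier A"
  then have "range (val x y z) \<subseteq> carrier A" by (auto simp: val_def)
  with * show ?thesis unfolding satisfies_def by blast
qed

abbreviation (input) Til :: "rl_term \<Rightarrow> rl_term" where "Til t \<equiv> Imp t One"

text \<open>Residuation in equational form: x \<preceq> y \<leadsto> xy and (y \<leadsto> z)y
  \<preceq> z are unit and counit of the adjunction, and the last two equations make multiplication
  and y \<leadsto> _ monotone.\<close>

definition crl_eqs :: "(rl_term \<times> rl_term) set" where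
  "crl_eqs = (let x = Var 0; y = Var 1; z = Var 2 in {
     (Mult (Mult x y) z, Mult x (Mult y z)), (Mult x y, Mult y x), (Mult One x, x),
     (Join x y, Join y x), (Meet x y, Meet y x),
     (Join (Join x y) z, Join x (Join y z)), (Meet (Meet x y) z, Meet x (Meet y z)),
     (Join x (Meet x y), x), (Meet x (Join x y), x),
     (Meet x (Imp y (Mult x y)), x), (Meet (Mult (Imp y z) y) z, Mult (Imp y z) y),
     (Mult (Join x y) z, Join (Mult x z) (Mult y z)),
     (Imp x (Meet y z), Meet (Imp x y) (Imp x z))})"

text \<open>In each distributive law y and z are interchangeable, so placing 1 at the outer and at
  one inner position covers all three cases.\<close>

definition K_eqs :: "(rl_term \<times> rl_term) set" where
  "K_eqs = (let x = Var 0; y = Var 1; z = Var 2 in {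
     (Meet Zero x, Zero), (Til (Til x), x),
     (Meet One (Join y z), Join (Meet One y) (Meet One z)),
     (Meet x (Join One z), Join (Meet x One) (Meet x z)),
     (Join One (Meet y z), Meet (Join One y) (Join One z)),
     (Join x (Meet One z), Meet (Join x One) (Join x z)),
     (Meet (Mult x y) One, Mult (Meet x One) (Meet y One)),
     (Meet (Imp (Meet x One) y) (Imp (Meet (Til y) One) (Til x)), Imp x y)})"

definition wajsberg_eqs :: "(rl_term \<times> rl_term) set" where
  "wajsberg_eqs = (let x = Var 0; y = Var 1 in {
     (Mult x (Imp x y), Mult y (Imp y x)), (Imp (Imp x y) y, Imp (Imp y x) x)})"

definition boolean_eqs :: "(rl_term \<times> rl_term) set" where
  "boolean_eqs = (let x = Var 0; y = Var 1; z = Var 2 in {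
     (Mult x y, Meet x y), (Meet x (Join y z), Join (Meet x y) (Meet x z)),
     (Meet x (Imp x Zero), Zero), (Join x (Imp x Zero), One)})"

lemma comm_residuated_lattice_of_eqs:
  assumes A: "rl_algebra A" and E: "satisfies A crl_eqs"
  shows "comm_residuated_lattice A"
proof -
  interpret rl_algebra A by fact
  note E = satisfiesD[OF E, unfolded crl_eqs_def Let_def]
  interpret comm_monoid A
  proof (rule comm_monoidI)
    fix x y z assume c: "x \<in> carrier A" "y \<in> carrier A" "z \<in> carrier A"
    show "x \<otimes>\<^bsub>A\<^esub> y \<otimes>\<^bsub>A\<^esub> z = x \<otimes>\<^bsub>A\<^esub> (y \<otimes>\<^bsub>A\<^esub> z)"
      using E[of "Mult (Mult (Var 0) (Var 1)) (Var 2)" _ x y z] c by simp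
  next
    fix x y assume c: "x \<in> carrier A" "y \<in> carrier A"
    show "x \<otimes>\<^bsub>A\<^esub> y = y \<otimes>\<^bsub>A\<^esub> x" "\<one>\<^bsub>A\<^esub> \<otimes>\<^bsub>A\<^esub> x = x"
      using E[of "Mult (Var 0) (Var 1)" _ x y y] E[of "Mult One (Var 0)" _ x y y] c by simp_all
  qed (use mult_in one_in in auto)
  have le_mult_imp: "x \<curlywedge>\<^bsub>A\<^esub> (y \<leadsto>\<^bsub>A\<^esub> x \<otimes>\<^bsub>A\<^esub> y) = x" "(y \<leadsto>\<^bsub>A\<^esub> z) \<otimes>\<^bsub>A\<^esub> y \<curlywedge>\<^bsub>A\<^esub> z = (y \<leadsto>\<^bsub>A\<^esub> z) \<otimes>\<^bsub>A\<^esub> y"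
    "(x \<curlyvee>\<^bsub>A\<^esub> y) \<otimes>\<^bsub>A\<^esub> z = (x \<otimes>\<^bsub>A\<^esub> z) \<curlyvee>\<^bsub>A\<^esub> (y \<otimes>\<^bsub>A\<^esub> z)"
    "(x \<leadsto>\<^bsub>A\<^esub> (y \<curlywedge>\<^bsub>A\<^esub> z)) = (x \<leadsto>\<^bsub>A\<^esub> y) \<curlywedge>\<^bsub>A\<^esub> (x \<leadsto>\<^bsub>A\<^esub> z)"
    if "x \<in> carrier A" "y \<in> carrier A" "z \<in> carrier A" for x y z
    using E[of "Meet (Var 0) (Imp (Var 1) (Mult (Var 0) (Var 1)))" _ x y z]
      E[of "Meet (Mult (Imp (Var 1) (Var 2)) (Var 1)) (Var 2)" _ x y z]
      E[of "Mult (Join (Var 0) (Var 1)) (Var 2)" _ x y z]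
      E[of "Imp (Var 0) (Meet (Var 1) (Var 2))" _ x y z] that by simp_all
  have lat: "x \<curlyvee>\<^bsub>A\<^esub> y = y \<curlyvee>\<^bsub>A\<^esub> x" "x \<curlywedge>\<^bsub>A\<^esub> y = y \<curlywedge>\<^bsub>A\<^esub> x" "(x \<curlyvee>\<^bsub>A\<^esub> y) \<curlyvee>\<^bsub>A\<^esub> z = x \<curlyvee>\<^bsub>A\<^esub> (y \<curlyvee>\<^bsub>A\<^esub> z)"
    "(x \<curlywedge>\<^bsub>A\<^esub> y) \<curlywedge>\<^bsub>A\<^esub> z = x \<curlywedge>\<^bsub>A\<^esub> (y \<curlywedge>\<^bsub>A\<^esub> z)" "x \<curlyvee>\<^bsub>A\<^esub> (x \<curlywedge>\<^bsub>A\<^esub> y) = x" "x \<curlywedge>\<^bsub>A\<^esub> (x \<curlyvee>\<^bsub>A\<^esub> y) = x"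
    if "x \<in> carrier A" "y \<in> carrier A" "z \<in> carrier A" for x y z
    using E[of "Join (Var 0) (Var 1)" _ x y z] E[of "Meet (Var 0) (Var 1)" _ x y z]
      E[of "Join (Join (Var 0) (Var 1)) (Var 2)" _ x y z] E[of "Meet (Meet (Var 0) (Var 1)) (Var 2)" _ x y z]
      E[of "Join (Var 0) (Meet (Var 0) (Var 1))" _ x y z] E[of "Meet (Var 0) (Join (Var 0) (Var 1))" _ x y z]
      that by simp_all
  have trans: "x \<preceq>\<^bsub>A\<^esub> z" if "x \<preceq>\<^bsub>A\<^esub> y" "y \<preceq>\<^bsub>A\<^esub> z" "x \<in> carrier A" "y \<in> carrier A" "z \<in> carrier A" for x y z
    using lat(4)[of x y z] that by (simp add: below_def)
  have le_join: "x \<preceq>\<^bsub>A\<^esub> y \<longleftrightarrow> x \<curlyvee>\<^bsub>A\<^esub> y = y" if "x \<in> carrier A" "y \<in> carrier A" for x y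
    using that lat(1)[of x y] lat(2)[of x y] lat(5)[of y x] lat(6)[of x y] by (auto simp: below_def)
  show ?thesis
  proof
    fix x y z assume c: "x \<in> carrier A" "y \<in> carrier A" "z \<in> carrier A"
    show "x \<otimes>\<^bsub>A\<^esub> y \<preceq>\<^bsub>A\<^esub> z \<longleftrightarrow> x \<preceq>\<^bsub>A\<^esub> (y \<leadsto>\<^bsub>A\<^esub> z)"
    proof
      assume "x \<otimes>\<^bsub>A\<^esub> y \<preceq>\<^bsub>A\<^esub> z"
      then have "(y \<leadsto>\<^bsub>A\<^esub> x \<otimes>\<^bsub>A\<^esub> y) \<preceq>\<^bsub>A\<^esub> (y \<leadsto>\<^bsub>A\<^esub> z)"
        using le_mult_imp(4)[of y "x \<otimes>\<^bsub>A\<^esub> y" z] c by (simp add: below_def mult_in)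
      then show "x \<preceq>\<^bsub>A\<^esub> (y \<leadsto>\<^bsub>A\<^esub> z)"
        using trans[of x "y \<leadsto>\<^bsub>A\<^esub> x \<otimes>\<^bsub>A\<^esub> y"] le_mult_imp(1)[of x y y] c
        by (simp add: below_def mult_in imp_in)
    next
      assume "x \<preceq>\<^bsub>A\<^esub> (y \<leadsto>\<^bsub>A\<^esub> z)"
      then have "x \<otimes>\<^bsub>A\<^esub> y \<preceq>\<^bsub>A\<^esub> (y \<leadsto>\<^bsub>A\<^esub> z) \<otimes>\<^bsub>A\<^esub> y"
        using le_mult_imp(3)[of x "y \<leadsto>\<^bsub>A\<^esub> z" y] c by (simp add: le_join mult_in imp_in)
      then show "x \<otimes>\<^bsub>A\<^esub> y \<preceq>\<^bsub>A\<^esub> z"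
        using trans[of "x \<otimes>\<^bsub>A\<^esub> y" "(y \<leadsto>\<^bsub>A\<^esub> z) \<otimes>\<^bsub>A\<^esub> y" z] le_mult_imp(2)[of y y z] c
        by (simp add: below_def mult_in imp_in)
    qed
  qed (use lat in auto)
qed

lemma bounded_K_lattice_of_eqs:
  assumes A: "rl_algebra A" and E: "satisfies A (crl_eqs \<union> K_eqs)"
  shows "bounded_K_lattice A"
proof -
  have "satisfies A crl_eqs" and KE: "satisfies A K_eqs"
    using E by (auto simp: satisfies_def)
  interpret comm_residuated_lattice A
    by (rule comm_residuated_lattice_of_eqs) fact+
  note E = satisfiesD[OF KE, unfolded K_eqs_def Let_def]
  have m1: "\<one>\<^bsub>A\<^esub> \<curlywedge>\<^bsub>A\<^esub> (y \<curlyvee>\<^bsub>A\<^esub> z) = (\<one>\<^bsub>A\<^esub> \<curlywedge>\<^bsub>A\<^esub> y) \<curlyvee>\<^bsub>A\<^esub> (\<one>\<^bsub>A\<^esub> \<curlywedge>\<^bsub>A\<^esub> z)"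
    "y \<curlywedge>\<^bsub>A\<^esub> (\<one>\<^bsub>A\<^esub> \<curlyvee>\<^bsub>A\<^esub> z) = (y \<curlywedge>\<^bsub>A\<^esub> \<one>\<^bsub>A\<^esub>) \<curlyvee>\<^bsub>A\<^esub> (y \<curlywedge>\<^bsub>A\<^esub> z)"
    "\<one>\<^bsub>A\<^esub> \<curlyvee>\<^bsub>A\<^esub> (y \<curlywedge>\<^bsub>A\<^esub> z) = (\<one>\<^bsub>A\<^esub> \<curlyvee>\<^bsub>A\<^esub> y) \<curlywedge>\<^bsub>A\<^esub> (\<one>\<^bsub>A\<^esub> \<curlyvee>\<^bsub>A\<^esub> z)"
    "y \<curlyvee>\<^bsub>A\<^esub> (\<one>\<^bsub>A\<^esub> \<curlywedge>\<^bsub>A\<^esub> z) = (y \<curlyvee>\<^bsub>A\<^esub> \<one>\<^bsub>A\<^esub>) \<curlywedge>\<^bsub>A\<^esub> (y \<curlyvee>\<^bsub>A\<^esub> z)"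
    if "y \<in> carrier A" "z \<in> carrier A" for y z
    using E[of "Meet One (Join (Var 1) (Var 2))" _ y y z] E[of "Meet (Var 0) (Join One (Var 2))" _ y y z]
      E[of "Join One (Meet (Var 1) (Var 2))" _ y y z] E[of "Join (Var 0) (Meet One (Var 2))" _ y y z]
      that by simp_all
  show ?thesis
  proof
    fix x y assume c: "x \<in> carrier A" "y \<in> carrier A"
    show "\<zero>\<^bsub>A\<^esub> \<preceq>\<^bsub>A\<^esub> x" "\<sim>\<^bsub>A\<^esub> (\<sim>\<^bsub>A\<^esub> x) = x"
      "(x \<otimes>\<^bsub>A\<^esub> y) \<curlywedge>\<^bsub>A\<^esub> \<one>\<^bsub>A\<^esub> = (x \<curlywedge>\<^bsub>A\<^esub> \<one>\<^bsub>A\<^esub>) \<otimes>\<^bsub>A\<^esub> (y \<curlywedge>\<^bsub>A\<^esub> \<one>\<^bsub>A\<^esub>)"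
      "((x \<curlywedge>\<^bsub>A\<^esub> \<one>\<^bsub>A\<^esub>) \<leadsto>\<^bsub>A\<^esub> y) \<curlywedge>\<^bsub>A\<^esub> ((\<sim>\<^bsub>A\<^esub> y \<curlywedge>\<^bsub>A\<^esub> \<one>\<^bsub>A\<^esub>) \<leadsto>\<^bsub>A\<^esub> \<sim>\<^bsub>A\<^esub> x) = (x \<leadsto>\<^bsub>A\<^esub> y)"
      using c E[of "Meet Zero (Var 0)" _ x y y] E[of "Til (Til (Var 0))" _ x y y]
        E[of "Meet (Mult (Var 0) (Var 1)) One" _ x y y]
        E[of "Meet (Imp (Meet (Var 0) One) (Var 1)) (Imp (Meet (Til (Var 1)) One) (Til (Var 0)))" _ x y y]
      by (simp_all add: below_def tilde_def)
  next
    fix x y z assume c: "x \<in> carrier A" "y \<in> carrier A" "z \<in> carrier A" "\<one>\<^bsub>A\<^esub> \<in> {x, y, z}"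
    then show "x \<curlywedge>\<^bsub>A\<^esub> (y \<curlyvee>\<^bsub>A\<^esub> z) = (x \<curlywedge>\<^bsub>A\<^esub> y) \<curlyvee>\<^bsub>A\<^esub> (x \<curlywedge>\<^bsub>A\<^esub> z)"
      using m1(1)[of y z] m1(2)[of x z] m1(2)[of x y] join_commute[of y \<open>\<one>\<^bsub>A\<^esub>\<close>]
        join_commute[of "x \<curlywedge>\<^bsub>A\<^esub> y" "x \<curlywedge>\<^bsub>A\<^esub> \<one>\<^bsub>A\<^esub>"] by auto
    from c show "x \<curlyvee>\<^bsub>A\<^esub> (y \<curlywedge>\<^bsub>A\<^esub> z) = (x \<curlyvee>\<^bsub>A\<^esub> y) \<curlywedge>\<^bsub>A\<^esub> (x \<curlyvee>\<^bsub>A\<^esub> z)"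
      using m1(3)[of y z] m1(4)[of x z] m1(4)[of x y] meet_commute[of y \<open>\<one>\<^bsub>A\<^esub>\<close>]
        meet_commute[of "x \<curlyvee>\<^bsub>A\<^esub> y" "x \<curlyvee>\<^bsub>A\<^esub> \<one>\<^bsub>A\<^esub>"] by auto
  qed
qed

lemma (in bounded_K_lattice) neg_cone_bounded: "bounded_comm_residuated_lattice (neg_cone A)"
proof -
  have [simp]: "x \<preceq>\<^bsub>neg_cone A\<^esub> y \<longleftrightarrow> x \<preceq> y" for x y
    by (simp add: below_def neg_cone_def)
  have [simp]: "carrier (neg_cone A) = {a \<in> carrier A. a \<preceq> \<one>}" "x \<otimes>\<^bsub>neg_cone A\<^esub> y = x \<otimes> y"
    "x \<curlyvee>\<^bsub>neg_cone A\<^esub> y = x \<curlyvee> y" "x \<curlywedge>\<^bsub>neg_cone A\<^esub> y = x \<curlywedge> y"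
    "(x \<leadsto>\<^bsub>neg_cone A\<^esub> y) = (x \<leadsto> y) \<curlywedge> \<one>" "\<one>\<^bsub>neg_cone A\<^esub> = \<one>" "\<zero>\<^bsub>neg_cone A\<^esub> = \<zero>" for x y
    by (simp_all add: neg_cone_def)
  have mult1: "x \<otimes> y \<preceq> \<one>" if "x \<preceq> \<one>" "y \<preceq> \<one>" "x \<in> carrier A" "y \<in> carrier A" for x y
    using mult_mono[OF that(1,2)] that by simp
  have meet1: "x \<curlywedge> y \<preceq> \<one>" if "x \<preceq> \<one>" "x \<in> carrier A" "y \<in> carrier A" for x y
    using le_trans[OF meet_le1[of x y] that(1)] that by simp
  interpret C: comm_monoid "neg_cone A"
    by (rule comm_monoidI) (auto simp: mult1 m_ac)
  show ?thesis
    by unfold_locales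
      (auto simp: mult1 meet1 join_le_iff zero_least join_assoc meet_assoc join_absorb meet_absorb
        le_meet_iff mult1 simp flip: residuation intro: join_commute meet_commute)
qed

lemma (in bounded_K_lattice) satisfies_neg_cone:
  assumes E: "satisfies A {(cone s, cone t) |s t. (s, t) \<in> E}"
  shows "satisfies (neg_cone A) E"
  unfolding satisfies_def
proof safe
  fix s t and e :: "nat \<Rightarrow> _" assume st: "(s, t) \<in> E" and e: "range e \<subseteq> carrier (neg_cone A)"
  have "e n \<curlywedge> \<one> = e n" for n
    using e by (auto simp: neg_cone_def below_def)
  then have *: "eval A e (cone u) = eval (neg_cone A) e u" for u
    by (simp add: eval_cone)
  have "range e \<subseteq> carrier A" using e by (auto simp: neg_cone_def)
  then have "eval A e (cone s) = eval A e (cone t)"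
    using E st unfolding satisfies_def by blast
  then show "eval (neg_cone A) e s = eval (neg_cone A) e t" by (simp add: *)
qed

lemma wajsberg_of_eqs:
  assumes A: "bounded_comm_residuated_lattice A" and E: "satisfies A wajsberg_eqs"
  shows "wajsberg_algebra A"
proof -
  interpret bounded_comm_residuated_lattice A by fact
  note E = satisfiesD[OF E, unfolded wajsberg_eqs_def Let_def]
  show ?thesis
  proof
    fix x y assume c: "x \<in> carrier A" "y \<in> carrier A"
    show "x \<otimes>\<^bsub>A\<^esub> (x \<leadsto>\<^bsub>A\<^esub> y) = y \<otimes>\<^bsub>A\<^esub> (y \<leadsto>\<^bsub>A\<^esub> x)"
      "((x \<leadsto>\<^bsub>A\<^esub> y) \<leadsto>\<^bsub>A\<^esub> y) = ((y \<leadsto>\<^bsub>A\<^esub> x) \<leadsto>\<^bsub>A\<^esub> x)"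
      using E[of "Mult (Var 0) (Imp (Var 0) (Var 1))" _ x y y]
        E[of "Imp (Imp (Var 0) (Var 1)) (Var 1)" _ x y y] c by simp_all
  qed
qed

lemma boolean_of_eqs:
  assumes A: "bounded_comm_residuated_lattice A" and E: "satisfies A boolean_eqs"
  shows "boolean_rl A"
proof -
  interpret bounded_comm_residuated_lattice A by fact
  note E = satisfiesD[OF E, unfolded boolean_eqs_def Let_def]
  show ?thesis
  proof
    fix x y z assume c: "x \<in> carrier A" "y \<in> carrier A" "z \<in> carrier A"
    show "x \<curlywedge>\<^bsub>A\<^esub> (y \<curlyvee>\<^bsub>A\<^esub> z) = (x \<curlywedge>\<^bsub>A\<^esub> y) \<curlyvee>\<^bsub>A\<^esub> (x \<curlywedge>\<^bsub>A\<^esub> z)"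
      using E[of "Meet (Var 0) (Join (Var 1) (Var 2))" _ x y z] c by simp
  next
    fix x y assume c: "x \<in> carrier A" "y \<in> carrier A"
    show "x \<otimes>\<^bsub>A\<^esub> y = x \<curlywedge>\<^bsub>A\<^esub> y"
      using E[of "Mult (Var 0) (Var 1)" _ x y y] c by simp
  next
    fix x assume c: "x \<in> carrier A"
    show "x \<curlywedge>\<^bsub>A\<^esub> (x \<leadsto>\<^bsub>A\<^esub> \<zero>\<^bsub>A\<^esub>) = \<zero>\<^bsub>A\<^esub>" "x \<curlyvee>\<^bsub>A\<^esub> (x \<leadsto>\<^bsub>A\<^esub> \<zero>\<^bsub>A\<^esub>) = \<one>\<^bsub>A\<^esub>"
      using E[of "Meet (Var 0) (Imp (Var 0) Zero)" _ x x x]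
        E[of "Join (Var 0) (Imp (Var 0) Zero)" _ x x x] c by simp_all
  qed
qed

section \<open>Boolean algebras are Wajsberg algebras\<close>

context boolean_rl
begin

lemma imp_join: assumes "x \<in> carrier A" "y \<in> carrier A" shows "x \<leadsto> y = (x \<leadsto> \<zero>) \<curlyvee> y"
proof (rule le_antisym)
  have "(x \<leadsto> y) \<curlywedge> x \<preceq> y"
    using imp_mp[of x y] assms by (simp add: mult_eq_meet meet_commute)
  have "x \<leadsto> y = (x \<leadsto> y) \<curlywedge> ((x \<leadsto> \<zero>) \<curlyvee> x)"
    using assms join_compl[of x] join_commute[of x "x \<leadsto> \<zero>"] by simp
  also have "\<dots> = ((x \<leadsto> y) \<curlywedge> (x \<leadsto> \<zero>)) \<curlyvee> ((x \<leadsto> y) \<curlywedge> x)"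
    using assms by (simp add: distrib)
  also have "\<dots> \<preceq> (x \<leadsto> \<zero>) \<curlyvee> y"
    using assms le_trans[OF meet_le2[of "x \<leadsto> y" "x \<leadsto> \<zero>"] join_ge1[of "x \<leadsto> \<zero>" y]]
      le_trans[OF \<open>(x \<leadsto> y) \<curlywedge> x \<preceq> y\<close> join_ge2[of "x \<leadsto> \<zero>" y]]
    by (simp add: join_le_iff)
  finally show "x \<leadsto> y \<preceq> (x \<leadsto> \<zero>) \<curlyvee> y" .
qed (use assms in \<open>auto simp: join_le_iff le_imp intro!: imp_mono zero_least\<close>)

lemma imp_imp_join:
  assumes "x \<in> carrier A" "y \<in> carrier A" shows "(x \<leadsto> y) \<leadsto> y = x \<curlyvee> y"
proof (rule le_antisym)
  have "((x \<leadsto> y) \<leadsto> y) \<curlywedge> (x \<leadsto> y) \<preceq> x \<curlyvee> y"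
    using assms imp_mp[of "x \<leadsto> y" y] le_trans[OF _ join_ge2[of x y]]
    by (simp add: mult_eq_meet meet_commute)
  \<comment> \<open>The complement of x lies below x \<leadsto> y, so these two join to 1 and
    distributivity splits the left side along them.\<close>
  moreover have "x \<curlyvee> (x \<leadsto> y) = \<one>"
    using assms imp_join[of x y] join_compl[of x] by (simp flip: join_assoc)
  then have "((x \<leadsto> y) \<leadsto> y) = (((x \<leadsto> y) \<leadsto> y) \<curlywedge> x) \<curlyvee> (((x \<leadsto> y) \<leadsto> y) \<curlywedge> (x \<leadsto> y))"
    using assms distrib[of "(x \<leadsto> y) \<leadsto> y" x "x \<leadsto> y"] by simp
  moreover have "((x \<leadsto> y) \<leadsto> y) \<curlywedge> x \<preceq> x \<curlyvee> y"
    using assms le_trans[OF meet_le2 join_ge1] by simp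
  ultimately show "(x \<leadsto> y) \<leadsto> y \<preceq> x \<curlyvee> y"
    using assms join_least by (metis imp_in join_in meet_in)
next
  have "x \<preceq> (x \<leadsto> y) \<leadsto> y" using assms by (simp add: imp_mp flip: residuation)
  then show "x \<curlyvee> y \<preceq> (x \<leadsto> y) \<leadsto> y" using assms by (simp add: join_le_iff le_imp)
qed (use assms in auto)

text \<open>Makes the representation over chains available for K(BA).\<close>

lemma wajsberg: "wajsberg_algebra A"
proof
  fix x y assume c: "x \<in> carrier A" "y \<in> carrier A"
  have "u \<otimes> (u \<leadsto> v) = u \<curlywedge> v" if "u \<in> carrier A" "v \<in> carrier A" for u v
  proof (rule le_antisym)
    show "u \<curlywedge> v \<preceq> u \<otimes> (u \<leadsto> v)"
      using that le_trans[OF meet_le2[of u v] le_imp[of u v]] by (simp add: mult_eq_meet le_meet_iff)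
  qed (use that in \<open>auto simp: le_meet_iff mult_le1 imp_mp\<close>)
  then show "x \<otimes> (x \<leadsto> y) = y \<otimes> (y \<leadsto> x)"
    using c meet_commute by simp
  show "((x \<leadsto> y) \<leadsto> y) = ((y \<leadsto> x) \<leadsto> x)"
    using c by (simp add: imp_imp_join join_commute)
qed

end

text \<open>Only these algebras are verified by real arithmetic: \<open>K0p n\<close> is a
  subalgebra, and \<open>K0_alg chang\<close> inherits equations as a limit of the
  \<open>K0p n\<close>.\<close>

lemma K_luk_crl_eqs:
  assumes "n \<ge> 1" shows "satisfies (K_alg (luk n)) (crl_eqs \<union> K_eqs)"
  unfolding satisfies_def
proof safe
  fix s t and e :: "nat \<Rightarrow> _" assume st: "(s, t) \<in> crl_eqs" and e: "range e \<subseteq> carrier (K_alg (luk n))"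
  have "e k \<in> carrier (luk n) \<times> carrier (luk n)" for k using e by auto
  then obtain a b c d f g where v: "e 0 = (a, b)" "e 1 = (c, d)" "e 2 = (f, g)"
    and vb: "0 \<le> a" "a \<le> 1" "0 \<le> b" "b \<le> 1" "0 \<le> c" "c \<le> 1" "0 \<le> d" "d \<le> 1" "0 \<le> f" "f \<le> 1" "0 \<le> g" "g \<le> 1"
    by (metis SigmaE luk_bounds)
  from st show "eval (K_alg (luk n)) e s = eval (K_alg (luk n)) e t"
    unfolding crl_eqs_def Let_def
    by (elim insertE emptyE) (simp only: eval.simps v K_luk_simps prod.inject, intro conjI; use vb in smt)+
next
  fix s t and e :: "nat \<Rightarrow> _" assume st: "(s, t) \<in> K_eqs" and e: "range e \<subseteq> carrier (K_alg (luk n))"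
  have "e k \<in> carrier (luk n) \<times> carrier (luk n)" for k using e by auto
  then obtain a b c d f g where v: "e 0 = (a, b)" "e 1 = (c, d)" "e 2 = (f, g)"
    and vb: "0 \<le> a" "a \<le> 1" "0 \<le> b" "b \<le> 1" "0 \<le> c" "c \<le> 1" "0 \<le> d" "d \<le> 1" "0 \<le> f" "f \<le> 1" "0 \<le> g" "g \<le> 1"
    by (metis SigmaE luk_bounds)
  \<comment> \<open>In K the operation \<sim> swaps components. Rewriting this first keeps the
    decomposition axiom, the eighth equation, within reach of arithmetic.\<close>
  have tm: "((a, b) \<leadsto>\<^bsub>K_alg (luk n)\<^esub> (1, 1)) = (b, a)" "((c, d) \<leadsto>\<^bsub>K_alg (luk n)\<^esub> (1, 1)) = (d, c)"
    "(a, b) \<curlywedge>\<^bsub>K_alg (luk n)\<^esub> (1, 1) = (a, 1)" "(d, c) \<curlywedge>\<^bsub>K_alg (luk n)\<^esub> (1, 1) = (d, 1)"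
    using vb by simp_all
  from st show "eval (K_alg (luk n)) e s = eval (K_alg (luk n)) e t"
    unfolding K_eqs_def Let_def
    apply (elim insertE emptyE)
           prefer 8
    subgoal by (simp only: prod.inject eval.simps v K_luk_simps(6) tm)
        (simp only: K_luk_simps prod.inject, intro conjI; use vb in smt)
    by (simp only: eval.simps v K_luk_simps prod.inject, intro conjI; use vb in linarith)+
qed

section \<open>Varieties above the atom\<close>

instance rl_term :: countable
  by countable_datatype

section \<open>Equational theories and generated varieties\<close>

lemma satisfies_iff: "satisfies A E \<longleftrightarrow> (\<forall>s t. (s, t) \<in> E \<longrightarrow> satisfies A {(s, t)})"
  by (auto simp: satisfies_def)

lemma satisfies_Un: "satisfies A (E \<union> F) \<longleftrightarrow> satisfies A E \<and> satisfies A F"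
  unfolding satisfies_def by (rule ball_Un)

lemma satisfies_cones:
  "(\<And>s t. (s, t) \<in> E \<Longrightarrow> satisfies A {(cone s, cone t)}) \<Longrightarrow>
    satisfies A {(cone s, cone t) |s t. (s, t) \<in> E}"
  by (subst satisfies_iff) auto

lemma satisfies_singleton:
  "satisfies A {(s, t)} \<longleftrightarrow> (\<forall>e. range e \<subseteq> carrier A \<longrightarrow> eval A e s = eval A e t)"
  by (simp add: satisfies_def)

lemma satisfies_Th:
  assumes "\<And>s t. satisfies X {(s, t)} \<Longrightarrow> satisfies A {(s, t)}" "satisfies X E"
  shows "satisfies A E"
  using assms(1) iffD1[OF satisfies_iff assms(2)] by (subst satisfies_iff) simp

lemma in_variety_of:
  "A \<in> variety_of X \<longleftrightarrow> rl_algebra A \<and> (\<forall>s t. satisfies X {(s, t)} \<longrightarrow> satisfies A {(s, t)})"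
proof
  assume A: "A \<in> variety_of X"
  have "satisfies X {}" by (simp add: satisfies_def)
  with A have "A \<in> models E" if "satisfies X E" for E
    using that unfolding variety_of_def by blast
  then have "rl_algebra A \<and> satisfies A E" if "satisfies X E" for E
    using that by (simp add: models_def)
  then show "rl_algebra A \<and> (\<forall>s t. satisfies X {(s, t)} \<longrightarrow> satisfies A {(s, t)})"
    using \<open>satisfies X {}\<close> by simp
qed (auto simp: variety_of_def models_def intro: satisfies_Th)

lemma in_variety_of_E: "satisfies A E" if "A \<in> variety_of X" "satisfies X E"
  using that satisfies_Th[of X A E] by (simp add: in_variety_of)

lemma variety_variety_of: "variety (variety_of X :: 'u rl set)"
proof -
  have "satisfies A {(s, t). satisfies X {(s, t)}} \<longleftrightarrow> (\<forall>s t. satisfies X {(s, t)} \<longrightarrow> satisfies A {(s, t)})"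
    for A :: "'u rl"
    by (subst satisfies_iff) simp
  then have "variety_of X = (models {(s, t). satisfies X {(s, t)}} :: 'u rl set)"
    by (simp add: set_eq_iff in_variety_of models_def)
  then show ?thesis unfolding variety_def by (rule exI)
qed

lemma variety_of_subset: "satisfies X E \<Longrightarrow> variety_of X \<subseteq> models E"
  by (auto simp: variety_of_def)

text \<open>The values of all terms under one valuation form a countable subalgebra.\<close>

lemma countable_refutation:
  assumes inf: "infinite (UNIV :: 'u set)" and X: "rl_algebra X" and neq: "\<not> satisfies X {(s, t)}"
  obtains A :: "'u rl" where "A \<in> variety_of X" "\<not> satisfies A {(s, t)}"
proof -
  obtain e where e: "range e \<subseteq> carrier X" "eval X e s \<noteq> eval X e t"
    using neq by (auto simp: satisfies_def)
  let ?S = "range (eval X e)"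
  have sub: "subuniverse ?S X"
  proof (rule subuniverseI)
    show "?S \<subseteq> carrier X" using eval_closed[OF X e(1)] by auto
    show "\<one>\<^bsub>X\<^esub> \<in> ?S" "\<zero>\<^bsub>X\<^esub> \<in> ?S"
      using eval.simps(6,7)[of X e] by (metis rangeI)+
    fix x y assume "x \<in> ?S" "y \<in> ?S"
    then obtain u v where "x = eval X e u" "y = eval X e v" by blast
    then show "x \<otimes>\<^bsub>X\<^esub> y \<in> ?S" "x \<curlyvee>\<^bsub>X\<^esub> y \<in> ?S" "x \<curlywedge>\<^bsub>X\<^esub> y \<in> ?S" "(x \<leadsto>\<^bsub>X\<^esub> y) \<in> ?S"
      using eval.simps(2-5)[of X e u v] by (metis rangeI)+
  qed
  \<comment> \<open>An infinite \<open>'u\<close> has room for a copy of the countable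
    subalgebra.\<close>
  obtain g :: "nat \<Rightarrow> 'u" where "inj g"
    using infinite_countable_subset[OF inf] by blast
  define i where "i = g \<circ> to_nat_on ?S"
  have i: "inj_on i ?S"
    unfolding i_def using \<open>inj g\<close> by (intro comp_inj_on inj_on_to_nat_on) (auto intro: inj_on_subset)
  define j where "j = the_inv_into ?S i"
  have ji [simp]: "j (i x) = x" if "x \<in> ?S" for x
    using the_inv_into_f_f[OF i that] by (simp add: j_def)
  define A :: "'u rl" where "A = \<lparr>carrier = i ` ?S, monoid.mult = (\<lambda>x y. i (j x \<otimes>\<^bsub>X\<^esub> j y)), one = i \<one>\<^bsub>X\<^esub>,
     join = (\<lambda>x y. i (j x \<curlyvee>\<^bsub>X\<^esub> j y)), meet = (\<lambda>x y. i (j x \<curlywedge>\<^bsub>X\<^esub> j y)),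
     imp = (\<lambda>x y. i (j x \<leadsto>\<^bsub>X\<^esub> j y)), zero = i \<zero>\<^bsub>X\<^esub>\<rparr>"
  let ?X = "X\<lparr>carrier := ?S\<rparr>"
  have alg: "rl_algebra ?X" using sub by (simp add: subuniverse_def)
  have hom: "rl_hom i ?X A"
    unfolding rl_hom_def by (auto simp: A_def)
  have "subuniverse (i ` carrier ?X) A"
    by (rule subuniverse_image[OF alg hom])
  then have algA: "rl_algebra A" by (simp add: subuniverse_def A_def)
  have "satisfies A {(u, v)}" if "satisfies X {(u, v)}" for u v
    using satisfies_image[OF alg hom] satisfies_subuniverse[OF X sub that] by (simp add: A_def)
  then have "A \<in> variety_of X" using algA by (simp add: in_variety_of)
  moreover have "\<not> satisfies A {(s, t)}"
  proof
    assume sat: "satisfies A {(s, t)}"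
    have e': "range e \<subseteq> carrier ?X"
    proof -
      have "e n \<in> ?S" for n
        using rangeI[of "eval X e" "Var n"] by simp
      then show ?thesis by auto
    qed
    then have "range (\<lambda>n. i (e n)) \<subseteq> carrier A" by (auto simp: A_def)
    then have "eval A (\<lambda>n. i (e n)) s = eval A (\<lambda>n. i (e n)) t"
      using sat by (simp add: satisfies_singleton)
    then have "i (eval X e s) = i (eval X e t)"
      by (simp add: eval_hom[OF alg hom e'])
    then show False using i e by (simp add: inj_on_eq_iff)
  qed
  ultimately show thesis using that by blast
qed

text \<open>The failing equation fails in a member of the generated variety that fits on
  \<open>'u\<close>, so one equation separates two generators living on arbitrary types.\<close>

lemma variety_of_not_subset:
  assumes "infinite (UNIV :: 'u set)" "rl_algebra X" "\<not> satisfies X {(s, t)}" "satisfies Y {(s, t)}"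
  shows "\<not> (variety_of X :: 'u rl set) \<subseteq> variety_of Y"
proof
  assume sub: "(variety_of X :: 'u rl set) \<subseteq> variety_of Y"
  obtain A :: "'u rl" where "A \<in> variety_of X" "\<not> satisfies A {(s, t)}"
    by (rule countable_refutation[OF assms(1-3)])
  then show False
    using subsetD[OF sub] assms(4) by (simp add: in_variety_of)
qed

section \<open>Equations of the generators\<close>

definition KW_eqs :: "(rl_term \<times> rl_term) set" where
  "KW_eqs = crl_eqs \<union> K_eqs \<union> {(cone s, cone t) |s t. (s, t) \<in> wajsberg_eqs}"

lemma KW_eqs_sound:
  assumes "rl_algebra A" "satisfies A KW_eqs" shows "A \<in> K_class WA"
proof -
  have E: "satisfies A (crl_eqs \<union> K_eqs)" "satisfies A {(cone s, cone t) |s t. (s, t) \<in> wajsberg_eqs}"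
    using assms(2) by (simp_all add: KW_eqs_def satisfies_Un)
  interpret bounded_K_lattice A
    by (rule bounded_K_lattice_of_eqs) fact+
  show ?thesis
    using wajsberg_of_eqs[OF neg_cone_bounded satisfies_neg_cone[OF E(2)]] bounded_K_lattice_axioms
    by (simp add: K_class_def WA_def)
qed

text \<open>First components of elements of B range over all of D, and relativised terms see nothing
  else. This reduces most separations to the chains.\<close>

lemma satisfies_cone_K_alg:
  assumes D: "rl_algebra D" and B: "carrier D \<times> {\<one>\<^bsub>D\<^esub>} \<subseteq> B" "B \<subseteq> carrier D \<times> carrier D"
    and top: "\<And>x. x \<in> carrier D \<Longrightarrow> x \<curlywedge>\<^bsub>D\<^esub> \<one>\<^bsub>D\<^esub> = x \<and> x \<curlyvee>\<^bsub>D\<^esub> \<one>\<^bsub>D\<^esub> = \<one>\<^bsub>D\<^esub> \<and> (x \<leadsto>\<^bsub>D\<^esub> \<one>\<^bsub>D\<^esub>) = \<one>\<^bsub>D\<^esub>"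
  shows "satisfies ((K_alg D)\<lparr>carrier := B\<rparr>) {(cone s, cone t)} \<longleftrightarrow> satisfies D {(s, t)}"
proof -
  have ev: "eval (K_alg D) e (cone u) = (eval D (\<lambda>k. fst (e k)) u, \<one>\<^bsub>D\<^esub>)"
    if "range e \<subseteq> B" for e u
    by (rule eval_cone_K_alg[OF D subset_trans[OF that B(2)] top])
  show ?thesis
  proof
    assume sat: "satisfies ((K_alg D)\<lparr>carrier := B\<rparr>) {(cone s, cone t)}"
    show "satisfies D {(s, t)}"
      unfolding satisfies_singleton
    proof (intro allI impI)
      fix e :: "nat \<Rightarrow> 'a" assume e: "range e \<subseteq> carrier D"
      then have r: "range (\<lambda>k. (e k, \<one>\<^bsub>D\<^esub>)) \<subseteq> B" using B(1) by auto
      then have "eval (K_alg D) (\<lambda>k. (e k, \<one>\<^bsub>D\<^esub>)) (cone s) = eval (K_alg D) (\<lambda>k. (e k, \<one>\<^bsub>D\<^esub>)) (cone t)"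
        using sat unfolding satisfies_singleton eval_carrier by simp
      then show "eval D e s = eval D e t" by (simp add: ev[OF r])
    qed
  next
    assume sat: "satisfies D {(s, t)}"
    show "satisfies ((K_alg D)\<lparr>carrier := B\<rparr>) {(cone s, cone t)}"
      unfolding satisfies_singleton eval_carrier
    proof (intro allI impI)
      fix e :: "nat \<Rightarrow> 'a \<times> 'a" assume "range e \<subseteq> carrier ((K_alg D)\<lparr>carrier := B\<rparr>)"
      then have r: "range e \<subseteq> B" by simp
      then have "range (\<lambda>k. fst (e k)) \<subseteq> carrier D" using B(2) by fastforce
      then show "eval (K_alg D) e (cone s) = eval (K_alg D) e (cone t)"
        using sat unfolding satisfies_singleton by (simp add: ev[OF r])
    qed
  qed
qed

lemma luk_top:
  "x \<in> carrier (luk n) \<Longrightarrow> x \<curlywedge>\<^bsub>luk n\<^esub> \<one>\<^bsub>luk n\<^esub> = x \<and> x \<curlyvee>\<^bsub>luk n\<^esub> \<one>\<^bsub>luk n\<^esub> = \<one>\<^bsub>luk n\<^esub> \<and>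
    (x \<leadsto>\<^bsub>luk n\<^esub> \<one>\<^bsub>luk n\<^esub>) = \<one>\<^bsub>luk n\<^esub>"
  using luk_bounds[of x n] by simp

lemma one_in_luk: "n \<ge> 1 \<Longrightarrow> 1 \<in> carrier (luk n)"
  using luk_in[of n n] by simp

lemma satisfies_cone_K_luk:
  assumes "n \<ge> 1"
  shows "satisfies (K_alg (luk n)) {(cone s, cone t)} \<longleftrightarrow> satisfies (luk n) {(s, t)}"
proof -
  have "(K_alg (luk n))\<lparr>carrier := carrier (luk n) \<times> carrier (luk n)\<rparr> = K_alg (luk n)"
    by (simp add: K_alg_def)
  moreover have "satisfies ((K_alg (luk n))\<lparr>carrier := carrier (luk n) \<times> carrier (luk n)\<rparr>) {(cone s, cone t)}
      \<longleftrightarrow> satisfies (luk n) {(s, t)}"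
    by (rule satisfies_cone_K_alg[OF rl_algebra_luk[OF assms] _ _ luk_top])
      (use one_in_luk[OF assms] in auto)
  ultimately show ?thesis by (simp only:)
qed

lemma satisfies_cone_K0p:
  assumes "n \<ge> 1"
  shows "satisfies (K0p n) {(cone s, cone t)} \<longleftrightarrow> satisfies (luk n) {(s, t)}"
  unfolding K0p_eq
  by (rule satisfies_cone_K_alg[OF rl_algebra_luk[OF assms] _ _ luk_top])
    (use one_in_luk[OF assms] in \<open>auto simp: K0_set_def dest: luk_bounds\<close>)

lemma satisfies_cone_K0_chang:
  "satisfies (K0_alg chang) {(cone s, cone t)} \<longleftrightarrow> satisfies chang {(s, t)}"
proof -
  obtain S where S: "K0_alg chang = (K_alg chang)\<lparr>carrier := S\<rparr>" "S \<subseteq> K0_set chang"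
    "carrier chang \<times> {(1, 0)} \<subseteq> S"
    by (rule K0_alg_chang)
  have top: "x \<curlywedge>\<^bsub>chang\<^esub> \<one>\<^bsub>chang\<^esub> = x \<and> x \<curlyvee>\<^bsub>chang\<^esub> \<one>\<^bsub>chang\<^esub> = \<one>\<^bsub>chang\<^esub> \<and> (x \<leadsto>\<^bsub>chang\<^esub> \<one>\<^bsub>chang\<^esub>) = \<one>\<^bsub>chang\<^esub>"
    if "x \<in> carrier chang" for x
    using that by (cases rule: chang_cases) (auto simp: min_def max_def zero_prod_def)
  show ?thesis
    unfolding S(1)
    by (rule satisfies_cone_K_alg[OF rl_algebra_chang _ _ top]) (use S in \<open>auto simp: K0_set_def\<close>)
qed

lemma rl_algebra_K0_chang: "rl_algebra (K0_alg chang)"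
  by (rule K0_alg_chang) simp

lemma K_luk_KW_eqs:
  assumes "n \<ge> 1" shows "satisfies (K_alg (luk n)) KW_eqs"
proof -
  interpret wajsberg_algebra "luk n" using assms by (rule wajsberg_luk)
  have "satisfies (luk n) {(s, t)}" if "(s, t) \<in> wajsberg_eqs" for s t
    unfolding satisfies_singleton
  proof (intro allI impI)
    fix e :: "nat \<Rightarrow> real" assume "range e \<subseteq> carrier (luk n)"
    then have "e 0 \<in> carrier (luk n)" "e (Suc 0) \<in> carrier (luk n)" by auto
    with divisible[OF this] wajsberg[OF this] that show "eval (luk n) e s = eval (luk n) e t"
      by (auto simp: wajsberg_eqs_def Let_def simp del: luk_simps)
  qed
  then have "satisfies (K_alg (luk n)) {(cone s, cone t) |s t. (s, t) \<in> wajsberg_eqs}"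
    by (intro satisfies_cones) (simp add: satisfies_cone_K_luk[OF assms])
  then show ?thesis
    using K_luk_crl_eqs[OF assms] by (simp add: KW_eqs_def satisfies_Un)
qed

lemma satisfies_K0p: "n \<ge> 1 \<Longrightarrow> satisfies (K_alg (luk n)) E \<Longrightarrow> satisfies (K0p n) E"
  unfolding K0p_eq
  by (rule satisfies_subuniverse[OF rl_algebra_K_alg[OF rl_algebra_luk] subuniverse_K0_luk])

text \<open>In \<open>luk (Suc n)\<close> the element a = 1/(n+1) satisfies na = \<not>a, so these
  chains contain the small elements that \<open>satisfies_K0_chang\<close> asks for.\<close>

lemma satisfies_K0_chang_limit:
  assumes "\<And>n. n \<ge> 1 \<Longrightarrow> satisfies (K0p n) E"
  shows "satisfies (K0_alg chang) E"
proof (rule satisfies_K0_chang)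
  fix n
  show D: "wajsberg_algebra (luk (Suc n))" by (rule wajsberg_luk) simp
  interpret D: wajsberg_algebra "luk (Suc n)" by (rule D)
  show a: "1 / real (Suc n) \<in> carrier (luk (Suc n))"
    using luk_in[of 1 "Suc n"] by simp
  show "1 / real (Suc n) \<noteq> \<zero>\<^bsub>luk (Suc n)\<^esub>" by simp
  have "D.nm k (1 / real (Suc n)) = real k / real (Suc n)" if "k \<le> n" for k
    using that
    by (induction k) (auto simp: D.plus_def D.neg_def divide_simps min_def)
  then show "D.nm n (1 / real (Suc n)) \<preceq>\<^bsub>luk (Suc n)\<^esub> D.neg (1 / real (Suc n))"
    by (simp add: D.neg_def divide_simps)
  show "subuniverse (K0_set (luk (Suc n))) (K_alg (luk (Suc n)))"
    by (rule subuniverse_K0_luk) simp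
  show "carrier (luk (Suc n)) \<times> {\<one>\<^bsub>luk (Suc n)\<^esub>} \<subseteq> K0_set (luk (Suc n))"
    using D.one_in by (auto simp: K0_set_def dest: luk_bounds)
  show "satisfies ((K_alg (luk (Suc n)))\<lparr>carrier := K0_set (luk (Suc n))\<rparr>) E"
    using assms[of "Suc n"] by (simp add: K0p_eq)
qed

lemma K0p_KW_eqs: "n \<ge> 1 \<Longrightarrow> satisfies (K0p n) KW_eqs"
  by (simp add: satisfies_K0p K_luk_KW_eqs)

lemma K0_chang_KW_eqs: "satisfies (K0_alg chang) KW_eqs"
  by (rule satisfies_K0_chang_limit) (rule K0p_KW_eqs)

lemma variety_of_subset_K_class: "satisfies X KW_eqs \<Longrightarrow> variety_of X \<subseteq> K_class WA"
  using KW_eqs_sound in_variety_of in_variety_of_E by blast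

lemma rl_hom_in: "rl_hom f A C \<Longrightarrow> x \<in> carrier A \<Longrightarrow> f x \<in> carrier C"
  by (simp add: rl_hom_def)

lemma rl_hom_restrict:
  "rl_hom f A C \<Longrightarrow> S \<subseteq> carrier A \<Longrightarrow> f ` S \<subseteq> T \<Longrightarrow> rl_hom f (A\<lparr>carrier := S\<rparr>) (C\<lparr>carrier := T\<rparr>)"
  by (simp add: rl_hom_def subset_iff image_subset_iff)

section \<open>The two-element chain and the trivial case\<close>

context wajsberg_algebra
begin

lemma zero_neq_one:
  assumes B: "subuniverse B (K_alg A)" and neq: "\<not> satisfies ((K_alg A)\<lparr>carrier := B\<rparr>) {(s, t)}"
  shows "\<zero> \<noteq> \<one>"
proof
  assume "\<zero> = \<one>"
  then have "x = \<one>" if "x \<in> carrier A" for x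
    using zero_mult(1)[OF that] l_one[OF that] by simp
  then have *: "x = (\<one>, \<one>)" if "x \<in> B" for x
    using that B by (cases x) (auto simp: subuniverse_def K_alg_def)
  have alg: "rl_algebra ((K_alg A)\<lparr>carrier := B\<rparr>)" using B by (simp add: subuniverse_def)
  have "satisfies ((K_alg A)\<lparr>carrier := B\<rparr>) {(s, t)}"
    unfolding satisfies_singleton
  proof (intro allI impI)
    fix e :: "nat \<Rightarrow> 'a \<times> 'a" assume "range e \<subseteq> carrier ((K_alg A)\<lparr>carrier := B\<rparr>)"
    from eval_closed[OF alg this, of s] eval_closed[OF alg this, of t]
    show "eval ((K_alg A)\<lparr>carrier := B\<rparr>) e s = eval ((K_alg A)\<lparr>carrier := B\<rparr>) e t"
      using *[of "eval (K_alg A) e s"] *[of "eval (K_alg A) e t"] by simp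
  qed
  then show False using neq by blast
qed

text \<open>The cyclic case with a = 1 and N = 0, since 0 = \<not>1.\<close>

lemma satisfies_K0p_1:
  assumes "\<zero> \<noteq> \<one>" "subuniverse B (K_alg A)" "carrier A \<times> {\<one>} \<subseteq> B"
    "satisfies ((K_alg A)\<lparr>carrier := B\<rparr>) E"
  shows "satisfies (K0p 1) E"
  using satisfies_K0p_cyclic[of \<one> 0 B E] assms by simp

lemma satisfies_K_luk_1:
  assumes "\<zero> \<noteq> \<one>" "satisfies (K_alg A) E"
  shows "satisfies (K_alg (luk 1)) E"
proof -
  have "approx_hom (\<lambda>_ x. nm (nat \<lfloor>x * real (Suc 0)\<rfloor>) \<one>) (luk (Suc 0)) (\<lambda>_. A)"
    by (rule approx_hom_luk) (use assms in auto)
  from satisfies_approx[OF approx_hom_K_alg[OF rl_algebra_luk this]] show ?thesis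
    using assms rl_algebra_axioms by (simp add: rl_algebra_K_alg rl_algebra_luk)
qed

lemma rl_hom_two:
  assumes two: "carrier A = {\<zero>, \<one>}" "\<zero> \<noteq> \<one>"
  defines "f \<equiv> \<lambda>x. if x = \<one> then 1 else (0 :: real)"
  shows "rl_hom f A (luk 1)" "inj_on f (carrier A)"
proof -
  have "0 \<in> carrier (luk 1)" "1 \<in> carrier (luk 1)"
    using luk_in[of 0 1] luk_in[of 1 1] by simp_all
  moreover have "\<zero> \<curlywedge> \<one> = \<zero>" "\<one> \<curlywedge> \<zero> = \<zero>" "\<zero> \<curlyvee> \<one> = \<one>" "\<one> \<curlyvee> \<zero> = \<one>" "\<zero> \<curlyvee> \<zero> = \<zero>"
    by (simp_all add: join_eq)
  ultimately show "rl_hom f A (luk 1)"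
    using two(2) by (auto simp: rl_hom_def f_def two(1))
  show "inj_on f (carrier A)"
    using two by (auto simp: inj_on_def f_def)
qed

text \<open>Of the four pairs only (0, 0) violates u \<oplus> v = 1, so a B without it lies in the
  three-element algebra.\<close>

lemma satisfies_two:
  assumes two: "carrier A = {\<zero>, \<one>}" "\<zero> \<noteq> \<one>" and B: "subuniverse B (K_alg A)"
  shows "satisfies (K_alg (luk 1)) E \<Longrightarrow> satisfies ((K_alg A)\<lparr>carrier := B\<rparr>) E"
    and "(\<zero>, \<zero>) \<notin> B \<Longrightarrow> satisfies (K0p 1) E \<Longrightarrow> satisfies ((K_alg A)\<lparr>carrier := B\<rparr>) E"
proof -
  let ?f = "\<lambda>x. if x = \<one> then 1 else (0 :: real)"
  let ?g = "map_prod ?f ?f"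
  have BA: "B \<subseteq> {\<zero>, \<one>} \<times> {\<zero>, \<one>}" using B two by (auto simp: subuniverse_def K_alg_def)
  have hom: "rl_hom ?g (K_alg A) (K_alg (luk 1))"
    by (rule rl_hom_K_alg[OF rl_algebra_axioms rl_hom_two(1)[OF two]])
  have inj: "inj_on ?g (carrier ((K_alg A)\<lparr>carrier := B\<rparr>))"
    by (rule inj_on_subset[OF map_prod_inj_on[OF rl_hom_two(2)[OF two] rl_hom_two(2)[OF two]]])
      (use BA two in auto)
  have alg: "rl_algebra ((K_alg A)\<lparr>carrier := B\<rparr>)" "rl_algebra (K_alg (luk 1))" "rl_algebra (K0p 1)"
    using B rl_algebra_K_alg[OF rl_algebra_luk] rl_algebra_K0p by (auto simp: subuniverse_def)
  have sub: "B \<subseteq> carrier (K_alg A)" using B by (simp add: subuniverse_def)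
  have "rl_hom ?g ((K_alg A)\<lparr>carrier := B\<rparr>) ((K_alg (luk 1))\<lparr>carrier := carrier (K_alg (luk 1))\<rparr>)"
    by (intro rl_hom_restrict[OF hom sub] image_subsetI rl_hom_in[OF hom] subsetD[OF sub])
  then have "rl_hom ?g ((K_alg A)\<lparr>carrier := B\<rparr>) (K_alg (luk 1))"
    by (simp del: K_luk_simps(1))
  then show "satisfies (K_alg (luk 1)) E \<Longrightarrow> satisfies ((K_alg A)\<lparr>carrier := B\<rparr>) E"
    using satisfies_embedding[OF _ inj alg(1,2)] by blast
  assume "(\<zero>, \<zero>) \<notin> B"
  have "?g x \<in> K0_set (luk 1)" if "x \<in> B" for x
  proof -
    have "x \<in> {(\<zero>, \<one>), (\<one>, \<zero>), (\<one>, \<one>)}"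
      using subsetD[OF BA that] that \<open>(\<zero>, \<zero>) \<notin> B\<close> by auto
    then show ?thesis
      using two(2) luk_in[of 0 1] luk_in[of 1 1] by (auto simp: K0_set_def)
  qed
  then have "rl_hom ?g ((K_alg A)\<lparr>carrier := B\<rparr>) (K0p 1)"
    unfolding K0p_eq by (intro rl_hom_restrict[OF hom sub]) (simp add: image_subset_iff)
  then show "satisfies (K0p 1) E \<Longrightarrow> satisfies ((K_alg A)\<lparr>carrier := B\<rparr>) E"
    using satisfies_embedding[OF _ inj alg(1,3)] by blast
qed

end

text \<open>The equation x = y fails exactly in nontrivial algebras, so this puts
  \<open>K0p 1\<close> below every nontrivial subvariety.\<close>

lemma nontrivial_K0p_1:
  assumes A: "A \<in> K_class WA" and nt: "\<not> satisfies A {(Var 0, Var 1)}" and E: "satisfies A E"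
  shows "satisfies (K0p 1) E"
proof -
  have KA: "bounded_K_lattice A" "wajsberg_algebra (neg_cone A)"
    using A by (simp_all add: K_class_def WA_def)
  obtain e where e: "range e \<subseteq> carrier A" "eval A e (Var 0) \<noteq> eval A e (Var 1)"
    using nt unfolding satisfies_singleton by blast
  obtain D :: "'a rl" and B where D: "wajsberg_algebra D" and B: "subuniverse B (K_alg D)" "carrier D \<times> {\<one>\<^bsub>D\<^esub>} \<subseteq> B"
    and sat: "\<And>E. satisfies A E \<Longrightarrow> satisfies ((K_alg D)\<lparr>carrier := B\<rparr>) E"
    and neq: "\<not> satisfies ((K_alg D)\<lparr>carrier := B\<rparr>) {(Var 0, Var 1)}"
    using representation[OF KA e] by metis
  interpret D: wajsberg_algebra D by fact
  have "\<zero>\<^bsub>D\<^esub> \<noteq> \<one>\<^bsub>D\<^esub>" by (rule D.zero_neq_one[OF B(1) neq])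
  then show ?thesis using D.satisfies_K0p_1 B sat[OF E] by blast
qed

text \<open>The equation s = t witnesses that A lies outside the atom; it is what excludes the
  three-element B.\<close>

lemma K_class_WA_cases:
  assumes A: "A \<in> K_class WA" and K3: "satisfies (K0p 1) {(s, t)}" and nst: "\<not> satisfies A {(s, t)}"
    and E: "satisfies A E"
  shows "satisfies (K_alg (luk 1)) E \<or> (\<exists>p. prime p \<and> satisfies (K0p p) E) \<or> satisfies (K0_alg chang) E"
proof -
  have KA: "bounded_K_lattice A" "wajsberg_algebra (neg_cone A)"
    using A by (simp_all add: K_class_def WA_def)
  obtain e where e: "range e \<subseteq> carrier A" "eval A e s \<noteq> eval A e t"
    using nst unfolding satisfies_singleton by blast
  obtain D :: "'a rl" and B where D: "wajsberg_algebra D"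
    and chain: "\<And>x y. x \<in> carrier D \<Longrightarrow> y \<in> carrier D \<Longrightarrow> x \<preceq>\<^bsub>D\<^esub> y \<or> y \<preceq>\<^bsub>D\<^esub> x"
    and B: "subuniverse B (K_alg D)" "carrier D \<times> {\<one>\<^bsub>D\<^esub>} \<subseteq> B"
    and sat: "\<And>E. satisfies A E \<Longrightarrow> satisfies ((K_alg D)\<lparr>carrier := B\<rparr>) E"
    and neq: "\<not> satisfies ((K_alg D)\<lparr>carrier := B\<rparr>) {(s, t)}"
    using representation[OF KA e] by metis
  interpret D: wajsberg_algebra D by fact
  have nt: "\<zero>\<^bsub>D\<^esub> \<noteq> \<one>\<^bsub>D\<^esub>" by (rule D.zero_neq_one[OF B(1) neq])
  show ?thesis
  proof (cases "carrier D = {\<zero>\<^bsub>D\<^esub>, \<one>\<^bsub>D\<^esub>}")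
    case True
    \<comment> \<open>Otherwise B would satisfy s = t together with \<open>K0p 1\<close>.\<close>
    have "(\<zero>\<^bsub>D\<^esub>, \<zero>\<^bsub>D\<^esub>) \<in> B"
      using D.satisfies_two(2)[OF True nt B(1) _ K3] neq by blast
    moreover have "K0_set D \<subseteq> B" by (rule D.K0_set_subset[OF B])
    moreover have "{(\<zero>\<^bsub>D\<^esub>, \<one>\<^bsub>D\<^esub>), (\<one>\<^bsub>D\<^esub>, \<zero>\<^bsub>D\<^esub>), (\<one>\<^bsub>D\<^esub>, \<one>\<^bsub>D\<^esub>)} \<subseteq> K0_set D"
      by (simp add: K0_set_def D.zero_least)
    ultimately have "carrier (K_alg D) \<subseteq> B"
      unfolding K_alg_def using True by auto
    then have "(K_alg D)\<lparr>carrier := B\<rparr> = K_alg D"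
      using B(1) by (auto simp: subuniverse_def)
    then show ?thesis using D.satisfies_K_luk_1[OF nt] sat[OF E] by simp
  next
    case False
    then obtain c where c: "c \<in> carrier D" "c \<noteq> \<zero>\<^bsub>D\<^esub>" "c \<noteq> \<one>\<^bsub>D\<^esub>"
      using D.zero_in D.one_in by blast
    show ?thesis
    proof (cases "\<forall>n. \<exists>a \<in> carrier D. a \<noteq> \<zero>\<^bsub>D\<^esub> \<and> D.nm n a \<preceq>\<^bsub>D\<^esub> D.neg a")
      case True
      then obtain a where "\<And>n. a n \<in> carrier D" "\<And>n. a n \<noteq> \<zero>\<^bsub>D\<^esub>" "\<And>n. D.nm n (a n) \<preceq>\<^bsub>D\<^esub> D.neg (a n)"
        by metis
      from satisfies_K0_chang[of "\<lambda>_. D", OF D this B sat[OF E]] show ?thesis by blast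
    next
      case False
      obtain a n where a: "a \<in> carrier D" "a \<noteq> \<zero>\<^bsub>D\<^esub>" "n \<ge> 1" "D.nm n a = D.neg a"
        by (rule D.archimedean_or_cyclic[OF chain c False])
      have K: "satisfies (K0p (Suc n)) E"
        by (rule D.satisfies_K0p_cyclic[OF a(1,2,4) B sat[OF E]])
      \<comment> \<open>n \<ge> 1 makes n + 1 at least 2.\<close>
      obtain p where p: "prime p" "p dvd Suc n"
        using prime_factor_nat[of "Suc n"] a(3) by auto
      then show ?thesis using satisfies_K0p_dvd[OF p(2) _ K] by auto
    qed
  qed
qed

lemma K_class_BA_eq: "K_class BA = (variety_of (K_alg (luk 1)) :: 'u rl set)"
proof
  show "K_class BA \<subseteq> (variety_of (K_alg (luk 1)) :: 'u rl set)"
  proof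
    fix A :: "'u rl" assume "A \<in> K_class BA"
    then have KA: "bounded_K_lattice A" "boolean_rl (neg_cone A)"
      by (simp_all add: K_class_def BA_def)
    interpret A: bounded_K_lattice A by fact
    interpret C: boolean_rl "neg_cone A" by fact
    have "satisfies A {(s, t)}" if st: "satisfies (K_alg (luk 1)) {(s, t)}" for s t
    proof (rule ccontr)
      assume "\<not> satisfies A {(s, t)}"
      then obtain e where e: "range e \<subseteq> carrier A" "eval A e s \<noteq> eval A e t"
        unfolding satisfies_singleton by blast
      obtain D :: "'u rl" and B where D: "wajsberg_algebra D"
        and chain: "\<And>x y. x \<in> carrier D \<Longrightarrow> y \<in> carrier D \<Longrightarrow> x \<preceq>\<^bsub>D\<^esub> y \<or> y \<preceq>\<^bsub>D\<^esub> x"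
        and B: "subuniverse B (K_alg D)" "carrier D \<times> {\<one>\<^bsub>D\<^esub>} \<subseteq> B"
        and sat: "\<And>E. satisfies A E \<Longrightarrow> satisfies ((K_alg D)\<lparr>carrier := B\<rparr>) E"
        and neq: "\<not> satisfies ((K_alg D)\<lparr>carrier := B\<rparr>) {(s, t)}"
        using representation[OF KA(1) C.wajsberg e] by metis
      interpret D: wajsberg_algebra D by fact
      \<comment> \<open>Excluded middle holds on the cone and passes to D. In a chain x \<curlyvee>
        \<not>x is x or \<not>x, so D has only the elements 0 and 1.\<close>
      let ?l = "Join (Var 0) (Imp (Var 0) Zero)"
      have "satisfies A {(cone ?l, cone One)}"
        unfolding satisfies_singleton
      proof (intro allI impI)
        fix e :: "nat \<Rightarrow> 'u" assume "range e \<subseteq> carrier A"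
        then have "e 0 \<curlywedge>\<^bsub>A\<^esub> \<one>\<^bsub>A\<^esub> \<in> carrier (neg_cone A)"
          by (auto simp: neg_cone_def image_subset_iff)
        from C.join_compl[OF this] show "eval A e (cone ?l) = eval A e (cone One)"
          unfolding eval_cone by simp
      qed
      then have l: "satisfies ((K_alg D)\<lparr>carrier := B\<rparr>) {(cone ?l, cone One)}" by (rule sat)
      have "x = \<zero>\<^bsub>D\<^esub> \<or> x = \<one>\<^bsub>D\<^esub>" if x: "x \<in> carrier D" for x
      proof -
        have "range (\<lambda>_. (x, \<one>\<^bsub>D\<^esub>)) \<subseteq> B" using x B by auto
        then have "eval (K_alg D) (\<lambda>_::nat. (x, \<one>\<^bsub>D\<^esub>)) (cone ?l) = eval (K_alg D) (\<lambda>_. (x, \<one>\<^bsub>D\<^esub>)) (cone One)"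
          using l[unfolded satisfies_singleton, rule_format, of "\<lambda>_. (x, \<one>\<^bsub>D\<^esub>)"]
          unfolding eval_carrier by simp
        then have "x \<curlyvee>\<^bsub>D\<^esub> D.neg x = \<one>\<^bsub>D\<^esub>"
          using x by (simp add: eval_cone_K_alg[OF D.rl_algebra_axioms] D.neg_def del: cone.simps)
        then have "x = \<one>\<^bsub>D\<^esub> \<or> D.neg x = \<one>\<^bsub>D\<^esub>"
          using chain[of x "D.neg x"] x D.le_join_iff D.join_commute by (metis D.neg_in)
        then show ?thesis using D.neg_neg[OF x] D.neg_one by metis
      qed
      then have two: "carrier D = {\<zero>\<^bsub>D\<^esub>, \<one>\<^bsub>D\<^esub>}" by auto
      show False
        using D.satisfies_two(1)[OF two D.zero_neq_one[OF B(1) neq] B(1) st] neq by blast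
    qed
    then show "A \<in> variety_of (K_alg (luk 1))"
      by (simp add: in_variety_of A.rl_algebra_axioms)
  qed
  show "(variety_of (K_alg (luk 1)) :: 'u rl set) \<subseteq> K_class BA"
  proof
    fix A :: "'u rl" assume A: "A \<in> variety_of (K_alg (luk 1))"
    then have "A \<in> K_class WA"
      using variety_of_subset_K_class[OF K_luk_KW_eqs[of 1]] by auto
    then interpret A: bounded_K_lattice A by (simp add: K_class_def)
    have "satisfies (luk 1) {(s, t)}" if "(s, t) \<in> boolean_eqs" for s t
      unfolding satisfies_singleton
    proof (intro allI impI)
      fix e :: "nat \<Rightarrow> real" assume "range e \<subseteq> carrier (luk 1)"
      moreover have "x = 0 \<or> x = 1" if "x \<in> carrier (luk 1)" for x
        using that by (auto simp: carrier_luk le_Suc_eq)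
      ultimately have "e k = 0 \<or> e k = 1" for k by (auto simp: image_subset_iff)
      from this[of 0] this[of 1] this[of 2] that show "eval (luk 1) e s = eval (luk 1) e t"
        by (auto simp: boolean_eqs_def Let_def)
    qed
    then have "satisfies (K_alg (luk 1)) {(cone s, cone t) |s t. (s, t) \<in> boolean_eqs}"
      by (intro satisfies_cones) (simp add: satisfies_cone_K_luk)
    from in_variety_of_E[OF A this] have "boolean_rl (neg_cone A)"
      by (intro boolean_of_eqs A.neg_cone_bounded A.satisfies_neg_cone)
    then show "A \<in> K_class BA"
      using A.bounded_K_lattice_axioms by (simp add: K_class_def BA_def)
  qed
qed

section \<open>Separating equations\<close>

primrec tpow :: "rl_term \<Rightarrow> nat \<Rightarrow> rl_term" where
  "tpow t 0 = One"
| "tpow t (Suc k) = Mult t (tpow t k)"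

text \<open>Truncated multiples, with x \<oplus> y written as \<not>x \<leadsto> y.\<close>

primrec tmul :: "rl_term \<Rightarrow> nat \<Rightarrow> rl_term" where
  "tmul t 0 = Zero"
| "tmul t (Suc k) = Imp (Imp t Zero) (tmul t k)"

lemma eval_luk_tpow:
  assumes "0 \<le> eval (luk n) e t" "eval (luk n) e t \<le> 1"
  shows "eval (luk n) e (tpow t k) = max 0 (1 - real k * (1 - eval (luk n) e t))"
proof (induction k)
  case (Suc k)
  then show ?case using assms by (simp add: algebra_simps)
qed simp

lemma eval_luk_tmul:
  assumes "0 \<le> eval (luk n) e t" "eval (luk n) e t \<le> 1"
  shows "eval (luk n) e (tmul t k) = min 1 (real k * eval (luk n) e t)"
proof (induction k)
  case (Suc k)
  then show ?case using assms by (simp add: algebra_simps)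
qed simp

text \<open>\<open>u \<oplus> v = 1\<close> for the pair \<open>(u, v) = Var 0\<close>.\<close>

definition oplus_eq :: "rl_term \<times> rl_term" where
  "oplus_eq = (Meet (Meet (Imp (Meet (Var 0) One) Zero) One) (Meet (Til (Var 0)) One),
     Meet (Imp (Meet (Var 0) One) Zero) One)"

lemma oplus_eq_K0p:
  assumes "n \<ge> 1" shows "satisfies (K0p n) {oplus_eq}"
  unfolding oplus_eq_def satisfies_singleton
proof (intro allI impI)
  fix e :: "nat \<Rightarrow> _" assume e: "range e \<subseteq> carrier (K0p n)"
  obtain u v where uv: "e 0 = (u, v)" by (cases "e 0")
  have "e 0 \<in> K0_set (luk n)" using e by (auto simp: K0p_eq)
  then have "1 - u \<le> v" "0 \<le> u" "u \<le> 1" "0 \<le> v" "v \<le> 1"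
    using luk_bounds[of u n] luk_bounds[of v n] by (auto simp: uv K0_set_def)
  then show "eval (K0p n) e (Meet (Meet (Imp (Meet (Var 0) One) Zero) One) (Meet (Til (Var 0)) One)) =
      eval (K0p n) e (Meet (Imp (Meet (Var 0) One) Zero) One)"
    unfolding K0p_eq eval_carrier by (simp add: uv)
qed

lemma oplus_eq_K0_chang: "satisfies (K0_alg chang) {oplus_eq}"
  by (rule satisfies_K0_chang_limit) (rule oplus_eq_K0p)

lemma oplus_eq_K_luk: "\<not> satisfies (K_alg (luk 1)) {oplus_eq}"
proof
  assume *: "satisfies (K_alg (luk 1)) {oplus_eq}"
  have "range (\<lambda>_::nat. (0, 0)) \<subseteq> carrier (K_alg (luk 1))"
    using luk_in[of 0 1] by auto
  with * show False
    unfolding oplus_eq_def satisfies_singleton by fastforce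
qed

text \<open>In a chain with n + 1 elements powers are stationary from exponent n on, while in the
  Chang algebra the powers of (1, -1) descend forever.\<close>

definition pow_eq :: "nat \<Rightarrow> rl_term \<times> rl_term" where
  "pow_eq k = (tpow (Var 0) k, tpow (Var 0) (Suc k))"

lemma pow_eq_luk: assumes "n \<ge> 1" shows "satisfies (luk n) {pow_eq n}"
  unfolding pow_eq_def satisfies_singleton
proof (intro allI impI)
  fix e :: "nat \<Rightarrow> _" assume "range e \<subseteq> carrier (luk n)"
  then have "e 0 \<in> carrier (luk n)" by auto
  then obtain k where k: "k \<le> n" "e 0 = real k / real n" by (auto simp: carrier_luk)
  have b: "0 \<le> eval (luk n) e (Var 0)" "eval (luk n) e (Var 0) \<le> 1"
    using luk_bounds[OF \<open>e 0 \<in> _\<close>] by simp_all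
  show "eval (luk n) e (tpow (Var 0) n) = eval (luk n) e (tpow (Var 0) (Suc n))"
  proof (cases "k = n")
    case True
    then show ?thesis
      unfolding eval_luk_tpow[OF b] using k assms by simp
  next
    case False
    then have "real n * (1 - e 0) \<ge> 1"
      using k assms by (simp add: algebra_simps)
    then show ?thesis
      unfolding eval_luk_tpow[OF b] using b by (simp add: algebra_simps)
  qed
qed

lemma not_pow_eq_1_luk: assumes "n \<ge> 2" shows "\<not> satisfies (luk n) {pow_eq 1}"
proof
  let ?e = "\<lambda>_::nat. real (n - 1) / real n"
  assume *: "satisfies (luk n) {pow_eq 1}"
  have "range ?e \<subseteq> carrier (luk n)" using luk_in[of "n - 1" n] by auto
  with * have "eval (luk n) ?e (tpow (Var 0) 1) = eval (luk n) ?e (tpow (Var 0) (Suc 1))"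
    unfolding pow_eq_def satisfies_singleton by blast
  moreover have b: "0 \<le> eval (luk n) ?e (Var 0)" "eval (luk n) ?e (Var 0) \<le> 1"
    by (simp_all add: divide_simps)
  ultimately show False
    unfolding eval_luk_tpow[OF b] using assms
    by (simp add: of_nat_diff field_simps max_def split: if_splits)
qed

lemma not_pow_eq_chang: "\<not> satisfies chang {pow_eq k}"
proof
  let ?e = "\<lambda>_::nat. (1, -1) :: int \<times> int"
  assume *: "satisfies chang {pow_eq k}"
  have "range ?e \<subseteq> carrier chang" by (auto simp: chang_def)
  with * have "eval chang ?e (tpow (Var 0) k) = eval chang ?e (tpow (Var 0) (Suc k))"
    unfolding pow_eq_def satisfies_singleton by blast
  moreover have "eval chang ?e (tpow (Var 0) j) = (1, - int j)" for j
    by (induction j) (auto simp: max_def)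
  ultimately show False by simp
qed

text \<open>\<open>((p - 1)x \<leftrightarrow> \<not> x)\<^sup>k = 0\<close>, which says that \<open>x\<close> is not the fraction \<open>1/p\<close>.\<close>

definition div_eq :: "nat \<Rightarrow> nat \<Rightarrow> rl_term \<times> rl_term" where
  "div_eq p k = (tpow (Mult (Imp (tmul (Var 0) (p - 1)) (Imp (Var 0) Zero))
      (Imp (Imp (Var 0) Zero) (tmul (Var 0) (p - 1)))) k, Zero)"

lemma min_one_mult_divide:
  assumes "q \<ge> 1"
  shows "min 1 (real j * (real k / real q)) = real (min q (j * k)) / real q"
proof -
  have "min 1 (real j * (real k / real q)) = min (real q / real q) (real (j * k) / real q)"
    using assms by simp
  also have "\<dots> = min (real q) (real (j * k)) / real q"
    by (simp add: min_divide_distrib_right)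
  finally show ?thesis by (simp only: of_nat_min)
qed

lemma luk_biimp_le:
  fixes u v c :: real
  assumes "0 \<le> u" "u \<le> 1" "0 \<le> v" "v \<le> 1" "c \<le> \<bar>u - v\<bar>" "c \<le> 1"
  shows "max 0 (min 1 (1 - u + v) + min 1 (1 - v + u) - 1) \<le> 1 - c"
  using assms by (auto simp: max_def min_def abs_if split: if_splits)

text \<open>No x in \<open>luk q\<close> solves (p-1)x = \<not>x. Distinct elements differ by at
  least 1/q, so the biimplication is at most 1 - 1/q and its q-th power is 0; this is where the
  exponent q comes from.\<close>

lemma div_eq_luk: assumes "\<not> p dvd q" "q \<ge> 1" "p \<ge> 1" shows "satisfies (luk q) {div_eq p q}"
  unfolding div_eq_def satisfies_singleton
proof (intro allI impI)
  fix e :: "nat \<Rightarrow> _" assume "range e \<subseteq> carrier (luk q)"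
  then have "e 0 \<in> carrier (luk q)" by auto
  then obtain k where k: "k \<le> q" "e 0 = real k / real q" by (auto simp: carrier_luk)
  let ?m = "tmul (Var 0) (p - 1)" and ?n = "Imp (Var 0) Zero"
  let ?d = "Mult (Imp ?m ?n) (Imp ?n ?m)"
  have b: "0 \<le> eval (luk q) e (Var 0)" "eval (luk q) e (Var 0) \<le> 1"
    using luk_bounds[OF \<open>e 0 \<in> _\<close>] by simp_all
  have m: "eval (luk q) e ?m = real (min q ((p - 1) * k)) / real q"
    unfolding eval_luk_tmul[OF b] eval.simps(1) k(2) by (rule min_one_mult_divide[OF assms(2)])
  have n: "eval (luk q) e ?n = real (q - k) / real q"
  proof -
    have "eval (luk q) e ?n = 1 - real k / real q" using b k(2) by simp
    also have "\<dots> = real (q - k) / real q" using k(1) assms by (simp add: of_nat_diff diff_divide_distrib)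
    finally show ?thesis .
  qed
  \<comment> \<open>For x = k/q, equality of the two numerators would give q = pk.\<close>
  have ne: "min q ((p - 1) * k) \<noteq> q - k"
  proof
    assume *: "min q ((p - 1) * k) = q - k"
    have "q = p * k"
    proof (cases "k = 0")
      case True
      then show ?thesis using * assms by simp
    next
      case False
      then have "(p - 1) * k = q - k" using * k assms by (simp add: min_def split: if_splits)
      then have "(p - 1) * k + k = q" using k by simp
      moreover have "(p - 1) * k + k = p * k" using assms by (cases p) auto
      ultimately show ?thesis by simp
    qed
    then show False using assms by simp
  qed
  let ?u = "min q ((p - 1) * k)" and ?v = "q - k"
  have "\<bar>real ?u - real ?v\<bar> \<ge> 1" using ne by linarith
  then have "\<bar>real ?u / real q - real ?v / real q\<bar> \<ge> 1 / real q"
    using assms by (simp add: divide_simps abs_if split: if_splits)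
  moreover have "0 \<le> real ?u / real q" "real ?u / real q \<le> 1" "0 \<le> real ?v / real q" "real ?v / real q \<le> 1"
    using assms by (auto simp: divide_simps)
  ultimately have "eval (luk q) e ?d \<le> 1 - 1 / real q"
    unfolding eval.simps(4) eval.simps(5)[of _ _ ?m ?n] eval.simps(5)[of _ _ ?n ?m] m n luk_simps
    using assms by (intro luk_biimp_le) auto
  moreover have "0 \<le> eval (luk q) e ?d"
    unfolding eval.simps(4) luk_simps by simp
  moreover have "0 \<le> 1 / real q" by simp
  ultimately have d: "0 \<le> eval (luk q) e ?d" "eval (luk q) e ?d \<le> 1 - 1 / real q" "eval (luk q) e ?d \<le> 1"
    by linarith+
  have "real q * (1 - y) \<ge> 1" if "y \<le> 1 - 1 / real q" for y
    using that assms by (simp add: field_simps)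
  from this[OF d(2)] have "max 0 (1 - real q * (1 - eval (luk q) e ?d)) = 0"
    by (intro max_absorb1) (simp only: diff_le_0_iff_le)
  then show "eval (luk q) e (tpow ?d q) = eval (luk q) e Zero"
    unfolding eval_luk_tpow[OF d(1,3)] eval.simps(6) luk_simps .
qed

lemma not_div_eq_luk: assumes "p \<ge> 1" shows "\<not> satisfies (luk p) {div_eq p k}"
proof
  \<comment> \<open>At x = 1/p both (p-1)x and \<not>x are 1 - 1/p, so the biimplication and all its
    powers are 1.\<close>
  let ?e = "\<lambda>_::nat. 1 / real p"
  let ?m = "tmul (Var 0) (p - 1)" and ?n = "Imp (Var 0) Zero"
  let ?d = "Mult (Imp ?m ?n) (Imp ?n ?m)"
  assume *: "satisfies (luk p) {div_eq p k}"
  have "range ?e \<subseteq> carrier (luk p)" using luk_in[of 1 p] assms by auto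
  with * have "eval (luk p) ?e (tpow ?d k) = eval (luk p) ?e Zero"
    unfolding div_eq_def satisfies_singleton by blast
  moreover have b: "0 \<le> eval (luk p) ?e (Var 0)" "eval (luk p) ?e (Var 0) \<le> 1"
    using assms by (simp_all add: divide_simps)
  have "eval (luk p) ?e ?m = 1 - 1 / real p"
    unfolding eval_luk_tmul[OF b] using assms by (simp add: of_nat_diff divide_simps min_def)
  moreover have "eval (luk p) ?e ?n = 1 - 1 / real p"
    using b by simp
  ultimately have d: "eval (luk p) ?e ?d = 1"
    unfolding eval.simps(4,5) luk_simps by simp
  show False
    using \<open>eval (luk p) ?e (tpow ?d k) = _\<close> d eval_luk_tpow[of p ?e ?d k] by simp
qed

text \<open>The equation \<open>2x\<^sup>2 = (2x)\<^sup>2\<close> of perfect MV-algebras.\<close>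

definition perfect_eq :: "rl_term \<times> rl_term" where
  "perfect_eq = (tmul (tpow (Var 0) 2) 2, tpow (tmul (Var 0) 2) 2)"

lemma eval_chang_two:
  assumes "eval chang e t \<in> carrier chang"
  shows "eval chang e (tpow t 2) = max (0, 0) (eval chang e t + eval chang e t - (1, 0))"
    "eval chang e (tmul t 2) = min (1, 0) (eval chang e t + eval chang e t)"
  by (cases rule: chang_cases[OF assms];
      simp add: numeral_2_eq_2 max_def min_def zero_prod_def)+

text \<open>Both sides are 0 on the infinitesimals and 1 on their negations.\<close>

lemma perfect_eq_chang: "satisfies chang {perfect_eq}"
  unfolding perfect_eq_def satisfies_singleton
proof (intro allI impI)
  fix e :: "nat \<Rightarrow> _" assume e: "range e \<subseteq> carrier chang"
  then have e0: "e 0 \<in> carrier chang" by auto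
  show "eval chang e (tmul (tpow (Var 0) 2) 2) = eval chang e (tpow (tmul (Var 0) 2) 2)"
    unfolding eval_chang_two[OF eval_closed[OF rl_algebra_chang e]] eval.simps(1)
    by (cases rule: chang_cases[OF e0]) (simp_all add: max_def min_def zero_prod_def)
qed

lemma not_perfect_eq_luk: assumes "n \<ge> 2" shows "\<not> satisfies (luk n) {perfect_eq}"
proof
  \<comment> \<open>This x lies in the interval from 1/4 (excluded) to 1/2, where xx = 0 but the
    square of 2x is 4x - 1 > 0.\<close>
  define x where "x = real (n div 2) / real n"
  let ?e = "\<lambda>_::nat. x"
  assume *: "satisfies (luk n) {perfect_eq}"
  have "range ?e \<subseteq> carrier (luk n)" using luk_in[of "n div 2" n] by (auto simp: x_def)
  with * have eq: "eval (luk n) ?e (tmul (tpow (Var 0) 2) 2) = eval (luk n) ?e (tpow (tmul (Var 0) 2) 2)"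
    unfolding perfect_eq_def satisfies_singleton by blast
  have "n div 2 * 2 \<le> n" "n < 4 * (n div 2)"
    using assms by presburger+
  then have "real (n div 2) * 2 \<le> real n" "real n < 4 * real (n div 2)"
    by linarith+
  then have x: "0 \<le> x" "x \<le> 1 / 2" "1 / 4 < x"
    using assms by (simp_all add: x_def field_simps)
  have "eval (luk n) ?e (tpow (Var 0) 2) = 0"
    using x eval_luk_tpow[of n ?e "Var 0" 2] by simp
  then have "eval (luk n) ?e (tmul (tpow (Var 0) 2) 2) = 0"
    using eval_luk_tmul[of n ?e "tpow (Var 0) 2" 2] by simp
  moreover have m: "eval (luk n) ?e (tmul (Var 0) 2) = 2 * x"
    using x eval_luk_tmul[of n ?e "Var 0" 2] by simp
  then have "eval (luk n) ?e (tpow (tmul (Var 0) 2) 2) = 4 * x - 1"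
    using x eval_luk_tpow[of n ?e "tmul (Var 0) 2" 2] by simp
  ultimately show False using eq x by simp
qed

section \<open>Covers and atoms among the subvarieties\<close>

lemma covered_in_minimal:
  assumes "U \<in> L" "XS \<subseteq> L" "\<And>X. X \<in> XS \<Longrightarrow> U \<subset> X"
    and anti: "\<And>X Y. X \<in> XS \<Longrightarrow> Y \<in> XS \<Longrightarrow> X \<subseteq> Y \<Longrightarrow> X = Y"
    and above: "\<And>V. V \<in> L \<Longrightarrow> U \<subset> V \<Longrightarrow> \<exists>X \<in> XS. X \<subseteq> V"
  shows "{V. covered_in L U V} = XS"
proof (intro equalityI subsetI)
  fix V assume "V \<in> {V. covered_in L U V}"
  then have V: "V \<in> L" "U \<subset> V" "\<And>W. W \<in> L \<Longrightarrow> U \<subset> W \<Longrightarrow> \<not> W \<subset> V"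
    by (auto simp: covered_in_def)
  obtain X where "X \<in> XS" "X \<subseteq> V" using above V by blast
  then have "X = V" using V assms(2,3) by (metis psubsetI subsetD)
  then show "V \<in> XS" using \<open>X \<in> XS\<close> by simp
next
  fix X assume X: "X \<in> XS"
  have "\<not> W \<subset> X" if W: "W \<in> L" "U \<subset> W" for W
  proof
    assume "W \<subset> X"
    obtain Y where Y: "Y \<in> XS" "Y \<subseteq> W" using above W by blast
    then have "Y = X" using anti X \<open>W \<subset> X\<close> by blast
    then show False using Y \<open>W \<subset> X\<close> by blast
  qed
  then show "X \<in> {V. covered_in L U V}"
    using X assms(1-3) by (auto simp: covered_in_def)
qed

lemma trivial_satisfies:
  assumes A: "rl_algebra A" and triv: "satisfies A {(Var 0, Var 1)}"
  shows "satisfies A E"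
  unfolding satisfies_def
proof safe
  fix s t and e :: "nat \<Rightarrow> _" assume e: "range e \<subseteq> carrier A"
  let ?f = "\<lambda>n::nat. if n = 0 then eval A e s else eval A e t"
  have "range ?f \<subseteq> carrier A" using eval_closed[OF A e] by auto
  then have "eval A ?f (Var 0) = eval A ?f (Var 1)"
    using triv unfolding satisfies_singleton by blast
  then show "eval A e s = eval A e t" by simp
qed

text \<open>The variety of x = y is the least member, and by \<open>nontrivial_K0p_1\<close> the
  variety of \<open>K0p 1\<close> lies below all others, so it is the only cover of the
  bottom.\<close>

lemma atom_iff:
  fixes U :: "'u rl set"
  assumes inf: "infinite (UNIV :: 'u set)"
  shows "atom_in (subvarieties (K_class WA)) U \<longleftrightarrow> U = variety_of (K0p 1)"
proof -
  let ?L = "subvarieties (K_class WA) :: 'u rl set set"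
  let ?U = "variety_of (K0p 1) :: 'u rl set"
  let ?b = "models {(Var 0, Var 1)} :: 'u rl set"
  have b: "?b \<in> ?L"
  proof -
    have "A \<in> K_class WA" if "A \<in> ?b" for A
      using that KW_eqs_sound[of A] trivial_satisfies[of A KW_eqs] by (simp add: models_def)
    then show ?thesis unfolding subvarieties_def variety_def by blast
  qed
  have least: "?b \<subseteq> W" if W: "W \<in> ?L" for W
  proof -
    obtain E where "W = models E" using W by (auto simp: subvarieties_def variety_def)
    then show ?thesis using trivial_satisfies by (auto simp: models_def)
  qed
  have U: "?U \<in> ?L"
    using variety_variety_of variety_of_subset_K_class[OF K0p_KW_eqs[of 1]] by (auto simp: subvarieties_def)
  have above: "?U \<subseteq> W" if W: "W \<in> ?L" "?b \<subset> W" for W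
  proof -
    obtain E where E: "W = models E" using W by (auto simp: subvarieties_def variety_def)
    obtain A where A: "A \<in> W" "A \<notin> ?b" using W by blast
    then have "A \<in> K_class WA" "\<not> satisfies A {(Var 0, Var 1)}" "satisfies A E"
      using W E by (auto simp: subvarieties_def models_def)
    then have "satisfies (K0p 1) E" by (rule nontrivial_K0p_1)
    then show ?thesis using variety_of_subset E by blast
  qed
  have nt: "?b \<subset> ?U"
  proof -
    have "\<not> satisfies (K0p 1) {(Var 0, Var 1)}"
    proof
      assume *: "satisfies (K0p 1) {(Var 0, Var 1)}"
      have "\<zero>\<^bsub>K0p 1\<^esub> \<in> carrier (K0p 1)" "\<one>\<^bsub>K0p 1\<^esub> \<in> carrier (K0p 1)"
        using rl_algebra_K0p[of 1] by (auto intro: rl_algebra.zero_in rl_algebra.one_in)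
      then have "range (\<lambda>n::nat. if n = 0 then \<zero>\<^bsub>K0p 1\<^esub> else \<one>\<^bsub>K0p 1\<^esub>) \<subseteq> carrier (K0p 1)" by auto
      from *[unfolded satisfies_singleton, rule_format, OF this]
      have "\<zero>\<^bsub>K0p 1\<^esub> = \<one>\<^bsub>K0p 1\<^esub>" by simp
      then show False by (simp add: K0p_eq)
    qed
    from countable_refutation[OF inf rl_algebra_K0p this] obtain A :: "'u rl"
      where "A \<in> ?U" "\<not> satisfies A {(Var 0, Var 1)}" by auto
    then have "A \<in> ?U" "A \<notin> ?b" by (simp_all add: models_def)
    then show ?thesis using least[OF U] by blast
  qed
  show ?thesis
  proof
    assume "atom_in ?L U"
    then obtain b where "b \<in> ?L" "\<And>W. W \<in> ?L \<Longrightarrow> b \<subseteq> W" and c: "covered_in ?L b U"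
      unfolding atom_in_def by blast
    then have "b = ?b" using b least by blast
    then have "U \<in> ?L" "?b \<subset> U" "\<not> (?b \<subset> ?U \<and> ?U \<subset> U)"
      using c U unfolding covered_in_def by blast+
    then show "U = ?U" using above nt by blast
  next
    assume "U = ?U"
    moreover have "\<not> W \<subset> ?U" if "W \<in> ?L" "?b \<subset> W" for W
      using above[OF that] by blast
    ultimately show "atom_in ?L U"
      unfolding atom_in_def covered_in_def using b least U nt by blast
  qed
qed

theorem theorem3p1:
  assumes "infinite (UNIV :: 'u set)"
  shows "{V :: 'u rl set. almost_minimal (subvarieties (K_class WA)) V} =
    {K_class BA} \<union> {variety_of (K0p p) |p. prime p} \<union> {variety_of (K0_alg chang)}"
proof -
  let ?L = "subvarieties (K_class WA) :: 'u rl set set"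
  let ?U = "variety_of (K0p 1) :: 'u rl set"
  let ?B = "variety_of (K_alg (luk 1)) :: 'u rl set"
  let ?C = "variety_of (K0_alg chang) :: 'u rl set"
  let ?P = "\<lambda>p. variety_of (K0p p) :: 'u rl set"
  let ?XS = "{?B} \<union> {?P p |p. prime p} \<union> {?C}"
  have L: "variety_of X \<in> ?L" if "satisfies X KW_eqs" for X :: "'x rl"
    using variety_variety_of variety_of_subset_K_class[OF that] by (auto simp: subvarieties_def)
  have LC: "?C \<in> ?L"
    using variety_variety_of variety_of_subset_K_class[OF K0_chang_KW_eqs] by (auto simp: subvarieties_def)
  note sep = variety_of_not_subset[OF assms]
  have alg: "rl_algebra (K_alg (luk 1))" "rl_algebra (K0p p)" if "p \<ge> 1" for p
    using that rl_algebra_K_alg rl_algebra_luk rl_algebra_K0p by auto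
  have cone1: "satisfies (K_alg (luk 1)) {(cone s, cone t)}" "satisfies (K0p 1) {(cone s, cone t)}"
    if "satisfies (luk 1) {(s, t)}" for s t
    using that satisfies_cone_K_luk[of 1] satisfies_cone_K0p[of 1] by auto
  \<comment> \<open>K(2) contains (0, 0), which violates \<open>oplus_eq\<close>; the equation holds
    in all \<open>K0p p\<close> and in \<open>K0_alg chang\<close>.\<close>
  have BP: "\<not> ?B \<subseteq> ?P p" if "p \<ge> 1" for p
    using sep[OF alg(1)[of 1], of "fst oplus_eq" "snd oplus_eq"] oplus_eq_K_luk oplus_eq_K0p[OF that] by simp
  have BC: "\<not> ?B \<subseteq> ?C"
    using sep[OF alg(1)[of 1], of "fst oplus_eq" "snd oplus_eq"] oplus_eq_K_luk oplus_eq_K0_chang by simp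
  \<comment> \<open>x = xx holds in \<open>luk 1\<close> and in no longer chain.\<close>
  have PB: "\<not> ?P p \<subseteq> ?B" "\<not> ?P p \<subseteq> ?U" if p: "prime p" for p
  proof -
    have p2: "p \<ge> 2" using p by (rule prime_ge_2_nat)
    have "\<not> satisfies (K0p p) {(cone (fst (pow_eq 1)), cone (snd (pow_eq 1)))}"
      using satisfies_cone_K0p[of p] not_pow_eq_1_luk[OF p2] p2 by simp
    from sep[OF _ this] cone1[of "fst (pow_eq 1)" "snd (pow_eq 1)"] pow_eq_luk[of 1] alg p2
    show "\<not> ?P p \<subseteq> ?B" "\<not> ?P p \<subseteq> ?U" by auto
  qed
  \<comment> \<open>\<open>luk p\<close> satisfies \<open>pow_eq p\<close>, whereas
    \<open>chang\<close> satisfies no \<open>pow_eq k\<close>.\<close>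
  have CB: "\<not> ?C \<subseteq> ?B" and CP: "\<not> ?C \<subseteq> ?P p" if p: "p \<ge> 1" for p
  proof -
    have *: "\<not> satisfies (K0_alg chang) {(cone (fst (pow_eq k)), cone (snd (pow_eq k)))}" for k
      using satisfies_cone_K0_chang not_pow_eq_chang by simp
    show "\<not> ?C \<subseteq> ?B"
      by (rule sep[OF rl_algebra_K0_chang *[of 1] cone1(1)]) (simp add: pow_eq_luk)
    have "satisfies (K0p p) {(cone (fst (pow_eq p)), cone (snd (pow_eq p)))}"
      using satisfies_cone_K0p[OF p] pow_eq_luk[OF p] by simp
    then show "\<not> ?C \<subseteq> ?P p"
      by (rule sep[OF rl_algebra_K0_chang *[of p]])
  qed
  have PC: "\<not> ?P p \<subseteq> ?C" if p: "prime p" for p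
  proof -
    have p2: "p \<ge> 2" using p by (rule prime_ge_2_nat)
    have "\<not> satisfies (K0p p) {(cone (fst perfect_eq), cone (snd perfect_eq))}"
      using satisfies_cone_K0p[of p] not_perfect_eq_luk[OF p2] p2 by simp
    moreover have "satisfies (K0_alg chang) {(cone (fst perfect_eq), cone (snd perfect_eq))}"
      using satisfies_cone_K0_chang perfect_eq_chang by simp
    ultimately show ?thesis
      using sep[of "K0p p"] rl_algebra_K0p[of p] p2 by simp
  qed
  \<comment> \<open>\<open>div_eq p q\<close> holds in \<open>luk q\<close>, since the prime p does
    not divide q, and fails in \<open>luk p\<close>.\<close>
  have PP: "p = q" if pq: "prime p" "prime q" "?P p \<subseteq> ?P q" for p q
  proof (rule ccontr)
    assume "p \<noteq> q"
    have p1: "p \<ge> 1" "q \<ge> 1" using pq prime_ge_1_nat by auto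
    have "\<not> p dvd q" using pq \<open>p \<noteq> q\<close> primes_dvd_imp_eq by blast
    then have "satisfies (K0p q) {(cone (fst (div_eq p q)), cone (snd (div_eq p q)))}"
      using satisfies_cone_K0p[OF p1(2)] div_eq_luk p1 by simp
    moreover have "\<not> satisfies (K0p p) {(cone (fst (div_eq p q)), cone (snd (div_eq p q)))}"
      using satisfies_cone_K0p[OF p1(1)] not_div_eq_luk[OF p1(1)] by simp
    ultimately show False using sep[OF alg(2)[OF p1(1)]] pq(3) by blast
  qed
  have "{V. covered_in ?L ?U V} = ?XS"
  proof (rule covered_in_minimal)
    show U: "?U \<in> ?L" by (rule L) (simp add: K0p_KW_eqs)
    show XS: "?XS \<subseteq> ?L"
      using LC L K_luk_KW_eqs K0p_KW_eqs prime_ge_1_nat by fastforce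
    show "?U \<subset> X" if X: "X \<in> ?XS" for X
    proof -
      have nsub: "\<not> X \<subseteq> ?U"
        using X BP[of 1] PB(2) CP[of 1] by auto
      \<comment> \<open>X is not contained in the atom, so it has a nontrivial member, and the atom
        lies below every nontrivial subvariety.\<close>
      moreover have "?U \<subseteq> X"
      proof -
        have "X \<in> ?L" using X XS by blast
        then obtain E where E: "X = models E" by (auto simp: subvarieties_def variety_def)
        obtain A where A: "A \<in> X" "A \<notin> ?U" using nsub by blast
        then have AK: "A \<in> K_class WA" "satisfies A E" "rl_algebra A"
          using \<open>X \<in> ?L\<close> E by (auto simp: subvarieties_def models_def)
        have "\<not> satisfies A {(Var 0, Var 1)}"
          using A(2) trivial_satisfies[OF AK(3)] AK(3) by (auto simp: in_variety_of)
        then have "satisfies (K0p 1) E" using nontrivial_K0p_1 AK by blast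
        then show ?thesis using variety_of_subset E by blast
      qed
      ultimately show ?thesis by blast
    qed
    show "X = Y" if XY: "X \<in> ?XS" "Y \<in> ?XS" "X \<subseteq> Y" for X Y
    proof -
      have "X = ?B \<or> (\<exists>p. prime p \<and> X = ?P p) \<or> X = ?C" "Y = ?B \<or> (\<exists>p. prime p \<and> Y = ?P p) \<or> Y = ?C"
        using XY(1,2) by auto
      then show ?thesis
      proof (elim disjE exE conjE)
        fix p q assume "prime p" "X = ?P p" "prime q" "Y = ?P q"
        then show ?thesis using XY(3) PP[of p q] by simp
      qed (use XY(3) BP[OF prime_ge_1_nat] BC PB(1) CB[of 1] CP[OF prime_ge_1_nat] PC in simp_all)
    qed
    show "\<exists>X \<in> ?XS. X \<subseteq> V" if V: "V \<in> ?L" "?U \<subset> V" for V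
    proof -
      obtain E where E: "V = models E" using V(1) by (auto simp: subvarieties_def variety_def)
      obtain A where A: "A \<in> V" "A \<notin> ?U" using V by blast
      then have AK: "A \<in> K_class WA" "satisfies A E" "rl_algebra A"
        using V E by (auto simp: subvarieties_def models_def)
      then obtain s t where "satisfies (K0p 1) {(s, t)}" "\<not> satisfies A {(s, t)}"
        using A by (auto simp: in_variety_of)
      from K_class_WA_cases[OF AK(1) this AK(2)] show ?thesis
      proof (elim disjE exE conjE)
        assume "satisfies (K_alg (luk 1)) E"
        then have "?B \<subseteq> V" unfolding E by (rule variety_of_subset)
        then show ?thesis by simp
      next
        fix p assume "prime p" and "satisfies (K0p p) E"
        then have "?P p \<subseteq> V" unfolding E by (intro variety_of_subset)
        then show ?thesis using \<open>prime p\<close> by (intro bexI[of _ "?P p"]) auto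
      next
        assume "satisfies (K0_alg chang) E"
        then have "?C \<subseteq> V" unfolding E by (rule variety_of_subset)
        then show ?thesis by simp
      qed
    qed
  qed
  then show ?thesis
    by (simp add: almost_minimal_def atom_iff[OF assms] K_class_BA_eq)
qed

end
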